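(* Let $G=G_1\ast_A G_2$ be an amalgam of finite groups. There exists an algorithm which, given $h_1,\ldots,h_k\in G$, decides whether or not the subgroup $H=\langle h_1,\ldots,h_k\rangle$ is malnormal in $G$. If $H$ is not malnormal, the algorithm produces a nontrivial element $g\in G\setminus H$ such that $H\cap gHg^{-1}\neq\{1\}$.
   Context: A subgroup $H$ of $G$ is malnormal if $gHg^{-1}\cap H=\{1\}$ for all $g\in G\setminus H$. $G=G_1\ast_A G_2$ is a free product with amalgamation, where $G_1=\langle X_1\mid R_1\rangle$ and $G_2=\langle X_2\mid R_2\rangle$ are finite groups given by finite presentations with $X_1^{\pm}\cap X_2^{\pm}=\emptyset$, $A$ is a group generated by $Y$ with monomorphisms $\phi_i:A\to G_i$ ($i=1,2$), and $G=\langle X_1\cup X_2\mid R_1,R_2,\ \phi_1(a)=\phi_2(a)\ (a\in Y)\rangle$. The amalgam (the finite groups $G_1,G_2,A$, their presentations, the monomorphisms) is fixed and known to the algorithm. Elements of $G$ are input and output as words in the letters $X^{\pm}$, where $X=X_1\cup X_2$. *)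

theory Defs
  imports "HOL-Algebra.Generated_Groups" "HOL-Library.Nat_Bijection"
begin

section \<open>Group presentations\<close>

text \<open>
  A letter \<open>(x, True)\<close> stands for the generator \<open>x\<close> and \<open>(x, False)\<close> for its formal inverse.
\<close>

type_synonym 'x word = "('x \<times> bool) list"

definition words :: "'x set \<Rightarrow> 'x word set" where
  "words X = lists (X \<times> UNIV)"

definition inv_word :: "'x word \<Rightarrow> 'x word" where
  "inv_word w = rev (map (\<lambda>(x, b). (x, \<not> b)) w)"

text \<open>
  The group presented by generators \<open>X\<close> and relators \<open>R\<close> is the set of words over \<open>X\<close> modulo the
  least congruence that cancels adjacent inverse letters and kills the relators.
\<close>

inductive_set pres_rel :: "'x set \<Rightarrow> 'x word set \<Rightarrow> ('x word \<times> 'x word) set" for X R where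
  refl: "w \<in> words X \<Longrightarrow> (w, w) \<in> pres_rel X R"
| sym: "(u, v) \<in> pres_rel X R \<Longrightarrow> (v, u) \<in> pres_rel X R"
| trans: "(u, v) \<in> pres_rel X R \<Longrightarrow> (v, w) \<in> pres_rel X R \<Longrightarrow> (u, w) \<in> pres_rel X R"
| append: "(u, u') \<in> pres_rel X R \<Longrightarrow> (v, v') \<in> pres_rel X R \<Longrightarrow> (u @ v, u' @ v') \<in> pres_rel X R"
| cancel: "x \<in> X \<Longrightarrow> ([(x, b), (x, \<not> b)], []) \<in> pres_rel X R"
| relator: "r \<in> R \<Longrightarrow> r \<in> words X \<Longrightarrow> (r, []) \<in> pres_rel X R"

definition word_class :: "'x set \<Rightarrow> 'x word set \<Rightarrow> 'x word \<Rightarrow> 'x word set" where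
  "word_class X R w = pres_rel X R `` {w}"

definition presented_group :: "'x set \<Rightarrow> 'x word set \<Rightarrow> 'x word set monoid" where
  "presented_group X R =
     \<lparr> carrier = words X // pres_rel X R,
       mult = (\<lambda>U V. \<Union>u\<in>U. \<Union>v\<in>V. word_class X R (u @ v)),
       one = word_class X R [] \<rparr>"

lemma pres_rel_words: "(u, v) \<in> pres_rel X R \<Longrightarrow> u \<in> words X \<and> v \<in> words X"
  by (induction rule: pres_rel.induct) (auto simp: words_def)

lemma equiv_pres_rel: "equiv (words X) (pres_rel X R)"
  by (intro equivI refl_onI symI transI)
     (auto intro: pres_rel.refl pres_rel.sym pres_rel.trans dest: pres_rel_words)

lemma word_class_eq_iff:
  "u \<in> words X \<Longrightarrow> v \<in> words X \<Longrightarrow>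
     word_class X R u = word_class X R v \<longleftrightarrow> (u, v) \<in> pres_rel X R"
  unfolding word_class_def using eq_equiv_class_iff[OF equiv_pres_rel] by fast

lemma words_append: "u \<in> words X \<Longrightarrow> v \<in> words X \<Longrightarrow> u @ v \<in> words X"
  by (auto simp: words_def)

lemma inv_word_words: "w \<in> words X \<Longrightarrow> inv_word w \<in> words X"
  by (auto simp: words_def inv_word_def)

lemma inv_word_left: "w \<in> words X \<Longrightarrow> (inv_word w @ w, []) \<in> pres_rel X R"
proof (induction w)
  case Nil
  then show ?case by (simp add: inv_word_def pres_rel.refl)
next
  case (Cons l w)
  obtain x b where l: "l = (x, b)" by (cases l)
  have x: "x \<in> X" and w: "w \<in> words X"
    using Cons.prems l by (auto simp: words_def)
  have mid: "([(x, \<not> b), (x, b)], []) \<in> pres_rel X R"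
    using pres_rel.cancel[OF x, of "\<not> b"] by simp
  have "(inv_word w @ ([(x, \<not> b), (x, b)] @ w), inv_word w @ ([] @ w)) \<in> pres_rel X R"
    by (intro pres_rel.append mid pres_rel.refl inv_word_words w)
  with Cons.IH[OF w] show ?case
    by (auto simp: inv_word_def l intro: pres_rel.trans)
qed

lemma word_class_closed: "w \<in> words X \<Longrightarrow> word_class X R w \<in> carrier (presented_group X R)"
  by (auto simp: presented_group_def word_class_def intro: quotientI)

lemma presented_group_elem:
  assumes "U \<in> carrier (presented_group X R)"
  obtains u where "u \<in> words X" "U = word_class X R u"
  using assms by (auto simp: presented_group_def word_class_def elim: quotientE)

lemma word_class_mult:
  assumes "u \<in> words X" "v \<in> words X"
  shows "word_class X R u \<otimes>\<^bsub>presented_group X R\<^esub> word_class X R v = word_class X R (u @ v)"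
proof -
  have eq: "word_class X R (u' @ v') = word_class X R (u @ v)"
    if "u' \<in> word_class X R u" "v' \<in> word_class X R v" for u' v'
  proof -
    from that have "(u @ v, u' @ v') \<in> pres_rel X R"
      by (simp add: word_class_def pres_rel.append)
    then show ?thesis
      using equiv_class_eq[OF equiv_pres_rel] unfolding word_class_def by blast
  qed
  have "u \<in> word_class X R u" "v \<in> word_class X R v"
    using assms by (simp_all add: word_class_def pres_rel.refl)
  then have "(\<Union>u'\<in>word_class X R u. \<Union>v'\<in>word_class X R v. word_class X R (u' @ v')) =
      word_class X R (u @ v)"
    using eq by blast
  then show ?thesis
    by (simp add: presented_group_def)
qed

lemma group_presented_group: "group (presented_group X R)"
proof (rule groupI)
  have nil: "[] \<in> words X" by (simp add: words_def)
  have one: "\<one>\<^bsub>presented_group X R\<^esub> = word_class X R []"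
    by (simp add: presented_group_def)
  show "\<one>\<^bsub>presented_group X R\<^esub> \<in> carrier (presented_group X R)"
    using word_class_closed[OF nil] by (simp add: one)
  fix U assume U: "U \<in> carrier (presented_group X R)"
  then obtain u where u: "u \<in> words X" "U = word_class X R u"
    by (rule presented_group_elem)
  show "\<one>\<^bsub>presented_group X R\<^esub> \<otimes>\<^bsub>presented_group X R\<^esub> U = U"
    using word_class_mult[OF nil u(1)] by (simp add: one u(2))
  have "word_class X R (inv_word u) \<otimes>\<^bsub>presented_group X R\<^esub> U = \<one>\<^bsub>presented_group X R\<^esub>"
    using u nil inv_word_left[OF u(1)]
    by (simp add: one word_class_mult inv_word_words words_append word_class_eq_iff)
  then show "\<exists>V\<in>carrier (presented_group X R).
      V \<otimes>\<^bsub>presented_group X R\<^esub> U = \<one>\<^bsub>presented_group X R\<^esub>"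
    using word_class_closed[OF inv_word_words[OF u(1)]] by blast
  fix V assume V: "V \<in> carrier (presented_group X R)"
  then obtain v where v: "v \<in> words X" "V = word_class X R v"
    by (rule presented_group_elem)
  show "U \<otimes>\<^bsub>presented_group X R\<^esub> V \<in> carrier (presented_group X R)"
    using u v by (simp add: word_class_mult word_class_closed words_append)
  fix W assume W: "W \<in> carrier (presented_group X R)"
  then obtain w where w: "w \<in> words X" "W = word_class X R w"
    by (rule presented_group_elem)
  show "U \<otimes>\<^bsub>presented_group X R\<^esub> V \<otimes>\<^bsub>presented_group X R\<^esub> W =
      U \<otimes>\<^bsub>presented_group X R\<^esub> (V \<otimes>\<^bsub>presented_group X R\<^esub> W)"
    using u v w by (simp add: word_class_mult words_append)
qed

section \<open>Amalgams of finite groups\<close>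

definition amalgam_of_finite_groups ::
  "'x set \<Rightarrow> 'x word set \<Rightarrow> 'x set \<Rightarrow> 'x word set \<Rightarrow> ('a, 'm) monoid_scheme \<Rightarrow> 'a set \<Rightarrow>
     ('a \<Rightarrow> 'x word set) \<Rightarrow> ('a \<Rightarrow> 'x word set) \<Rightarrow> bool" where
  "amalgam_of_finite_groups X1 R1 X2 R2 A Y \<phi>1 \<phi>2 \<longleftrightarrow>
     finite X1 \<and> finite X2 \<and> X1 \<inter> X2 = {} \<and>
     finite R1 \<and> R1 \<subseteq> words X1 \<and> finite R2 \<and> R2 \<subseteq> words X2 \<and>
     finite (carrier (presented_group X1 R1)) \<and> finite (carrier (presented_group X2 R2)) \<and>
     group A \<and> Y \<subseteq> carrier A \<and> generate A Y = carrier A \<and>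
     \<phi>1 \<in> mon A (presented_group X1 R1) \<and> \<phi>2 \<in> mon A (presented_group X2 R2)"

text \<open>
  An element of \<open>presented_group Xi Ri\<close> is the set of all words representing it, so \<open>u \<in> \<phi>1 a\<close>
  says that \<open>u\<close> is a word for \<open>\<phi>1 a\<close>. The defining relation \<open>\<phi>1 a = \<phi>2 a\<close> is imposed for all
  choices of representing words; modulo \<open>R1\<close> and \<open>R2\<close> these choices are equivalent.
\<close>

definition amalgam_relators ::
  "'x word set \<Rightarrow> 'x word set \<Rightarrow> 'a set \<Rightarrow> ('a \<Rightarrow> 'x word set) \<Rightarrow> ('a \<Rightarrow> 'x word set) \<Rightarrow>
     'x word set" where
  "amalgam_relators R1 R2 Y \<phi>1 \<phi>2 =
     R1 \<union> R2 \<union> {u @ inv_word v | a u v. a \<in> Y \<and> u \<in> \<phi>1 a \<and> v \<in> \<phi>2 a}"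

section \<open>Malnormal subgroups\<close>

definition conjugate :: "('a, 'm) monoid_scheme \<Rightarrow> 'a \<Rightarrow> 'a set \<Rightarrow> 'a set" where
  "conjugate G g H = (g <#\<^bsub>G\<^esub> H) #>\<^bsub>G\<^esub> (inv\<^bsub>G\<^esub> g)"

definition malnormal :: "'a set \<Rightarrow> ('a, 'm) monoid_scheme \<Rightarrow> bool" where
  "malnormal H G \<longleftrightarrow>
     subgroup H G \<and> (\<forall>g \<in> carrier G - H. conjugate G g H \<inter> H = {\<one>\<^bsub>G\<^esub>})"

section \<open>Algorithms\<close>

text \<open>
  Algorithms are programs for partial recursive functions on the natural numbers.
  \<open>eval p xs y\<close> means that \<open>p\<close> halts on the arguments \<open>xs\<close> with result \<open>y\<close>.
\<close>

datatype recf =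
    Zero
  | Succ
  | Proj nat
  | Comp recf "recf list"
  | PrimRec recf recf
  | Minim recf

inductive eval :: "recf \<Rightarrow> nat list \<Rightarrow> nat \<Rightarrow> bool" where
  Zero: "eval Zero xs 0"
| Succ: "eval Succ [x] (Suc x)"
| Proj: "i < length xs \<Longrightarrow> eval (Proj i) xs (xs ! i)"
| Comp: "list_all2 (\<lambda>g y. eval g xs y) gs ys \<Longrightarrow> eval f ys z \<Longrightarrow> eval (Comp f gs) xs z"
| PrimRec_0: "eval f xs y \<Longrightarrow> eval (PrimRec f g) (0 # xs) y"
| PrimRec_Suc: "eval (PrimRec f g) (n # xs) y \<Longrightarrow> eval g (n # y # xs) z \<Longrightarrow>
    eval (PrimRec f g) (Suc n # xs) z"
| Minim: "eval f (n # xs) 0 \<Longrightarrow> (\<And>i. i < n \<Longrightarrow> \<exists>y. eval f (i # xs) (Suc y)) \<Longrightarrow>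
    eval (Minim f) xs n"

lemma eval_deterministic: "eval p xs y \<Longrightarrow> eval p xs z \<Longrightarrow> z = y"
proof (induction arbitrary: z rule: eval.induct)
  case (Zero xs) then show ?case by (auto elim: eval.cases)
next
  case (Succ x) then show ?case by (auto elim: eval.cases)
next
  case (Proj i xs) then show ?case by (auto elim: eval.cases)
next
  case (Comp xs gs ys f w)
  from Comp.prems obtain ys' where
    ys': "list_all2 (\<lambda>g y. eval g xs y) gs ys'" "eval f ys' z"
    by (cases rule: eval.cases) auto
  have "ys' = ys"
    using Comp.IH(1) ys'(1) by (auto simp: list_all2_conv_all_nth intro!: nth_equalityI)
  then show ?case using Comp.IH(2) ys'(2) by simp
next
  case (PrimRec_0 f xs y g)
  from PrimRec_0.prems show ?case by (cases rule: eval.cases) (auto intro: PrimRec_0.IH)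
next
  case (PrimRec_Suc f g n xs y w)
  from PrimRec_Suc.prems obtain y' where
    "eval (PrimRec f g) (n # xs) y'" "eval g (n # y' # xs) z"
    by (cases rule: eval.cases) auto
  then show ?case using PrimRec_Suc.IH by blast
next
  case (Minim f n xs)
  from Minim.prems have z: "eval f (z # xs) 0"
    and below: "\<And>i. i < z \<Longrightarrow> \<exists>y. eval f (i # xs) (Suc y)"
    by (cases rule: eval.cases; auto)+
  show ?case
  proof (cases rule: linorder_cases[of z n])
    case less then show ?thesis using Minim.IH(2) z by force
  next
    case greater then show ?thesis using Minim.IH(1) below by force
  qed
qed

definition computable_on :: "'i set \<Rightarrow> ('i \<Rightarrow> nat) \<Rightarrow> ('o \<Rightarrow> nat) \<Rightarrow> ('i \<Rightarrow> 'o) \<Rightarrow> bool" where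
  "computable_on D enc_in enc_out f \<longleftrightarrow>
     (\<exists>p. \<forall>x\<in>D. eval p [enc_in x] (enc_out (f x)))"

text \<open>
  Words over a finite alphabet are coded by numbers, given a numbering \<open>c\<close> of the generators.
  The answer \<open>None\<close> stands for malnormal, and \<open>Some g\<close> for not malnormal, with witness
  \<open>g\<close>.
\<close>

definition encode_word :: "('x \<Rightarrow> nat) \<Rightarrow> 'x word \<Rightarrow> nat" where
  "encode_word c w = list_encode (map (\<lambda>(x, b). prod_encode (c x, of_bool b)) w)"

definition encode_words :: "('x \<Rightarrow> nat) \<Rightarrow> 'x word list \<Rightarrow> nat" where
  "encode_words c ws = list_encode (map (encode_word c) ws)"

definition encode_answer :: "('x \<Rightarrow> nat) \<Rightarrow> 'x word option \<Rightarrow> nat" where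
  "encode_answer c ans = (case ans of None \<Rightarrow> 0 | Some g \<Rightarrow> Suc (encode_word c g))"

lemma inj_on_encode_word:
  assumes "inj_on c X"
  shows "inj_on (encode_word c) (words X)"
proof -
  have "inj_on (\<lambda>(x, b). prod_encode (c x, of_bool b)) (X \<times> (UNIV :: bool set))"
    using assms by (auto simp: inj_on_def prod_encode_eq)
  note inj = inj_on_map_lists[OF this]
  show ?thesis
  proof (rule inj_onI)
    fix u v assume "u \<in> words X" "v \<in> words X" "encode_word c u = encode_word c v"
    then show "u = v"
      using inj_onD[OF inj, of u v] by (simp only: encode_word_def words_def list_encode_eq)
  qed
qed

lemma inj_on_encode_words:
  assumes "inj_on c X"
  shows "inj_on (encode_words c) (lists (words X))"
proof (rule inj_onI)
  fix us vs
  assume "us \<in> lists (words X)" "vs \<in> lists (words X)" "encode_words c us = encode_words c vs"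
  then show "us = vs"
    using inj_onD[OF inj_on_map_lists[OF inj_on_encode_word[OF assms]], of us vs]
    by (simp only: encode_words_def list_encode_eq)
qed

lemma encode_answer_eq_iff:
  assumes "inj_on c X" "set_option a \<subseteq> words X" "set_option b \<subseteq> words X"
  shows "encode_answer c a = encode_answer c b \<longleftrightarrow> a = b"
  using assms(2,3) inj_on_eq_iff[OF inj_on_encode_word[OF assms(1)]]
  by (cases a; cases b) (simp_all add: encode_answer_def)

end

theory Submission
  imports Defs
begin

text \<open>
  The syllable length of normal forms is a length function on the amalgam \<open>G\<close>: it measures the
  distance between edges of the Bass-Serre tree, and the edge stabilisers are finite. So \<open>G\<close> is a
  group with a length function \<open>len\<close> whose balls are finite, in which every element is reached by a
  geodesic, and whose distance \<open>len (inv x \<otimes> y)\<close> satisfies the four-point condition of a tree. The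
  group theory rests on these properties.

  Let \<open>H\<close> be generated by elements of length at most \<open>L\<close>. If \<open>H\<close> is not malnormal, there are
  \<open>g \<notin> H\<close> and \<open>k \<in> H\<close>, \<open>k \<noteq> 1\<close>, with \<open>inv g \<otimes> k \<otimes> g \<in> H\<close>. Take \<open>g\<close> as short as possible. In the
  quadrilateral with corners \<open>1, g, kg, k\<close> the sides \<open>[1, k]\<close> and \<open>[g, kg]\<close> stay within \<open>L\<close> of \<open>H\<close> and of
  \<open>gH\<close>, whereas the points \<open>p i\<close> of \<open>[1, g]\<close> away from its ends are far from both by minimality. As a
  path in a tree cannot avoid the points between its ends (\<open>bottleneck\<close>), these \<open>p i\<close> are close to
  the opposite side, so that \<open>inv (p i) \<otimes> k \<otimes> p i\<close> has length at most \<open>2 L\<close>. If \<open>g\<close> were long, two of these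
  conjugates would agree by the pigeonhole principle, and \<open>c = p j \<otimes> inv (p i)\<close> would commute with \<open>k\<close>.
  Then either \<open>c\<close> is outside \<open>H\<close> and a shorter choice than \<open>g\<close>, or \<open>inv c \<otimes> g\<close> is one. This
  bounds \<open>g\<close> (\<open>minimal_witness_short\<close>) without a distinction between elements \<open>k\<close> of finite and of
  infinite order. A second pigeonhole argument bounds \<open>k\<close> (\<open>witness_element_short\<close>).

  So it suffices to know \<open>H\<close> within a ball of computable radius \<open>M\<close>. There it is the least
  set that contains \<open>1\<close> and the generators and is closed under inverses and under those products that
  do not leave the ball (\<open>ball_closure\<close>): in a product of short elements with a short result, a
  partial product of maximal length can be bypassed, because its two neighbours are close to each
  other.

  The algorithm is an unbounded search for a certificate. A certificate has a list of words for
  elements of \<open>H\<close>, each obtained from later entries of the list or from the generators, that is closed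
  in the ball of radius \<open>M\<close>; a second such list for \<open>G\<close> itself, which thus contains all candidates for
  \<open>g\<close>; and the answer that these lists imply. Checking a certificate is recursive, as soon as equality
  in \<open>G\<close> is. For that, normal forms are numbered in such a way that multiplication by a
  letter reads and replaces only the two lowest digits of the number, hence is given by a finite table
  (\<open>state_coding\<close>). That normal forms are unique is the classical argument of van der Waerden: \<open>G\<close> acts
  on the set of normal forms.
\<close>

section \<open>Total recursive functions\<close>

text \<open>
  Functions of \<open>k\<close> arguments are taken on argument lists, so that a term in \<open>v ! 0, v ! 1, \<dots>\<close> can be
  analysed by introduction rules along its structure. The values at lists of other lengths do not matter,
  which is what \<open>rfun_cong\<close> exploits.
\<close>

definition rfun :: "nat \<Rightarrow> (nat list \<Rightarrow> nat) \<Rightarrow> bool" where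
  "rfun k f \<longleftrightarrow> (\<exists>p. \<forall>v. length v = k \<longrightarrow> eval p v (f v))"

abbreviation rfun1 :: "(nat \<Rightarrow> nat) \<Rightarrow> bool" where
  "rfun1 f \<equiv> rfun (Suc 0) (\<lambda>v. f (v ! 0))"

abbreviation rfun2 :: "(nat \<Rightarrow> nat \<Rightarrow> nat) \<Rightarrow> bool" where
  "rfun2 f \<equiv> rfun (Suc (Suc 0)) (\<lambda>v. f (v ! 0) (v ! 1))"

abbreviation rfun3 :: "(nat \<Rightarrow> nat \<Rightarrow> nat \<Rightarrow> nat) \<Rightarrow> bool" where
  "rfun3 f \<equiv> rfun (Suc (Suc (Suc 0))) (\<lambda>v. f (v ! 0) (v ! 1) (v ! 2))"

text \<open>
  Decidable predicates are recursive characteristic functions; quantifiers over \<open>v\<close> extended by a new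
  first argument are then expressed with \<open>v ! 0\<close> for the bound variable and \<open>tl v\<close> for the old arguments.
\<close>

abbreviation rdec :: "nat \<Rightarrow> (nat list \<Rightarrow> bool) \<Rightarrow> bool" where
  "rdec k P \<equiv> rfun k (\<lambda>v. of_bool (P v))"

lemma rfun_cong: "rfun k f \<Longrightarrow> (\<And>v. length v = k \<Longrightarrow> f v = g v) \<Longrightarrow> rfun k g"
  unfolding rfun_def by metis

lemma rfun_nth [intro]: "i < k \<Longrightarrow> rfun k (\<lambda>v. v ! i)"
  unfolding rfun_def using eval.Proj by metis

lemma rfun_tl_nth [intro]: "Suc i < k \<Longrightarrow> rfun k (\<lambda>v. tl v ! i)"
  by (rule rfun_cong[OF rfun_nth[of "Suc i"]]) (auto simp: nth_tl)

lemma rfun_tl2_nth [intro]: "Suc (Suc i) < k \<Longrightarrow> rfun k (\<lambda>v. tl (tl v) ! i)"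
  by (rule rfun_cong[OF rfun_nth[of "Suc (Suc i)"]]) (auto simp: nth_tl)

lemma rfun_tl3_nth [intro]: "Suc (Suc (Suc i)) < k \<Longrightarrow> rfun k (\<lambda>v. tl (tl (tl v)) ! i)"
  by (rule rfun_cong[OF rfun_nth[of "Suc (Suc (Suc i))"]]) (auto simp: nth_tl)

lemma rfun_comp:
  assumes F: "rfun (length fs) F" and fs: "\<And>f. f \<in> set fs \<Longrightarrow> rfun k f"
  shows "rfun k (\<lambda>v. F (map (\<lambda>f. f v) fs))"
proof -
  obtain p where p: "length v = length fs \<Longrightarrow> eval p v (F v)" for v
    using F unfolding rfun_def by blast
  have "\<forall>f\<in>set fs. \<exists>q. \<forall>v. length v = k \<longrightarrow> eval q v (f v)"
    using fs unfolding rfun_def by blast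
  then obtain q where q: "f \<in> set fs \<Longrightarrow> length v = k \<Longrightarrow> eval (q f) v (f v)" for f v
    by metis
  have "eval (Comp p (map q fs)) v (F (map (\<lambda>f. f v) fs))" if "length v = k" for v
    by (rule eval.Comp[where ys = "map (\<lambda>f. f v) fs"])
       (auto simp: list_all2_map1 list_all2_map2 list_all2_same q that p)
  then show ?thesis unfolding rfun_def by blast
qed

lemma rfun_app1:
  assumes "rfun1 F" "rfun k f"
  shows "rfun k (\<lambda>v. F (f v))"
  using rfun_comp[of "[f]" "\<lambda>v. F (v ! 0)" k] assms by auto

lemma rfun_app2:
  assumes "rfun2 F" "rfun k f" "rfun k g"
  shows "rfun k (\<lambda>v. F (f v) (g v))"
  using rfun_comp[of "[f, g]" "\<lambda>v. F (v ! 0) (v ! 1)" k] assms by auto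

lemma rfun_app3:
  assumes "rfun3 F" "rfun k f" "rfun k g" "rfun k h"
  shows "rfun k (\<lambda>v. F (f v) (g v) (h v))"
  using rfun_comp[of "[f, g, h]" "\<lambda>v. F (v ! 0) (v ! 1) (v ! 2)" k] assms by auto

lemma rfun_Suc [intro]: "rfun k f \<Longrightarrow> rfun k (\<lambda>v. Suc (f v))"
proof (erule rfun_app1[rotated])
  show "rfun1 Suc"
    unfolding rfun_def
  proof (intro exI[of _ Succ] allI impI)
    fix v :: "nat list" assume "length v = Suc 0"
    then obtain x where "v = [x]" by (cases v) auto
    then show "eval Succ v (Suc (v ! 0))" by (auto intro: eval.Succ)
  qed
qed

lemma rfun_const [intro]: "rfun k (\<lambda>_. n)"
proof (induction n)
  case 0
  show ?case unfolding rfun_def using eval.Zero by blast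
next
  case (Suc n)
  then show ?case by (rule rfun_Suc)
qed

lemma rfun_rec [intro]:
  assumes n: "rfun k n" and f: "rfun k f"
    and g: "rfun (Suc (Suc k)) (\<lambda>v. g (v ! 0) (v ! 1) (tl (tl v)))"
  shows "rfun k (\<lambda>v. rec_nat (f v) (\<lambda>i y. g i y v) (n v))"
proof -
  obtain pn where pn: "length v = k \<Longrightarrow> eval pn v (n v)" for v
    using n unfolding rfun_def by blast
  obtain pf where pf: "length v = k \<Longrightarrow> eval pf v (f v)" for v
    using f unfolding rfun_def by blast
  obtain pg where "length v = Suc (Suc k) \<Longrightarrow> eval pg v (g (v ! 0) (v ! 1) (tl (tl v)))" for v
    using g unfolding rfun_def by blast
  from this[of "_ # _ # _"] have pg: "length v = k \<Longrightarrow> eval pg (i # y # v) (g i y v)" for v i y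
    by simp
  have rec: "eval (PrimRec pf pg) (m # v) (rec_nat (f v) (\<lambda>i y. g i y v) m)"
    if "length v = k" for m v
    by (induction m) (auto intro: eval.PrimRec_0 eval.PrimRec_Suc pf pg that)
  have projs: "list_all2 (\<lambda>q y. eval q v y) (map Proj [0..<k]) v" if "length v = k" for v
    using that by (auto simp: list_all2_conv_all_nth intro: eval.Proj)
  have "eval (Comp (PrimRec pf pg) (pn # map Proj [0..<k])) v
      (rec_nat (f v) (\<lambda>i y. g i y v) (n v))" if "length v = k" for v
    by (rule eval.Comp[of _ _ "n v # v"]) (auto simp: pn projs rec that)
  then show ?thesis unfolding rfun_def by blast
qed

text \<open>
  Unbounded search is stated for a possibly partial result, since the final algorithm is only
  known to halt on codes of lists of words.
\<close>

lemma eval_search: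
  assumes "rdec (Suc k) (\<lambda>v. P (v ! 0) (tl v))"
  shows "\<exists>p. \<forall>v. length v = k \<longrightarrow> (\<exists>n. P n v) \<longrightarrow> eval p v (LEAST n. P n v)"
proof -
  let ?f = "\<lambda>v. 1 - (of_bool (P (v ! 0) (tl v)) :: nat)"
  have "rfun (Suc k) (\<lambda>v. rec_nat (Suc 0) (\<lambda>_ _. 0) (of_bool (P (v ! 0) (tl v))))"
    using assms by (auto simp del: nat.rec)
  then have "rfun (Suc k) ?f"
    by (rule rfun_cong) (auto simp: of_bool_def)
  then obtain p where "length v = Suc k \<Longrightarrow> eval p v (?f v)" for v
    unfolding rfun_def by blast
  from this[of "_ # _"] have p: "length v = k \<Longrightarrow> eval p (n # v) (1 - of_bool (P n v))" for n v
    by simp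
  have "eval (Minim p) v (LEAST n. P n v)" if "length v = k" "\<exists>n. P n v" for v
  proof (rule eval.Minim)
    show "eval p ((LEAST n. P n v) # v) 0"
      using p[OF that(1), of "LEAST n. P n v"] LeastI_ex[OF that(2)] by simp
    fix i assume "i < (LEAST n. P n v)"
    then have "\<not> P i v" using not_less_Least by blast
    then show "\<exists>y. eval p (i # v) (Suc y)"
      using p[OF that(1), of i] by auto
  qed
  then show ?thesis by blast
qed

lemma rfun_Least:
  assumes "rdec (Suc k) (\<lambda>v. P (v ! 0) (tl v))" and "\<And>v. \<exists>n. P n v"
  shows "rfun k (\<lambda>v. LEAST n. P n v)"
  using eval_search[OF assms(1)] assms(2) unfolding rfun_def by blast

lemma rfun_if [intro]:
  assumes "rdec k P" "rfun k f" "rfun k g"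
  shows "rfun k (\<lambda>v. if P v then f v else g v)"
proof -
  have "rfun k (\<lambda>v. rec_nat (g v) (\<lambda>_ _. f v) (of_bool (P v)))"
  proof (intro rfun_rec assms)
    show "rfun (Suc (Suc k)) (\<lambda>v. f (tl (tl v)))"
    proof -
      obtain p where p: "length v = k \<Longrightarrow> eval p v (f v)" for v
        using assms(2) unfolding rfun_def by blast
      have "list_all2 (\<lambda>q y. eval q v y) (map (\<lambda>i. Proj (Suc (Suc i))) [0..<k]) (tl (tl v))"
        if "length v = Suc (Suc k)" for v
        using that eval.Proj[of _ v] by (auto simp: list_all2_conv_all_nth nth_tl)
      then have "eval (Comp p (map (\<lambda>i. Proj (Suc (Suc i))) [0..<k])) v (f (tl (tl v)))"
        if "length v = Suc (Suc k)" for v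
        by (rule eval.Comp) (simp_all add: p that)
      then show ?thesis unfolding rfun_def by blast
    qed
  qed
  then show ?thesis by (rule rfun_cong) (auto simp: of_bool_def)
qed

lemma rdec_not [intro]: "rdec k P \<Longrightarrow> rdec k (\<lambda>v. \<not> P v)"
  by (rule rfun_cong[of _ "\<lambda>v. if P v then 0 else Suc 0"]) auto

lemma rdec_conj [intro]: "rdec k P \<Longrightarrow> rdec k Q \<Longrightarrow> rdec k (\<lambda>v. P v \<and> Q v)"
  by (rule rfun_cong[of _ "\<lambda>v. if P v then of_bool (Q v) else 0"]) auto

lemma rdec_disj [intro]: "rdec k P \<Longrightarrow> rdec k Q \<Longrightarrow> rdec k (\<lambda>v. P v \<or> Q v)"
  by (rule rfun_cong[of _ "\<lambda>v. if P v then Suc 0 else of_bool (Q v)"]) auto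

lemma rdec_imp [intro]: "rdec k P \<Longrightarrow> rdec k Q \<Longrightarrow> rdec k (\<lambda>v. P v \<longrightarrow> Q v)"
  by (rule rfun_cong[of _ "\<lambda>v. if P v then of_bool (Q v) else Suc 0"]) auto

lemma rfun_add [intro]: "rfun k f \<Longrightarrow> rfun k g \<Longrightarrow> rfun k (\<lambda>v. f v + g v)"
proof (rule rfun_app2[of "(+)"])
  have *: "rec_nat m (\<lambda>_ y. Suc y) n = m + n" for m n :: nat by (induction n) auto
  have "rfun2 (\<lambda>m n. rec_nat m (\<lambda>_ y. Suc y) n)" by (intro rfun_rec rfun_nth rfun_Suc) auto
  then show "rfun2 (+)" unfolding * .
qed

lemma rfun_pred [intro]: "rfun k f \<Longrightarrow> rfun k (\<lambda>v. f v - Suc 0)"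
proof (rule rfun_app1[of "\<lambda>n. n - Suc 0"])
  have *: "rec_nat 0 (\<lambda>i _. i) n = n - Suc 0" for n :: nat by (cases n) auto
  have "rfun1 (\<lambda>n. rec_nat 0 (\<lambda>i _. i) n)" by (intro rfun_rec rfun_nth rfun_const) auto
  then show "rfun1 (\<lambda>n. n - Suc 0)" unfolding * .
qed

lemma rfun_diff [intro]: "rfun k f \<Longrightarrow> rfun k g \<Longrightarrow> rfun k (\<lambda>v. f v - g v)"
proof (rule rfun_app2[of "(-)"])
  have *: "rec_nat m (\<lambda>_ y. y - Suc 0) n = m - n" for m n :: nat by (induction n) auto
  have "rfun2 (\<lambda>m n. rec_nat m (\<lambda>_ y. y - Suc 0) n)" by (intro rfun_rec rfun_nth rfun_pred) auto
  then show "rfun2 (-)" unfolding * .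
qed

lemma rfun_mult [intro]: "rfun k f \<Longrightarrow> rfun k g \<Longrightarrow> rfun k (\<lambda>v. f v * g v)"
proof (rule rfun_app2[of "(*)"])
  have *: "rec_nat 0 (\<lambda>_ y. y + m) n = m * n" for m n :: nat by (induction n) auto
  have "rfun2 (\<lambda>m n. rec_nat 0 (\<lambda>_ y. y + m) n)" by (intro rfun_rec rfun_nth rfun_tl2_nth rfun_add) auto
  then show "rfun2 (*)" unfolding * .
qed

lemma rfun_power [intro]: "rfun k f \<Longrightarrow> rfun k g \<Longrightarrow> rfun k (\<lambda>v. f v ^ g v)"
proof (rule rfun_app2[of "(^)"])
  have *: "rec_nat 1 (\<lambda>_ y. y * m) n = m ^ n" for m n :: nat by (induction n) auto
  have "rfun2 (\<lambda>m n. rec_nat 1 (\<lambda>_ y. y * m) n)" by (intro rfun_rec rfun_nth rfun_tl2_nth rfun_mult) auto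
  then show "rfun2 (^)" unfolding * .
qed

lemma rdec_le [intro]: "rfun k f \<Longrightarrow> rfun k g \<Longrightarrow> rdec k (\<lambda>v. f v \<le> g v)"
proof (rule rfun_cong[of _ "\<lambda>v. Suc 0 - (f v - g v)"])
qed auto

lemma rdec_less [intro]: "rfun k f \<Longrightarrow> rfun k g \<Longrightarrow> rdec k (\<lambda>v. f v < g v)"
  using rdec_le[of k "\<lambda>v. Suc (f v)" g] by (simp add: Suc_le_eq rfun_Suc)

lemma rdec_eq [intro]: "rfun k f \<Longrightarrow> rfun k g \<Longrightarrow> rdec k (\<lambda>v. f v = g v)"
  using rdec_conj[OF rdec_le[of k f g] rdec_le[of k g f]] by (simp add: eq_iff)

lemma rdec_ex [intro]:
  assumes "rfun k n" "rdec (Suc k) (\<lambda>v. P (v ! 0) (tl v))"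
  shows "rdec k (\<lambda>v. \<exists>i<n v. P i v)"
proof -
  obtain p where "length v = Suc k \<Longrightarrow> eval p v (of_bool (P (v ! 0) (tl v)))" for v
    using assms(2) unfolding rfun_def by blast
  from this[of "_ # _"] have p: "length v = k \<Longrightarrow> eval p (i # v) (of_bool (P i v))" for i v
    by simp
  have "eval (Comp p (Proj 0 # map (\<lambda>i. Proj (Suc (Suc i))) [0..<k])) v (of_bool (P (v ! 0) (tl (tl v))))"
    if "length v = Suc (Suc k)" for v
  proof (rule eval.Comp[of _ _ "v ! 0 # tl (tl v)"])
    have "list_all2 (\<lambda>q y. eval q v y) (map (\<lambda>i. Proj (Suc (Suc i))) [0..<k]) (tl (tl v))"
      using that eval.Proj[of _ v] by (auto simp: list_all2_conv_all_nth nth_tl)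
    then show "list_all2 (\<lambda>q y. eval q v y) (Proj 0 # map (\<lambda>i. Proj (Suc (Suc i))) [0..<k]) (v ! 0 # tl (tl v))"
      using that eval.Proj[of 0 v] by auto
  qed (simp add: p that)
  then have P: "rdec (Suc (Suc k)) (\<lambda>v. P (v ! 0) (tl (tl v)))"
    unfolding rfun_def by blast
  have "rfun k (\<lambda>v. rec_nat 0 (\<lambda>i y. if P i v then Suc 0 else y) (n v))"
    by (intro rfun_rec rfun_if assms(1) P rfun_const rfun_nth) auto
  moreover have "rec_nat 0 (\<lambda>i y. if P i v then Suc 0 else y) m = of_bool (\<exists>i<m. P i v)" for m v
    by (induction m) (auto simp: less_Suc_eq)
  ultimately show ?thesis by simp
qed

lemma rdec_all [intro]:
  assumes "rfun k n" "rdec (Suc k) (\<lambda>v. P (v ! 0) (tl v))"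
  shows "rdec k (\<lambda>v. \<forall>i<n v. P i v)"
  using rdec_not[OF rdec_ex[OF assms(1), of "\<lambda>i v. \<not> P i v", OF rdec_not[OF assms(2)]]] by simp

text \<open>
  Inverse functions such as division and the projections of \<open>prod_decode\<close> are obtained by searching for
  their value, so that no recursion equations are needed for them.
\<close>

lemma rfun_div [intro]: "rfun k f \<Longrightarrow> rfun k g \<Longrightarrow> rfun k (\<lambda>v. f v div g v)"
proof (rule rfun_app2[of "(div)"])
  have "(LEAST m. g = 0 \<or> f < g * Suc m) = f div g" for f g :: nat
  proof (rule Least_equality)
    show "g = 0 \<or> f < g * Suc (f div g)"
      using dividend_less_times_div[of g f] by auto
    show "f div g \<le> y" if "g = 0 \<or> f < g * Suc y" for y
      using that by (cases "g = 0") (auto simp: less_mult_imp_div_less mult.commute less_Suc_eq_le[symmetric] simp del: mult_Suc_right)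
  qed
  moreover have "rfun2 (\<lambda>f g. LEAST m. g = 0 \<or> f < g * Suc m)"
  proof (rule rfun_Least)
    show "\<exists>n. v ! 1 = 0 \<or> v ! 0 < v ! 1 * Suc n" for v :: "nat list"
      by (intro exI[of _ "v ! 0"]) (cases "v ! 1", auto)
  qed (intro rdec_disj rdec_eq rdec_less rfun_mult rfun_Suc rfun_tl_nth rfun_nth rfun_const; simp)
  ultimately show "rfun2 (div)" by simp
qed

lemma rfun_mod [intro]: "rfun k f \<Longrightarrow> rfun k g \<Longrightarrow> rfun k (\<lambda>v. f v mod g v)"
  unfolding modulo_nat_def by (intro rfun_diff rfun_mult rfun_div)

lemma rfun_prod_encode [intro]: "rfun k f \<Longrightarrow> rfun k g \<Longrightarrow> rfun k (\<lambda>v. prod_encode (f v, g v))"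
  unfolding prod_encode_def triangle_def prod.case
  by (intro rfun_add rfun_div rfun_mult rfun_Suc rfun_const)

lemma rfun_fst [intro]: "rfun k f \<Longrightarrow> rfun k (\<lambda>v. fst (prod_decode (f v)))"
proof (rule rfun_app1[of "\<lambda>n. fst (prod_decode n)"])
  have "(LEAST a. \<exists>b<Suc n. prod_encode (a, b) = n) = fst (prod_decode n)" for n
    using le_prod_encode_2[of "snd (prod_decode n)" "fst (prod_decode n)"]
    by (intro Least_equality)
       (auto simp: prod_decode_inverse less_Suc_eq_le intro!: exI[of _ "snd (prod_decode n)"])
  moreover have "rfun1 (\<lambda>n. LEAST a. \<exists>b<Suc n. prod_encode (a, b) = n)"
  proof (rule rfun_Least)
    show "\<exists>a. \<exists>b<Suc (v ! 0). prod_encode (a, b) = v ! 0" for v :: "nat list"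
      using le_prod_encode_2[of "snd (prod_decode (v ! 0))" "fst (prod_decode (v ! 0))"]
      by (intro exI[of _ "fst (prod_decode (v ! 0))"] exI[of _ "snd (prod_decode (v ! 0))"])
         (auto simp: prod_decode_inverse less_Suc_eq_le)
  qed (intro rdec_ex rdec_eq rfun_prod_encode rfun_Suc rfun_tl_nth rfun_tl2_nth rfun_nth; simp)
  ultimately show "rfun1 (\<lambda>n. fst (prod_decode n))" by simp
qed

lemma rfun_snd [intro]: "rfun k f \<Longrightarrow> rfun k (\<lambda>v. snd (prod_decode (f v)))"
proof (rule rfun_app1[of "\<lambda>n. snd (prod_decode n)"])
  have "(LEAST b. prod_encode (fst (prod_decode n), b) = n) = snd (prod_decode n)" for n
  proof (rule Least_equality)
    fix y assume "prod_encode (fst (prod_decode n), y) = n"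
    then have "prod_decode n = (fst (prod_decode n), y)" by (metis prod_encode_inverse)
    then show "snd (prod_decode n) \<le> y" by (metis order_refl snd_conv)
  qed (simp add: prod_decode_inverse)
  moreover have "rfun1 (\<lambda>n. LEAST b. prod_encode (fst (prod_decode n), b) = n)"
  proof (rule rfun_Least)
    show "\<exists>b. prod_encode (fst (prod_decode (v ! 0)), b) = v ! 0" for v :: "nat list"
      by (metis prod.collapse prod_decode_inverse)
  qed (intro rdec_eq rfun_prod_encode rfun_fst rfun_tl_nth rfun_nth; simp)
  ultimately show "rfun1 (\<lambda>n. snd (prod_decode n))" by simp
qed

text \<open>
  Lists are read off from their codes by dropping elements and taking the head: the head is a projection
  of the code, and dropping iterates one.
\<close>

definition hd_code :: "nat \<Rightarrow> nat" where
  "hd_code n = fst (prod_decode (n - Suc 0))"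

definition drop_code :: "nat \<Rightarrow> nat \<Rightarrow> nat" where
  "drop_code j n = list_encode (drop j (list_decode n))"

lemma drop_code_rec: "drop_code j n = rec_nat n (\<lambda>_ m. snd (prod_decode (m - Suc 0))) j"
proof (induction j)
  case (Suc j)
  have *: "snd (prod_decode (list_encode xs - Suc 0)) = list_encode (tl xs)" for xs
  proof (cases xs)
    case Nil
    have "prod_decode 0 = (0, 0)" by (simp add: prod_decode_def prod_decode_aux.simps)
    then show ?thesis using Nil by simp
  qed simp
  show ?case
    by (simp add: Suc.IH[symmetric]) (simp add: drop_code_def * drop_Suc tl_drop)
qed (simp add: drop_code_def)

lemma rfun_hd_code [intro]: "rfun k f \<Longrightarrow> rfun k (\<lambda>v. hd_code (f v))"
  unfolding hd_code_def by (intro rfun_fst rfun_pred)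

lemma rfun_drop_code [intro]: "rfun k f \<Longrightarrow> rfun k g \<Longrightarrow> rfun k (\<lambda>v. drop_code (f v) (g v))"
proof (rule rfun_app2[of drop_code])
  show "rfun2 drop_code"
    unfolding drop_code_rec
    by (intro rfun_rec rfun_snd rfun_pred rfun_nth) auto
qed

lemma length_le_list_encode: "length xs \<le> list_encode xs"
proof (induction xs)
  case (Cons x xs)
  then show ?case using le_prod_encode_2[of "list_encode xs" x] by simp
qed simp

lemma elem_le_list_encode: "x \<in> set xs \<Longrightarrow> x < list_encode xs"
proof (induction xs)
  case (Cons y xs)
  then show ?case
    using le_prod_encode_1[of y "list_encode xs"] le_prod_encode_2[of "list_encode xs" y] by fastforce
qed simp

lemma drop_code_eq_0: "drop_code j n = 0 \<longleftrightarrow> length (list_decode n) \<le> j"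
  using list_encode_eq[of "drop j (list_decode n)" "[]"] by (simp add: drop_code_def)

lemma hd_drop_code: "j < length (list_decode n) \<Longrightarrow> hd_code (drop_code j n) = list_decode n ! j"
  by (simp add: drop_code_def hd_code_def Cons_nth_drop_Suc[symmetric])

text \<open>
  A list is not longer than its code, so a quantifier over its elements becomes a bounded
  quantifier over positions.
\<close>

lemma ex_list_decode:
  "(\<exists>x\<in>set (list_decode n). P x) \<longleftrightarrow> (\<exists>j<n. drop_code j n \<noteq> 0 \<and> P (hd_code (drop_code j n)))"
proof
  assume "\<exists>x\<in>set (list_decode n). P x"
  then obtain j where "j < length (list_decode n)" "P (list_decode n ! j)"
    by (auto simp: in_set_conv_nth)
  moreover have "length (list_decode n) \<le> n" using length_le_list_encode[of "list_decode n"] by simp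
  ultimately show "\<exists>j<n. drop_code j n \<noteq> 0 \<and> P (hd_code (drop_code j n))"
    by (intro exI[of _ j]) (auto simp: drop_code_eq_0 hd_drop_code)
next
  assume "\<exists>j<n. drop_code j n \<noteq> 0 \<and> P (hd_code (drop_code j n))"
  then obtain j where "j < length (list_decode n)" "P (hd_code (drop_code j n))"
    by (auto simp: drop_code_eq_0 not_le)
  then show "\<exists>x\<in>set (list_decode n). P x"
    by (auto simp: hd_drop_code)
qed

lemma rfun_lift:
  assumes "rfun k f"
  shows "rfun (Suc k) (\<lambda>v. f (tl v))"
proof -
  obtain p where p: "length v = k \<Longrightarrow> eval p v (f v)" for v
    using assms unfolding rfun_def by blast
  have "list_all2 (\<lambda>q y. eval q v y) (map (\<lambda>i. Proj (Suc i)) [0..<k]) (tl v)"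
    if "length v = Suc k" for v
    using that eval.Proj[of _ v] by (auto simp: list_all2_conv_all_nth nth_tl)
  then have "eval (Comp p (map (\<lambda>i. Proj (Suc i)) [0..<k])) v (f (tl v))"
    if "length v = Suc k" for v
    by (rule eval.Comp) (simp_all add: p that)
  then show ?thesis unfolding rfun_def by blast
qed

text \<open>
  Substitution for the bound variable under a quantifier.
\<close>

lemma rfun_hd_tl:
  assumes P: "rfun (Suc k) (\<lambda>v. P (v ! 0) (tl v))" and f: "rfun (Suc k) f"
  shows "rfun (Suc k) (\<lambda>v. P (f v) (tl v))"
proof -
  obtain p where "length v = Suc k \<Longrightarrow> eval p v (P (v ! 0) (tl v))" for v
    using P unfolding rfun_def by blast
  from this[of "_ # _"] have p: "length v = k \<Longrightarrow> eval p (i # v) (P i v)" for i v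
    by simp
  obtain q where q: "length v = Suc k \<Longrightarrow> eval q v (f v)" for v
    using f unfolding rfun_def by blast
  have "list_all2 (\<lambda>q y. eval q v y) (q # map (\<lambda>i. Proj (Suc i)) [0..<k]) (f v # tl v)"
    if "length v = Suc k" for v
    using that eval.Proj[of _ v] q by (auto simp: list_all2_conv_all_nth nth_tl nth_Cons split: nat.splits)
  then have "eval (Comp p (q # map (\<lambda>i. Proj (Suc i)) [0..<k])) v (P (f v) (tl v))"
    if "length v = Suc k" for v
    by (rule eval.Comp) (simp_all add: p that)
  then show ?thesis unfolding rfun_def by blast
qed

lemma rdec_bex [intro]:
  assumes "rfun k n" "rdec (Suc k) (\<lambda>v. P (v ! 0) (tl v))"
  shows "rdec k (\<lambda>v. \<exists>x\<in>set (list_decode (n v)). P x v)"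
proof -
  have d: "rfun (Suc k) (\<lambda>v. drop_code (v ! 0) (n (tl v)))"
    by (intro rfun_drop_code rfun_lift assms rfun_nth) simp
  have "rdec (Suc k) (\<lambda>v. P (hd_code (drop_code (v ! 0) (n (tl v)))) (tl v))"
    by (rule rfun_hd_tl[where P = "\<lambda>i v. of_bool (P i v)"]) (intro assms rfun_hd_code d)+
  with d show ?thesis
    unfolding ex_list_decode by (intro rdec_ex assms rdec_conj rdec_not rdec_eq rfun_const)
qed

lemma rdec_ball [intro]:
  assumes "rfun k n" "rdec (Suc k) (\<lambda>v. P (v ! 0) (tl v))"
  shows "rdec k (\<lambda>v. \<forall>x\<in>set (list_decode (n v)). P x v)"
  using rdec_not[OF rdec_bex[OF assms(1), of "\<lambda>i v. \<not> P i v", OF rdec_not[OF assms(2)]]] by simp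

lemma rfun_foldl [intro]:
  assumes step: "rfun2 step" and "rfun k f" "rfun k g"
  shows "rfun k (\<lambda>v. foldl step (f v) (list_decode (g v)))"
proof (rule rfun_app2[of "\<lambda>n w. foldl step n (list_decode w)", OF _ assms(2,3)])
  have *: "rec_nat n (\<lambda>j s. if drop_code j w = 0 then s else step s (hd_code (drop_code j w))) m
      = foldl step n (take m (list_decode w))" for m n w
  proof (induction m)
    case (Suc m)
    then show ?case
      by (cases "m < length (list_decode w)")
         (auto simp: drop_code_eq_0 hd_drop_code take_Suc_conv_app_nth)
  qed simp
  have "take w (list_decode w) = list_decode w" for w
    using length_le_list_encode[of "list_decode w"] by simp
  then have "foldl step n (list_decode w) =
      rec_nat n (\<lambda>j s. if drop_code j w = 0 then s else step s (hd_code (drop_code j w))) w" for n w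
    by (simp add: *)
  moreover have "rfun2 (\<lambda>n w. rec_nat n (\<lambda>j s. if drop_code j w = 0 then s else step s (hd_code (drop_code j w))) w)"
    by (intro rfun_rec rfun_if rdec_eq rfun_app2[OF step] rfun_hd_code rfun_drop_code rfun_nth rfun_tl2_nth rfun_const; simp)
  ultimately show "rfun2 (\<lambda>n w. foldl step n (list_decode w))" by (simp only:)
qed

text \<open>
  Any finite amount of data may be built into a program. This is how the multiplication in the finite
  factors enters the algorithm.
\<close>

lemma rfun_table:
  assumes "finite S"
  shows "\<exists>F. rfun1 F \<and> (\<forall>n\<in>S. F n = f n)"
  using assms
proof induction
  case empty
  have "rfun1 (\<lambda>_. 0)" by (rule rfun_const)
  then show ?case by fast
next
  case (insert a S)
  then obtain F where F: "rfun1 F" "\<forall>n\<in>S. F n = f n" by blast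
  have "rfun1 (\<lambda>n. if n = a then f a else F n)"
    by (intro rfun_if rdec_eq F rfun_const rfun_nth) simp
  then show ?case using F(2) insert.hyps
    by (intro exI[of _ "\<lambda>n. if n = a then f a else F n"]) auto
qed

lemma rdec_finite [intro]:
  assumes "finite S" "rfun k f"
  shows "rdec k (\<lambda>v. f v \<in> S)"
proof (rule rfun_app1[of "\<lambda>n. of_bool (n \<in> S)", OF _ assms(2)])
  have "rdec (Suc 0) (\<lambda>v. v ! 0 \<in> set xs)" for xs
  proof (induction xs)
    case (Cons a xs)
    then have "rdec (Suc 0) (\<lambda>v. v ! 0 = a \<or> v ! 0 \<in> set xs)" by (intro rdec_disj rdec_eq) auto
    then show ?case by (rule rfun_cong) auto
  qed (auto intro: rfun_const)
  then show "rdec (Suc 0) (\<lambda>v. v ! 0 \<in> S)"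
    using finite_list[OF assms(1)] by auto
qed

section \<open>Groups with a tree-like length function\<close>

text \<open>
  The number \<open>len x + len y - len (inv x \<otimes> y)\<close> is twice the Gromov product of \<open>x\<close> and \<open>y\<close> with
  respect to \<open>1\<close>: in a tree, twice the length that the paths from \<open>1\<close> to \<open>x\<close> and to \<open>y\<close> have in common.
  The assumption \<open>hyperbolic\<close> says that if \<open>x\<close> and \<open>y\<close>, as well as \<open>y\<close> and \<open>z\<close>, have an initial path of some
  length in common, then so do \<open>x\<close> and \<open>z\<close>. These are Lyndon's length functions.
\<close>

locale length_group = group G for G :: "('g, 'm) monoid_scheme" (structure) +
  fixes len :: "'g \<Rightarrow> nat"
  assumes len_one: "len \<one> = 0"
    and len_inv: "x \<in> carrier G \<Longrightarrow> len (inv x) = len x"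
    and geodesic: "x \<in> carrier G \<Longrightarrow> i \<le> len x \<Longrightarrow>
      \<exists>p\<in>carrier G. len p = i \<and> len (inv p \<otimes> x) = len x - i"
    and hyperbolic: "x \<in> carrier G \<Longrightarrow> y \<in> carrier G \<Longrightarrow> z \<in> carrier G \<Longrightarrow>
      min (int (len x) + int (len y) - int (len (inv x \<otimes> y)))
          (int (len y) + int (len z) - int (len (inv y \<otimes> z)))
        \<le> int (len x) + int (len z) - int (len (inv x \<otimes> z))"
    and finite_ball: "finite {x \<in> carrier G. len x \<le> n}"
begin

definition gap :: "'g \<Rightarrow> 'g \<Rightarrow> nat" where
  "gap x y = len (inv x \<otimes> y)"

definition ball :: "nat \<Rightarrow> 'g set" where
  "ball n = {x \<in> carrier G. len x \<le> n}"

lemma cancel_left [simp]: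
  "x \<in> carrier G \<Longrightarrow> y \<in> carrier G \<Longrightarrow> x \<otimes> (inv x \<otimes> y) = y"
  "x \<in> carrier G \<Longrightarrow> y \<in> carrier G \<Longrightarrow> inv x \<otimes> (x \<otimes> y) = y"
  by (simp_all add: m_assoc[symmetric])

lemma len_mult:
  assumes "x \<in> carrier G" "y \<in> carrier G"
  shows "len (x \<otimes> y) \<le> len x + len y"
  using hyperbolic[of "inv x" \<one> y] assms by (simp add: len_one len_inv)

lemma gap_one [simp]: "x \<in> carrier G \<Longrightarrow> gap \<one> x = len x"
  by (simp add: gap_def)

lemma gap_sym:
  assumes "x \<in> carrier G" "y \<in> carrier G"
  shows "gap x y = gap y x"
  using len_inv[of "inv x \<otimes> y"] assms by (simp add: gap_def inv_mult_group)

lemma gap_triangle: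
  assumes "x \<in> carrier G" "y \<in> carrier G" "z \<in> carrier G"
  shows "gap x z \<le> gap x y + gap y z"
  using len_mult[of "inv x \<otimes> y" "inv y \<otimes> z"] assms by (simp add: gap_def m_assoc)

lemma gap_left [simp]:
  assumes "a \<in> carrier G" "x \<in> carrier G" "y \<in> carrier G"
  shows "gap (a \<otimes> x) (a \<otimes> y) = gap x y"
  using assms by (simp add: gap_def inv_mult_group m_assoc)

lemma gap_mult [simp]:
  "x \<in> carrier G \<Longrightarrow> y \<in> carrier G \<Longrightarrow> gap x (x \<otimes> y) = len y"
  by (simp add: gap_def)

text \<open>
  The form of the hyperbolicity axiom used below: the four-point condition for \<open>1, x, y, z\<close>, written
  without subtraction.
\<close>

lemma four_point:
  assumes "x \<in> carrier G" "y \<in> carrier G" "z \<in> carrier G"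
  shows "gap x z + len y \<le> max (len z + gap x y) (len x + gap y z)"
  using hyperbolic[OF assms] by (auto simp: gap_def)

definition hop :: "'g set \<Rightarrow> nat \<Rightarrow> ('g \<times> 'g) set" where
  "hop S L = {(a, b). a \<in> S \<and> b \<in> S \<and> gap a b \<le> L}"

lemma hop_mono: "S \<subseteq> S' \<Longrightarrow> L \<le> L' \<Longrightarrow> (hop S L)\<^sup>* \<subseteq> (hop S' L')\<^sup>*"
  by (rule rtrancl_mono) (auto simp: hop_def)

text \<open>
  A path that jumps by at most \<open>L\<close> cannot avoid a point \<open>p\<close> on the geodesic from \<open>1\<close> to its end \<open>y\<close>.
  Following the path, consider where the geodesic to the current point leaves \<open>[1, y]\<close>. At some jump
  from \<open>z'\<close> to \<open>z\<close> this branching point passes \<open>p\<close>. The geodesic from \<open>z'\<close> to \<open>z\<close> then runs through \<open>p\<close>, so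
  \<open>p\<close> is within \<open>L\<close> of \<open>z\<close>.
\<close>

lemma bottleneck:
  assumes S: "S \<subseteq> carrier G" "\<one> \<in> S" and y: "(\<one>, y) \<in> (hop S L)\<^sup>*"
    and p: "p \<in> carrier G" "len p + gap p y = len y"
  shows "\<exists>q\<in>S. gap p q \<le> L"
proof -
  have yc: "y \<in> carrier G"
    using y S by (cases rule: rtrancl.cases) (auto simp: hop_def)
  have "\<exists>q\<in>S. gap p q \<le> L" if "(\<one>, z) \<in> (hop S L)\<^sup>*" "2 * len p + gap z y \<le> len z + len y" for z
    using that
  proof (induction rule: rtrancl_induct)
    case base
    then have "len p = 0" using yc by (simp add: len_one)
    then show ?case using p S gap_sym[of p \<one>] by (intro bexI[of _ \<one>]) auto
  next
    case (step z' z)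
    then have z: "z' \<in> S" "z \<in> S" "gap z' z \<le> L" by (auto simp: hop_def)
    then have zc: "z' \<in> carrier G" "z \<in> carrier G" using S by auto
    \<comment> \<open>The condition says that the geodesics to \<open>z'\<close> and to \<open>y\<close> agree at least up to \<open>p\<close>.\<close>
    show ?case
    proof (cases "2 * len p + gap z' y \<le> len z' + len y")
      case True
      then show ?thesis by (rule step.IH)
    next
      case False
      have 1: "gap z' y + len z \<le> max (len y + gap z' z) (len z' + gap z y)"
        using four_point[of z' z y] zc yc by simp
      have 2: "gap p z + len y \<le> max (len z + gap p y) (len p + gap y z)"
        using four_point[of p y z] zc yc p by simp
      have 3: "gap y z = gap z y" using gap_sym zc yc by simp
      have 4: "len z \<le> len z' + gap z' z"
        using gap_triangle[of \<one> z' z] zc by simp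
      have "gap p z + len p \<le> len z"
        using 2 3 step.prems p(2) by (auto simp: max_def split: if_splits)
      moreover have "len z \<le> gap z' z + len p"
        using 1 4 False step.prems by (auto simp: max_def split: if_splits)
      ultimately have "gap p z \<le> L" using z(3) by simp
      then show ?thesis using z by blast
    qed
  qed
  from this[OF y] show ?thesis using p yc by (simp add: gap_def len_one)
qed

text \<open>
  A subgroup and its left cosets are connected by jumps as long as its generators. Any set \<open>S\<close> that is
  invariant under right multiplication is admitted, because the induction has to move the starting
  point.
\<close>

lemma hop_sub_group:
  assumes h: "h \<in> generate G X" and X: "X \<subseteq> carrier G" "\<And>x. x \<in> X \<Longrightarrow> len x \<le> L"
    and S: "S \<subseteq> carrier G" "\<And>s h. s \<in> S \<Longrightarrow> h \<in> generate G X \<Longrightarrow> s \<otimes> h \<in> S"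
    and a: "a \<in> S"
  shows "(a, a \<otimes> h) \<in> (hop S L)\<^sup>*"
  using h a
proof (induction arbitrary: a rule: generate.induct)
  case one
  then show ?case using S(1) by auto
next
  case (incl h)
  then have "a \<otimes> h \<in> S" using S(2) generate.incl by metis
  then have "(a, a \<otimes> h) \<in> hop S L"
    using incl X S(1) by (auto simp: hop_def subsetD)
  then show ?case by blast
next
  case (inv h)
  then have "a \<otimes> inv h \<in> S" using S(2) generate.inv by metis
  then have "(a, a \<otimes> inv h) \<in> hop S L"
    using inv X S(1) by (auto simp: hop_def subsetD len_inv)
  then show ?case by blast
next
  case (eng h1 h2)
  have c: "h1 \<in> carrier G" "h2 \<in> carrier G" "a \<in> carrier G"
    using eng generate_in_carrier[OF X(1)] S(1) by auto
  have "(a, a \<otimes> h1) \<in> (hop S L)\<^sup>*" using eng by blast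
  moreover have "(a \<otimes> h1, (a \<otimes> h1) \<otimes> h2) \<in> (hop S L)\<^sup>*"
    using eng S(2) by blast
  ultimately show ?case using c by (simp add: m_assoc)
qed

text \<open>
  The pair \<open>g, k\<close> shows that the subgroup \<open>H\<close> is not malnormal: \<open>k\<close> lies both in \<open>H\<close> and in its
  conjugate by \<open>g\<close>. Keeping \<open>k\<close> explicit allows to multiply \<open>g\<close> by elements of \<open>H\<close> on both sides.
\<close>

definition intersection_witness :: "'g set \<Rightarrow> 'g \<Rightarrow> 'g \<Rightarrow> bool" where
  "intersection_witness H g k \<longleftrightarrow>
     g \<in> carrier G - H \<and> k \<in> H - {\<one>} \<and> inv g \<otimes> k \<otimes> g \<in> H"

lemma witness_left:
  assumes H: "subgroup H G" and w: "intersection_witness H g k" and h: "h \<in> H"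
  shows "intersection_witness H (h \<otimes> g) (h \<otimes> k \<otimes> inv h)"
proof -
  have c: "g \<in> carrier G" "k \<in> carrier G" "h \<in> carrier G"
    using w h subgroup.mem_carrier[OF H] by (auto simp: intersection_witness_def)
  have "h \<otimes> g \<notin> H"
  proof
    assume "h \<otimes> g \<in> H"
    then have "inv h \<otimes> (h \<otimes> g) \<in> H" using H h by (meson subgroup.m_closed subgroup.m_inv_closed)
    then show False using w c by (simp add: intersection_witness_def)
  qed
  moreover have "h \<otimes> k \<otimes> inv h \<in> H"
    using H h w by (meson DiffD1 intersection_witness_def subgroup.m_closed subgroup.m_inv_closed)
  moreover have "h \<otimes> k \<otimes> inv h \<noteq> \<one>"
  proof
    assume *: "h \<otimes> k \<otimes> inv h = \<one>"
    have "inv h \<otimes> (h \<otimes> k \<otimes> inv h) \<otimes> h = k" using c by (simp add: m_assoc)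
    with * have "k = \<one>" using c by simp
    then show False using w by (simp add: intersection_witness_def)
  qed
  moreover have "inv (h \<otimes> g) \<otimes> (h \<otimes> k \<otimes> inv h) \<otimes> (h \<otimes> g) = inv g \<otimes> k \<otimes> g"
    using c by (simp add: m_assoc inv_mult_group)
  ultimately show ?thesis
    using w c by (simp add: intersection_witness_def)
qed

lemma witness_right:
  assumes H: "subgroup H G" and w: "intersection_witness H g k" and h: "h \<in> H"
  shows "intersection_witness H (g \<otimes> h) k"
proof -
  have c: "g \<in> carrier G" "k \<in> carrier G" "h \<in> carrier G"
    using w h subgroup.mem_carrier[OF H] by (auto simp: intersection_witness_def)
  have "g \<otimes> h \<notin> H"
  proof
    assume "g \<otimes> h \<in> H"
    then have "g \<otimes> h \<otimes> inv h \<in> H" using H h by (meson subgroup.m_closed subgroup.m_inv_closed)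
    then show False using w c by (simp add: intersection_witness_def m_assoc)
  qed
  moreover have "inv (g \<otimes> h) \<otimes> k \<otimes> (g \<otimes> h) = inv h \<otimes> (inv g \<otimes> k \<otimes> g) \<otimes> h"
    using c by (simp add: m_assoc inv_mult_group)
  ultimately show ?thesis
    using w c H h by (simp add: intersection_witness_def subgroup.m_closed subgroup.m_inv_closed)
qed

lemma geodesic_points:
  assumes "x \<in> carrier G"
  obtains p where "\<And>i. i \<le> len x \<Longrightarrow> p i \<in> carrier G \<and> len (p i) = i \<and> gap (p i) x = len x - i"
  using geodesic[OF assms] unfolding gap_def by metis

lemma geodesic_gap:
  assumes c: "x \<in> carrier G" "p \<in> carrier G" "q \<in> carrier G"
    and p: "len p + gap p x = len x" and q: "len q + gap q x = len x"
  shows "gap p q \<le> max (len p) (len q) - min (len p) (len q)"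
  using four_point[of p x q] gap_sym[of x q] c p q by (auto simp: max_def split: if_splits)

text \<open>
  The quadrilateral argument. Minimality is over all witnesses \<open>g', k'\<close>, not only those with
  \<open>k' = k\<close>, as multiplying \<open>g\<close> from the left by \<open>h \<in> H\<close> conjugates \<open>k\<close>.
\<close>

lemma minimal_witness_short:
  assumes X: "X \<subseteq> carrier G" "\<And>x. x \<in> X \<Longrightarrow> len x \<le> L"
    and H: "H = generate G X"
    and L: "1 \<le> L"
    and w: "intersection_witness H g k"
    and min: "\<And>g' k'. intersection_witness H g' k' \<Longrightarrow> len g \<le> len g'"
  shows "len g \<le> 2 * (L + card (ball (2 * L)) + 1)"
proof (rule ccontr)
  define n N where "n = len g" and "N = card (ball (2 * L))"
  assume "\<not> ?thesis"
  then have n: "n > 2 * (L + N + 1)" by (simp add: n_def N_def)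
  have sub: "subgroup H G" unfolding H by (rule generate_is_subgroup[OF X(1)])
  have Hc: "h \<in> carrier G" if "h \<in> H" for h using that sub by (rule subgroup.mem_carrier[rotated])
  note Hm = subgroup.m_closed[OF sub] and Hi = subgroup.m_inv_closed[OF sub]
  have g: "g \<in> carrier G" "g \<notin> H" and k: "k \<in> H" "k \<noteq> \<one>" and gk: "inv g \<otimes> k \<otimes> g \<in> H"
    using w by (auto simp: intersection_witness_def)
  have kc: "k \<in> carrier G" by (rule Hc[OF k(1)])
  obtain p where p: "\<And>i. i \<le> n \<Longrightarrow> p i \<in> carrier G \<and> len (p i) = i \<and> gap (p i) g = n - i"
    using geodesic_points[OF g(1)] unfolding n_def by blast
  have pp: "gap (p i) (p j) \<le> max i j - min i j" if "i \<le> n" "j \<le> n" for i j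
    using geodesic_gap[of g "p i" "p j"] p[of i] p[of j] that g by (auto simp: n_def)
  \<comment> \<open>The points on the path from \<open>1\<close> to \<open>g\<close> around the other three sides of the quadrilateral.\<close>
  define S where "S = H \<union> (\<lambda>i. k \<otimes> p i) ` {..n} \<union> (\<lambda>h. g \<otimes> h) ` H"
  have Sc: "S \<subseteq> carrier G"
    using Hc g p kc by (auto simp: S_def)
  have path: "(\<one>, g) \<in> (hop S L)\<^sup>*"
  proof -
    have "(\<one>, \<one> \<otimes> k) \<in> (hop H L)\<^sup>*"
      using hop_sub_group[of k X L H \<one>] k X Hm subgroup.subset[OF sub] subgroup.one_closed[OF sub]
      unfolding H by blast
    then have "(\<one>, k) \<in> (hop S L)\<^sup>*"
      using hop_mono[of H S L L] kc by (auto simp: S_def)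
    also have "(k, k \<otimes> p 0) \<in> hop S L"
      using k kc p[of 0] by (auto simp: hop_def S_def)
    also have "(k \<otimes> p 0, k \<otimes> p i) \<in> (hop S L)\<^sup>*" if "i \<le> n" for i
      using that
    proof (induction i)
      case (Suc i)
      then have "(k \<otimes> p i, k \<otimes> p (Suc i)) \<in> hop S L"
        using kc p[of i] p[of "Suc i"] pp[of i "Suc i"] L by (auto simp: hop_def S_def)
      then show ?case using Suc by (meson Suc_leD rtrancl.rtrancl_into_rtrancl)
    qed simp
    from this[of n] have "(k \<otimes> p 0, k \<otimes> p n) \<in> (hop S L)\<^sup>*" by simp
    also have "(k \<otimes> p n, k \<otimes> g) \<in> hop S L"
    proof -
      have "k \<otimes> g = g \<otimes> (inv g \<otimes> k \<otimes> g)" using kc g by (simp add: m_assoc)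
      then have "k \<otimes> g \<in> S" using gk by (auto simp: S_def)
      then show ?thesis using kc p[of n] g by (auto simp: hop_def S_def)
    qed
    also have "(k \<otimes> g, g) \<in> (hop S L)\<^sup>*"
    proof -
      let ?k = "inv g \<otimes> k \<otimes> g"
      have "(g \<otimes> ?k, g \<otimes> ?k \<otimes> inv ?k) \<in> (hop ((\<lambda>h. g \<otimes> h) ` H) L)\<^sup>*"
      proof (rule hop_sub_group[OF _ X(1,2)])
        show "inv ?k \<in> generate G X" using Hi[OF gk] H by simp
        show "s \<otimes> h \<in> (\<lambda>h. g \<otimes> h) ` H" if "s \<in> (\<lambda>h. g \<otimes> h) ` H" "h \<in> generate G X" for s h
          using that Hm Hc g H by (force simp: m_assoc)
      qed (use gk g Hc in auto)
      moreover have "g \<otimes> ?k = k \<otimes> g" "k \<otimes> g \<otimes> inv ?k = g"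
        using kc g by (simp_all add: m_assoc inv_mult_group)
      ultimately show ?thesis
        using hop_mono[of "(\<lambda>h. g \<otimes> h) ` H" S L L] by (auto simp: S_def)
    qed
    finally show ?thesis .
  qed
  \<comment> \<open>A point \<open>p i\<close> away from the ends cannot be close to \<open>H\<close> or to \<open>gH\<close>, as that would make \<open>g\<close> shorter.
    So it is close to some \<open>k \<otimes> p j\<close>, and minimality of \<open>g\<close> forces \<open>i\<close> and \<open>j\<close> to be close.\<close>
  have mid: "inv (p i) \<otimes> k \<otimes> p i \<in> ball (2 * L)" if i: "L < i" "i + L < n" for i
  proof -
    have pi: "p i \<in> carrier G" "len (p i) = i" "gap (p i) g = n - i" using p[of i] i by auto
    have "\<one> \<in> S" using subgroup.one_closed[OF sub] by (simp add: S_def)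
    from bottleneck[OF Sc this path pi(1)] obtain q where q: "q \<in> S" "gap (p i) q \<le> L"
      using pi i by (auto simp: n_def)
    then consider (H) "q \<in> H" | (gH) h where "h \<in> H" "q = g \<otimes> h" | (kp) j where "j \<le> n" "q = k \<otimes> p j"
      by (auto simp: S_def)
    then have "gap (p i) (k \<otimes> p i) \<le> 2 * L"
    proof cases
      case H
      then have qc: "q \<in> carrier G" by (rule Hc)
      have "n \<le> len (inv q \<otimes> g)"
        using min[OF witness_left[OF sub w Hi[OF H]]] by (simp add: n_def)
      also have "\<dots> \<le> gap (p i) q + gap (p i) g"
        using gap_triangle[of q "p i" g] gap_sym[of q "p i"] pi g qc by (simp add: gap_def)
      finally show ?thesis using q pi i by simp
    next
      case gH
      then have qc: "q \<in> carrier G" using g Hc by simp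
      have "n \<le> len q"
        using min[OF witness_right[OF sub w gH(1)]] gH by (simp add: n_def)
      also have "\<dots> \<le> i + gap (p i) q"
        using gap_triangle[of \<one> "p i" q] pi qc by simp
      finally show ?thesis using q pi i by simp
    next
      case kp
      have pj: "p j \<in> carrier G" "len (p j) = j" "gap (p j) g = n - j" using p[of j] kp by auto
      have "n \<le> gap k g"
        using min[OF witness_left[OF sub w Hi[OF k(1)]]] by (simp add: n_def gap_def)
      also have "\<dots> \<le> gap k q + gap q (p i) + gap (p i) g"
        using gap_triangle[of k q g] gap_triangle[of q "p i" g] kp pj pi kc g by simp
      also have "\<dots> \<le> j + L + (n - i)"
        using kp pj pi kc q gap_sym[of "p i" q] by simp
      finally have 1: "i \<le> j + L" using i by simp
      have "n \<le> len (k \<otimes> g)"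
        using min[OF witness_left[OF sub w k(1)]] by (simp add: n_def)
      also have "\<dots> \<le> len (p i) + gap (p i) q + gap q (k \<otimes> g)"
        using gap_triangle[of \<one> "p i" "k \<otimes> g"] gap_triangle[of "p i" q "k \<otimes> g"] kp pj pi kc g by simp
      also have "\<dots> \<le> i + L + (n - j)"
        using kp pj pi kc q g by simp
      finally have 2: "j \<le> i + L" using kp by simp
      have "gap (p i) (k \<otimes> p i) \<le> gap (p i) q + gap q (k \<otimes> p i)"
        using gap_triangle[of "p i" q "k \<otimes> p i"] kp pj pi kc by simp
      also have "gap q (k \<otimes> p i) \<le> max j i - min j i"
        using kp pj pi kc pp[of j i] i by simp
      finally show ?thesis using q 1 2 by auto
    qed
    then show ?thesis using pi kc by (simp add: ball_def gap_def m_assoc)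
  qed
  let ?f = "\<lambda>i. inv (p i) \<otimes> k \<otimes> p i"
  have "\<not> inj_on ?f {L + 1..L + N + 1}"
  proof
    assume "inj_on ?f {L + 1..L + N + 1}"
    then have "card {L + 1..L + N + 1} \<le> card (ball (2 * L))"
      by (rule card_inj_on_le) (use mid n finite_ball in \<open>auto simp: ball_def\<close>)
    then show False by (simp add: N_def)
  qed
  then obtain i j where ij: "L < i" "i < j" "j \<le> L + N + 1" "?f i = ?f j"
    unfolding inj_on_def by (metis atLeastAtMost_iff linorder_neqE_nat Suc_eq_plus1 Suc_le_eq)
  have pi: "p i \<in> carrier G" "len (p i) = i" and pj: "p j \<in> carrier G" "len (p j) = j" "gap (p j) g = n - j"
    using p[of i] p[of j] ij n by auto
  \<comment> \<open>\<open>c\<close> commutes with \<open>k\<close>, so it is a witness itself unless it lies in \<open>H\<close>; in that case it can be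
    split off from \<open>g\<close>, which removes the part of the geodesic between \<open>p i\<close> and \<open>p j\<close>.\<close>
  define c where "c = p j \<otimes> inv (p i)"
  have cc: "c \<in> carrier G" using pi pj by (simp add: c_def)
  have comm: "inv c \<otimes> k \<otimes> c = k"
  proof -
    have "inv c \<otimes> k \<otimes> c = p i \<otimes> ?f j \<otimes> inv (p i)"
      using pi pj kc by (simp add: c_def m_assoc inv_mult_group)
    also have "\<dots> = k"
      unfolding ij(4)[symmetric] using pi kc by (simp add: m_assoc)
    finally show ?thesis .
  qed
  show False
  proof (cases "c \<in> H")
    case False
    then have "intersection_witness H c k" using k cc comm by (simp add: intersection_witness_def)
    then have "n \<le> len c" using min by (simp add: n_def)
    also have "\<dots> \<le> j + i" using len_mult[of "p j" "inv (p i)"] pi pj by (simp add: c_def len_inv)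
    finally show False using n ij by simp
  next
    case True
    have "n \<le> len (inv c \<otimes> g)"
      using min[OF witness_left[OF sub w Hi[OF True]]] by (simp add: n_def)
    also have "inv c \<otimes> g = p i \<otimes> (inv (p j) \<otimes> g)"
      using pi pj g by (simp add: c_def inv_mult_group m_assoc)
    also have "len \<dots> \<le> i + (n - j)"
      using len_mult[of "p i" "inv (p j) \<otimes> g"] pi pj g by (simp add: gap_def)
    finally show False using n ij by simp
  qed
qed

text \<open>
  For fixed \<open>g\<close>, the whole geodesic from \<open>1\<close> to \<open>k\<close> is close to \<open>H\<close> and also to \<open>gH\<close>, the latter via the
  path \<open>1, g, \<dots>, kg, k\<close>. So each point on it is \<open>h \<otimes> u = g \<otimes> h' \<otimes> u'\<close> with short \<open>u\<close> and \<open>u'\<close>. If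
  the pair \<open>u, u'\<close> repeats at \<open>p i\<close> and \<open>p j\<close>, then \<open>p j \<otimes> inv (p i)\<close> can replace \<open>k\<close>.
\<close>

lemma witness_element_short:
  assumes X: "X \<subseteq> carrier G" "\<And>x. x \<in> X \<Longrightarrow> len x \<le> L"
    and H: "H = generate G X"
    and w: "intersection_witness H g k" and B: "len g \<le> B" "L \<le> B"
  shows "\<exists>k'. intersection_witness H g k' \<and> len k' \<le> 2 * (card (ball L) * card (ball (2 * B)))"
proof -
  obtain k where w: "intersection_witness H g k"
    and min: "\<And>k'. intersection_witness H g k' \<Longrightarrow> len k \<le> len k'"
    using ex_has_least_nat[of "intersection_witness H g" k len] w by blast
  define N where "N = card (ball L) * card (ball (2 * B))"
  have "len k \<le> 2 * N"
  proof (cases "len k < N")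
    case False
    have sub: "subgroup H G" unfolding H by (rule generate_is_subgroup[OF X(1)])
    have Hc: "h \<in> carrier G" if "h \<in> H" for h using that sub by (rule subgroup.mem_carrier[rotated])
    note Hm = subgroup.m_closed[OF sub] and Hi = subgroup.m_inv_closed[OF sub]
      and H1 = subgroup.one_closed[OF sub]
    have g: "g \<in> carrier G" "g \<notin> H" and k: "k \<in> H" "k \<noteq> \<one>" and gk: "inv g \<otimes> k \<otimes> g \<in> H"
      using w by (auto simp: intersection_witness_def)
    have kc: "k \<in> carrier G" by (rule Hc[OF k(1)])
    obtain p where p: "\<And>i. i \<le> len k \<Longrightarrow> p i \<in> carrier G \<and> len (p i) = i \<and> gap (p i) k = len k - i"
      using geodesic_points[OF kc] by blast
    have nearH: "\<exists>h\<in>H. gap (p i) h \<le> L" if "i \<le> len k" for i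
    proof (rule bottleneck)
      have "(\<one>, \<one> \<otimes> k) \<in> (hop H L)\<^sup>*"
        using hop_sub_group[of k X L H \<one>] k X Hm subgroup.subset[OF sub] H1
        unfolding H by blast
      then show "(\<one>, k) \<in> (hop H L)\<^sup>*" using kc by simp
    qed (use p[OF that] that Hc H1 in auto)
    have neargH: "\<exists>h\<in>H. gap (p i) (g \<otimes> h) \<le> 2 * B" if "i \<le> len k" for i
    proof -
      let ?gH = "(\<lambda>h. g \<otimes> h) ` H" and ?k = "inv g \<otimes> k \<otimes> g"
      \<comment> \<open>The first and last jumps have length \<open>len g\<close>, which is why \<open>B\<close> and not \<open>L\<close> is the jump bound.\<close>
      define S where "S = {\<one>, k} \<union> ?gH"
      have "g \<otimes> \<one> \<in> S" using H1 unfolding S_def by blast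
      then have "(\<one>, g \<otimes> \<one>) \<in> hop S B"
        using g B by (simp add: hop_def S_def)
      also have "(g \<otimes> \<one>, g \<otimes> \<one> \<otimes> ?k) \<in> (hop S B)\<^sup>*"
      proof -
        have "(g \<otimes> \<one>, g \<otimes> \<one> \<otimes> ?k) \<in> (hop ?gH L)\<^sup>*"
        proof (rule hop_sub_group[OF _ X(1,2)])
          show "?k \<in> generate G X" using gk H by simp
          show "s \<otimes> h \<in> ?gH" if "s \<in> ?gH" "h \<in> generate G X" for s h
            using that Hm Hc g H by (force simp: m_assoc)
          show "?gH \<subseteq> carrier G" using g Hc by auto
          show "g \<otimes> \<one> \<in> ?gH" using H1 by blast
        qed
        then show ?thesis using hop_mono[of ?gH S L B] B by (auto simp: S_def)
      qed
      also have eq: "g \<otimes> \<one> \<otimes> ?k = k \<otimes> g" using g kc by (simp add: m_assoc)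
      also have "(k \<otimes> g, k) \<in> hop S B"
      proof -
        have "k \<otimes> g = g \<otimes> ?k" using eq g by simp
        then have "k \<otimes> g \<in> S" using gk unfolding S_def by blast
        then show ?thesis using g kc B gap_sym[of "k \<otimes> g" k] by (auto simp: hop_def S_def)
      qed
      finally have path: "(\<one>, k) \<in> (hop S B)\<^sup>*" .
      have "\<exists>q\<in>S. gap (p i) q \<le> B"
        by (rule bottleneck[OF _ _ path]) (use p[OF that] that Hc kc g in \<open>auto simp: S_def\<close>)
      then obtain q where q: "q \<in> S" "gap (p i) q \<le> B" by blast
      have qc: "q \<in> carrier G" using q kc g Hc by (auto simp: S_def)
      have "\<exists>h\<in>H. gap q (g \<otimes> h) \<le> B"
        using q(1) unfolding S_def
      proof (elim UnE insertE emptyE)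
        assume "q = \<one>"
        then show ?thesis using g B H1 by (intro bexI[of _ \<one>]) auto
      next
        assume q: "q = k"
        have "gap k (g \<otimes> ?k) \<le> B" using eq g kc B by simp
        then show ?thesis using q gk by blast
      next
        assume "q \<in> ?gH"
        then show ?thesis using qc g Hc by (force simp: gap_def len_one)
      qed
      then obtain h where "h \<in> H" "gap q (g \<otimes> h) \<le> B" by blast
      then show ?thesis
        using gap_triangle[of "p i" q "g \<otimes> h"] q qc p[OF that] g Hc by (intro bexI[of _ h]) auto
    qed
    obtain a where a: "\<And>i. i \<le> len k \<Longrightarrow> a i \<in> H \<and> gap (p i) (a i) \<le> L"
      using nearH by metis
    obtain b where b: "\<And>i. i \<le> len k \<Longrightarrow> b i \<in> H \<and> gap (p i) (g \<otimes> b i) \<le> 2 * B"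
      using neargH by metis
    let ?f = "\<lambda>i. (inv (p i) \<otimes> a i, inv (p i) \<otimes> (g \<otimes> b i))"
    have "\<not> inj_on ?f {0..N}"
    proof
      assume "inj_on ?f {0..N}"
      then have "card {0..N} \<le> card (ball L \<times> ball (2 * B))"
        by (rule card_inj_on_le)
           (use a b p g Hc False finite_ball in \<open>auto simp: ball_def gap_def image_subset_iff\<close>)
      then show False by (simp add: N_def card_cartesian_product)
    qed
    then obtain i j where ij: "i < j" "j \<le> N" "?f i = ?f j"
      unfolding inj_on_def by (metis atLeastAtMost_iff linorder_neqE_nat)
    have pi: "p i \<in> carrier G" "len (p i) = i" and pj: "p j \<in> carrier G" "len (p j) = j"
      using p[of i] p[of j] ij False by auto
    have ab: "a i \<in> H" "a j \<in> H" "b i \<in> H" "b j \<in> H"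
      using a[of i] a[of j] b[of i] b[of j] ij False by auto
    define c where "c = p j \<otimes> inv (p i)"
    have c_eq: "c = x \<otimes> inv y"
      if "inv (p i) \<otimes> y = inv (p j) \<otimes> x" "x \<in> carrier G" "y \<in> carrier G" for x y
    proof -
      have x: "x = p j \<otimes> (inv (p i) \<otimes> y)" using that pj by simp
      have "x \<otimes> inv y = p j \<otimes> inv (p i)"
        by (subst x) (simp add: m_assoc that(3) pi pj)
      then show ?thesis by (simp add: c_def)
    qed
    have "c = a j \<otimes> inv (a i)" using c_eq[of "a i" "a j"] ij ab Hc by simp
    then have "c \<in> H" using ab Hm Hi by simp
    moreover have "c = (g \<otimes> b j) \<otimes> inv (g \<otimes> b i)" using c_eq[of "g \<otimes> b i" "g \<otimes> b j"] ij ab Hc g by simp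
    then have "inv g \<otimes> c \<otimes> g = b j \<otimes> inv (b i)" using ab Hc g by (simp add: inv_mult_group m_assoc)
    then have "inv g \<otimes> c \<otimes> g \<in> H" using ab Hm Hi by simp
    moreover have "c \<noteq> \<one>"
    proof
      assume "c = \<one>"
      then have "p j = p i" using pi pj by (metis c_def inv_equality inv_closed inv_inv)
      then show False using pi pj ij by simp
    qed
    ultimately have "intersection_witness H g c" using g by (simp add: intersection_witness_def)
    then have "len k \<le> len c" by (rule min)
    also have "\<dots> \<le> j + i" using len_mult[of "p j" "inv (p i)"] pi pj by (simp add: c_def len_inv)
    finally show ?thesis using ij by simp
  qed simp
  then show ?thesis using w by (auto simp: N_def)
qed

lemma bounded_witness:
  assumes X: "X \<subseteq> carrier G" "\<And>x. x \<in> X \<Longrightarrow> len x \<le> L"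
    and w: "intersection_witness (generate G X) g k" and L: "1 \<le> L"
    and B: "2 * (L + card (ball (2 * L)) + 1) \<le> B"
  shows "\<exists>g k. intersection_witness (generate G X) g k \<and> len g \<le> B \<and>
    len k \<le> 2 * (card (ball L) * card (ball (2 * B)))"
proof -
  let ?P = "\<lambda>g. \<exists>k. intersection_witness (generate G X) g k"
  obtain g k where w: "intersection_witness (generate G X) g k"
    and min: "\<And>g'. ?P g' \<Longrightarrow> len g \<le> len g'"
    using ex_has_least_nat[of ?P g len] w by blast
  have "len g \<le> B"
    using minimal_witness_short[OF X HOL.refl L w] min B by (meson le_trans)
  then show ?thesis
    using witness_element_short[OF X HOL.refl w, of B] B by auto
qed

text \<open>
  Write an element of the ball as a product of elements of \<open>T\<close> in the ball, with as few factors as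
  possible. A partial product that is at least as long as its two neighbours could be skipped by
  multiplying the factors before and after it, since by the four-point condition these two neighbours
  are at distance at most \<open>M\<close>. So there is no such partial product, all of them are in the ball, and they are
  in \<open>T\<close> one after the other.
\<close>

lemma ball_closure:
  assumes X: "X \<subseteq> carrier G" "\<And>x. x \<in> X \<Longrightarrow> len x \<le> M"
    and T: "\<one> \<in> T" "X \<subseteq> T"
    and T_inv: "\<And>x. x \<in> T \<Longrightarrow> x \<in> ball M \<Longrightarrow> inv x \<in> T"
    and T_mult: "\<And>x y. x \<in> T \<Longrightarrow> y \<in> T \<Longrightarrow> x \<in> ball M \<Longrightarrow> y \<in> ball M \<Longrightarrow> x \<otimes> y \<in> ball M \<Longrightarrow> x \<otimes> y \<in> T"
  shows "generate G X \<inter> ball M \<subseteq> T"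
proof -
  define W where "W = T \<inter> ball M"
  have Wc: "w \<in> carrier G" if "w \<in> W" for w using that by (simp add: W_def ball_def)
  define pr where "pr = foldr (\<otimes>)"
  have prc: "pr ss \<one> \<in> carrier G" if "set ss \<subseteq> W" for ss
    using that by (induction ss) (auto simp: pr_def Wc)
  have pr_app: "pr (ss @ ts) \<one> = pr ss \<one> \<otimes> pr ts \<one>" if "set ss \<subseteq> W" "set ts \<subseteq> W" for ss ts
    using that
  proof (induction ss)
    case Nil
    then show ?case using prc[of ts] by (simp add: pr_def)
  next
    case (Cons s ss)
    then show ?case using prc[of ts] prc[of ss] Wc[of s] by (simp add: pr_def m_assoc)
  qed
  have pr_Cons: "pr (s # ss) \<one> = s \<otimes> pr ss \<one>" and pr_Nil: "pr [] \<one> = \<one>" for s ss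
    by (simp_all add: pr_def)
  have W1: "\<one> \<in> W" using T by (simp add: W_def ball_def len_one)
  have ex: "\<exists>ss. set ss \<subseteq> W \<and> pr ss \<one> = h" if "h \<in> generate G X" for h
    using that
  proof (induction rule: generate.induct)
    case one
    show ?case by (intro exI[of _ "[]"]) (simp add: pr_def)
  next
    case (incl h)
    then have "h \<in> W" using X T by (auto simp: W_def ball_def)
    then show ?case using Wc by (intro exI[of _ "[h]"]) (simp add: pr_def)
  next
    case (inv h)
    then have "inv h \<in> W" using X T T_inv by (auto simp: W_def ball_def len_inv subset_iff)
    then show ?case using Wc by (intro exI[of _ "[inv h]"]) (simp add: pr_def)
  next
    case (eng h1 h2)
    then obtain s1 s2 where "set s1 \<subseteq> W" "pr s1 \<one> = h1" "set s2 \<subseteq> W" "pr s2 \<one> = h2" by blast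
    then show ?case using pr_app[of s1 s2] by (intro exI[of _ "s1 @ s2"]) auto
  qed
  show ?thesis
  proof
    fix h assume "h \<in> generate G X \<inter> ball M"
    then have h: "h \<in> generate G X" "len h \<le> M" by (auto simp: ball_def)
    let ?P = "\<lambda>ss. set ss \<subseteq> W \<and> pr ss \<one> = h"
    obtain s0 where "?P s0" using ex[OF h(1)] by blast
    then obtain ss where ss: "set ss \<subseteq> W" "pr ss \<one> = h" and min: "\<And>ts. ?P ts \<Longrightarrow> length ss \<le> length ts"
      using ex_has_least_nat[of ?P s0 length] by blast
    define q where "q i = pr (take i ss) \<one>" for i
    have tk: "set (take i ss) \<subseteq> W" for i using ss(1) by (rule order_trans[OF set_take_subset])
    have qc: "q i \<in> carrier G" for i unfolding q_def by (rule prc[OF tk])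
    have q_Suc: "q (Suc i) = q i \<otimes> ss ! i" "ss ! i \<in> W" if "i < length ss" for i
    proof -
      show "ss ! i \<in> W" using that ss by auto
      then show "q (Suc i) = q i \<otimes> ss ! i"
        using that pr_app[OF tk[of i], of "[ss ! i]"] Wc[of "ss ! i"]
        by (simp add: q_def take_Suc_conv_app_nth pr_Cons pr_Nil)
    qed
    \<comment> \<open>Skipping the partial product \<open>q (Suc i)\<close> would give a shorter list of factors.\<close>
    have no_peak: False
      if i: "Suc i < length ss" and pk: "len (q i) \<le> len (q (Suc i))" "len (q (Suc (Suc i))) \<le> len (q (Suc i))" for i
    proof -
      let ?s = "ss ! i" and ?t = "ss ! Suc i"
      have st: "?s \<in> W" "?t \<in> W" and q1: "q (Suc i) = q i \<otimes> ?s"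
        and q2: "q (Suc (Suc i)) = q (Suc i) \<otimes> ?t"
        using q_Suc[of i] q_Suc[of "Suc i"] i by simp_all
      have stc: "?s \<in> carrier G" "?t \<in> carrier G" by (rule Wc[OF st(1)], rule Wc[OF st(2)])
      have sM: "len ?s \<le> M" "len ?t \<le> M" using st by (simp_all add: W_def ball_def)
      have q: "q (Suc (Suc i)) = q i \<otimes> (?s \<otimes> ?t)"
        unfolding q2 q1 by (rule m_assoc[OF qc stc])
      have "gap (q i) (q (Suc i)) \<le> M" unfolding q1 gap_mult[OF qc stc(1)] by (rule sM)
      moreover have "gap (q (Suc i)) (q (Suc (Suc i))) \<le> M"
        unfolding q2 gap_mult[OF qc stc(2)] by (rule sM)
      ultimately have "gap (q i) (q (Suc (Suc i))) \<le> M"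
        using four_point[OF qc[of i] qc[of "Suc i"] qc[of "Suc (Suc i)"]] pk by simp
      then have "?s \<otimes> ?t \<in> ball M" using q qc[of i] stc by (simp add: ball_def)
      then have stW: "?s \<otimes> ?t \<in> W" using st T_mult by (simp add: W_def)
      let ?ts = "take i ss @ [?s \<otimes> ?t] @ drop (Suc (Suc i)) ss"
      have dr: "set (drop (Suc (Suc i)) ss) \<subseteq> W" using ss(1) by (rule order_trans[OF set_drop_subset])
      have "ss = take i ss @ [?s, ?t] @ drop (Suc (Suc i)) ss"
        using i id_take_nth_drop[of i ss] Cons_nth_drop_Suc[of "Suc i" ss] by simp
      then have "h = pr (take i ss @ [?s, ?t] @ drop (Suc (Suc i)) ss) \<one>" using ss by simp
      also have "\<dots> = pr ?ts \<one>"
        using pr_app[OF tk[of i]] dr st stW stc prc[OF dr] by (simp add: pr_Cons m_assoc)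
      finally have "pr ?ts \<one> = h" by simp
      then have "length ss \<le> length ?ts" using tk dr stW by (intro min) auto
      then show False using i by simp
    qed
    have q0: "len (q 0) = 0" by (simp add: q_def pr_def len_one)
    have qn: "q (length ss) = h" by (simp add: q_def ss)
    have short: "len (q i) \<le> M" if i: "i \<le> length ss" for i
    proof (rule ccontr)
      assume big: "\<not> ?thesis"
      define m where "m = Max ((\<lambda>i. len (q i)) ` {..length ss})"
      have "m \<in> (\<lambda>i. len (q i)) ` {..length ss}" unfolding m_def by (rule Max_in) auto
      then obtain j where j: "j \<le> length ss" "len (q j) = m" by auto
      have le: "len (q i) \<le> m" if "i \<le> length ss" for i unfolding m_def using that by (intro Max_ge) auto
      have "m > M" using le[OF i] big by simp
      then have "j \<noteq> 0" "j \<noteq> length ss" using q0 qn h j by (auto intro!: Nat.gr0I)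
      then obtain j' where "j = Suc j'" "j < length ss" using j by (cases j) auto
      then show False using no_peak[of j'] le[of j'] le[of "Suc j"] j by simp
    qed
    have "q i \<in> T" if "i \<le> length ss" for i
      using that
    proof (induction i)
      case 0
      then show ?case using T by (simp add: q_def pr_def)
    next
      case (Suc i)
      then have "q i \<in> T" "q i \<in> ball M" "q (Suc i) \<in> ball M" using short[of i] short[of "Suc i"] qc by (auto simp: ball_def)
      then show ?case using T_mult[of "q i" "ss ! i"] q_Suc[of i] Suc.prems by (auto simp: W_def)
    qed
    from this[of "length ss"] show "h \<in> T" using qn by simp
  qed
qed

end

section \<open>Normal forms in an amalgam\<close>

text \<open>
  The two factors are indexed by \<open>bool\<close>, so that everything that is symmetric in them is proved
  once.
\<close>

locale amalgam =
  fixes Gr :: "bool \<Rightarrow> 'g monoid" and A :: "('a, 'm) monoid_scheme" and \<phi> :: "bool \<Rightarrow> 'a \<Rightarrow> 'g"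
  assumes group_Gr: "group (Gr i)"
    and group_A: "group A"
    and \<phi>_mon: "\<phi> i \<in> mon A (Gr i)"
    and finite_Gr: "finite (carrier (Gr i))"
begin

sublocale A: group A by (rule group_A)
sublocale Gr: group "Gr i" for i by (rule group_Gr)

lemma \<phi>_hom: "group_hom A (Gr i) (\<phi> i)"
  using \<phi>_mon by (auto simp: group_hom_def group_hom_axioms_def group_A group_Gr mon_def)

sublocale \<phi>: group_hom A "Gr i" "\<phi> i" for i by (rule \<phi>_hom)

lemma \<phi>_inj: "inj_on (\<phi> i) (carrier A)"
  using \<phi>_mon by (auto simp: mon_def)

definition edge :: "bool \<Rightarrow> 'g set" where
  "edge i = \<phi> i ` carrier A"

lemma subgroup_edge: "subgroup (edge i) (Gr i)"
  unfolding edge_def by (rule \<phi>.img_is_subgroup)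

text \<open>
  \<open>rep i\<close> chooses representatives of the left cosets of the amalgamated subgroup, and \<open>rest i x\<close> is the
  element of \<open>A\<close> with \<open>x = rep i x \<otimes> \<phi> i (rest i x)\<close>. The choice depends only on the coset, because the
  predicate under \<open>SOME\<close> does; the trivial coset must have the representative \<open>1\<close>.
\<close>

definition rep :: "bool \<Rightarrow> 'g \<Rightarrow> 'g" where
  "rep i x = (if x \<in> edge i then \<one>\<^bsub>Gr i\<^esub>
     else SOME y. y \<in> carrier (Gr i) \<and> inv\<^bsub>Gr i\<^esub> y \<otimes>\<^bsub>Gr i\<^esub> x \<in> edge i)"

definition rest :: "bool \<Rightarrow> 'g \<Rightarrow> 'a" where
  "rest i x = the_inv_into (carrier A) (\<phi> i) (inv\<^bsub>Gr i\<^esub> (rep i x) \<otimes>\<^bsub>Gr i\<^esub> x)"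

lemma edge_mult_iff:
  assumes "x \<in> carrier (Gr i)" "e \<in> edge i"
  shows "x \<otimes>\<^bsub>Gr i\<^esub> e \<in> edge i \<longleftrightarrow> x \<in> edge i"
proof
  have e: "e \<in> carrier (Gr i)" using assms subgroup.mem_carrier[OF subgroup_edge] by blast
  assume "x \<otimes>\<^bsub>Gr i\<^esub> e \<in> edge i"
  then have "x \<otimes>\<^bsub>Gr i\<^esub> e \<otimes>\<^bsub>Gr i\<^esub> inv\<^bsub>Gr i\<^esub> e \<in> edge i"
    using assms subgroup.m_closed[OF subgroup_edge] subgroup.m_inv_closed[OF subgroup_edge] by blast
  then show "x \<in> edge i" using assms e by (simp add: Gr.m_assoc)
qed (use assms subgroup.m_closed[OF subgroup_edge] in blast)

lemma rep_closed_edge: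
  assumes "x \<in> carrier (Gr i)"
  shows "rep i x \<in> carrier (Gr i) \<and> inv\<^bsub>Gr i\<^esub> (rep i x) \<otimes>\<^bsub>Gr i\<^esub> x \<in> edge i"
proof (cases "x \<in> edge i")
  case False
  have "x \<in> carrier (Gr i) \<and> inv\<^bsub>Gr i\<^esub> x \<otimes>\<^bsub>Gr i\<^esub> x \<in> edge i"
    using assms subgroup.one_closed[OF subgroup_edge] by simp
  from someI[of "\<lambda>y. y \<in> carrier (Gr i) \<and> inv\<^bsub>Gr i\<^esub> y \<otimes>\<^bsub>Gr i\<^esub> x \<in> edge i", OF this] False
  show ?thesis by (simp add: rep_def)
qed (simp add: rep_def assms)

lemma rep_closed [simp]: "x \<in> carrier (Gr i) \<Longrightarrow> rep i x \<in> carrier (Gr i)"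
  using rep_closed_edge by blast

lemma \<phi>_the_inv: "e \<in> edge i \<Longrightarrow> \<phi> i (the_inv_into (carrier A) (\<phi> i) e) = e"
  unfolding edge_def by (rule f_the_inv_into_f[OF \<phi>_inj])

lemma the_inv_closed: "e \<in> edge i \<Longrightarrow> the_inv_into (carrier A) (\<phi> i) e \<in> carrier A"
  unfolding edge_def by (rule the_inv_into_into[OF \<phi>_inj]) auto

lemma rest_closed [simp]: "x \<in> carrier (Gr i) \<Longrightarrow> rest i x \<in> carrier A"
  unfolding rest_def using rep_closed_edge by (blast intro: the_inv_closed)

lemma rep_rest:
  assumes "x \<in> carrier (Gr i)"
  shows "rep i x \<otimes>\<^bsub>Gr i\<^esub> \<phi> i (rest i x) = x"
  using assms rep_closed_edge[OF assms]
  by (simp add: rest_def \<phi>_the_inv Gr.m_assoc[symmetric])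

lemma rep_mult:
  assumes x: "x \<in> carrier (Gr i)" and a: "a \<in> carrier A"
  shows "rep i (x \<otimes>\<^bsub>Gr i\<^esub> \<phi> i a) = rep i x"
proof -
  have e: "\<phi> i a \<in> edge i" using a by (simp add: edge_def)
  have "inv\<^bsub>Gr i\<^esub> y \<otimes>\<^bsub>Gr i\<^esub> (x \<otimes>\<^bsub>Gr i\<^esub> \<phi> i a) \<in> edge i \<longleftrightarrow> inv\<^bsub>Gr i\<^esub> y \<otimes>\<^bsub>Gr i\<^esub> x \<in> edge i"
    if "y \<in> carrier (Gr i)" for y
    using edge_mult_iff[of "inv\<^bsub>Gr i\<^esub> y \<otimes>\<^bsub>Gr i\<^esub> x" i "\<phi> i a"] that x a e by (simp add: Gr.m_assoc)
  then show ?thesis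
    using edge_mult_iff[OF x e] by (simp add: rep_def cong: conj_cong)
qed

lemma rest_unique:
  assumes "r \<in> carrier (Gr i)" "a \<in> carrier A" "rep i x = r" "x = r \<otimes>\<^bsub>Gr i\<^esub> \<phi> i a"
  shows "rest i x = a"
  using assms by (simp add: rest_def Gr.m_assoc[symmetric] the_inv_into_f_f[OF \<phi>_inj])

lemma rep_eq_one_iff:
  assumes "x \<in> carrier (Gr i)"
  shows "rep i x = \<one>\<^bsub>Gr i\<^esub> \<longleftrightarrow> x \<in> edge i"
proof
  assume "rep i x = \<one>\<^bsub>Gr i\<^esub>"
  then have "x = \<phi> i (rest i x)" using rep_rest[OF assms] assms by simp
  then show "x \<in> edge i" using assms by (auto simp: edge_def)
qed (simp add: rep_def)

lemma rep_rep:
  assumes "x \<in> carrier (Gr i)"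
  shows "rep i (rep i x) = rep i x"
  using rep_mult[of "rep i x" i "rest i x"] assms by (simp add: rep_rest)

text \<open>
  A normal form is \<open>r\<^sub>1 \<cdots> r\<^sub>n a\<close> with nontrivial coset representatives from alternating factors and
  \<open>a\<close> in \<open>A\<close>. The representatives are listed in reverse, \<open>r\<^sub>n\<close> first, since right multiplication
  changes that end.
\<close>

definition stack :: "(bool \<times> 'g) list \<Rightarrow> bool" where
  "stack s \<longleftrightarrow> successively (\<lambda>p q. fst p \<noteq> fst q) s \<and>
     (\<forall>(i, r)\<in>set s. r \<in> carrier (Gr i) \<and> rep i r = r \<and> r \<noteq> \<one>\<^bsub>Gr i\<^esub>)"

definition states :: "((bool \<times> 'g) list \<times> 'a) set" where
  "states = {(s, a). stack s \<and> a \<in> carrier A}"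

definition free_top :: "bool \<Rightarrow> (bool \<times> 'g) list \<Rightarrow> bool" where
  "free_top i s \<longleftrightarrow> s = [] \<or> fst (hd s) \<noteq> i"

text \<open>
  For each factor \<open>i\<close>, \<open>pop i\<close> splits off the largest final part of a normal form that lies in that
  factor, and \<open>push i\<close> puts it back. These maps are mutually inverse, so right multiplication in the factor can be
  transported to an action on normal forms; the laws of an action are then immediate.
\<close>

definition push :: "bool \<Rightarrow> (bool \<times> 'g) list \<times> 'g \<Rightarrow> (bool \<times> 'g) list \<times> 'a" where
  "push i = (\<lambda>(s, x). (if rep i x = \<one>\<^bsub>Gr i\<^esub> then s else (i, rep i x) # s, rest i x))"

definition pop :: "bool \<Rightarrow> (bool \<times> 'g) list \<times> 'a \<Rightarrow> (bool \<times> 'g) list \<times> 'g" where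
  "pop i = (\<lambda>(s, a). if free_top i s then (s, \<phi> i a)
     else (tl s, snd (hd s) \<otimes>\<^bsub>Gr i\<^esub> \<phi> i a))"

definition act :: "bool \<Rightarrow> 'g \<Rightarrow> (bool \<times> 'g) list \<times> 'a \<Rightarrow> (bool \<times> 'g) list \<times> 'a" where
  "act i x \<omega> = (case pop i \<omega> of (s, y) \<Rightarrow> push i (s, y \<otimes>\<^bsub>Gr i\<^esub> x))"

lemma stack_Cons:
  "stack ((i, r) # s) \<longleftrightarrow> stack s \<and> free_top i s \<and>
     r \<in> carrier (Gr i) \<and> rep i r = r \<and> r \<noteq> \<one>\<^bsub>Gr i\<^esub>"
  by (cases s) (auto simp: stack_def free_top_def)

lemma stack_Nil [simp]: "stack []"
  by (simp add: stack_def)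

lemma rep_\<phi>: "a \<in> carrier A \<Longrightarrow> rep i (\<phi> i a) = \<one>\<^bsub>Gr i\<^esub>"
  by (simp add: rep_def edge_def)

lemma rest_\<phi>: "a \<in> carrier A \<Longrightarrow> rest i (\<phi> i a) = a"
  by (rule rest_unique[of "\<one>\<^bsub>Gr i\<^esub>"]) (simp_all add: rep_\<phi>)

lemma pop_states:
  assumes "\<omega> \<in> states" "pop i \<omega> = (s, y)"
  shows "stack s" "free_top i s" "y \<in> carrier (Gr i)" "push i (s, y) = \<omega>"
proof -
  obtain t a where \<omega>: "\<omega> = (t, a)" by (cases \<omega>)
  have t: "stack t" "a \<in> carrier A" using assms(1) \<omega> by (auto simp: states_def)
  have "stack s \<and> free_top i s \<and> y \<in> carrier (Gr i) \<and> push i (s, y) = \<omega>"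
  proof (cases "free_top i t")
    case True
    then show ?thesis using assms(2) t by (auto simp: pop_def push_def \<omega> rep_\<phi> rest_\<phi>)
  next
    case False
    then obtain r u where tu: "t = (i, r) # u" by (cases t) (auto simp: free_top_def)
    have sy: "s = u" "y = r \<otimes>\<^bsub>Gr i\<^esub> \<phi> i a"
      using assms(2) False tu by (auto simp: pop_def \<omega>)
    have r: "stack u" "free_top i u" "r \<in> carrier (Gr i)" "rep i r = r" "r \<noteq> \<one>\<^bsub>Gr i\<^esub>"
      using t tu by (auto simp: stack_Cons)
    have "rep i y = r" using r t sy by (simp add: rep_mult)
    moreover have "rest i y = a" by (rule rest_unique[of r]) (use r t sy calculation in auto)
    moreover have "y \<in> carrier (Gr i)" using r t sy by simp
    ultimately show ?thesis using r by (simp add: push_def \<omega> tu sy(1))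
  qed
  then show "stack s" "free_top i s" "y \<in> carrier (Gr i)" "push i (s, y) = \<omega>" by auto
qed

lemma push_states:
  assumes "stack s" "free_top i s" "y \<in> carrier (Gr i)"
  shows "push i (s, y) \<in> states" "pop i (push i (s, y)) = (s, y)"
proof -
  show "push i (s, y) \<in> states"
    using assms by (auto simp: push_def states_def stack_Cons rep_rep)
  show "pop i (push i (s, y)) = (s, y)"
    using assms rep_rest[of y i] by (auto simp: push_def pop_def) (auto simp: free_top_def)
qed

lemma act_closed:
  assumes "\<omega> \<in> states" "x \<in> carrier (Gr i)"
  shows "act i x \<omega> \<in> states"
  using pop_states[OF assms(1)] assms(2) by (auto simp: act_def push_states split: prod.split)

lemma act_act:
  assumes "\<omega> \<in> states" "x \<in> carrier (Gr i)" "y \<in> carrier (Gr i)"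
  shows "act i y (act i x \<omega>) = act i (x \<otimes>\<^bsub>Gr i\<^esub> y) \<omega>"
proof -
  obtain s z where p: "pop i \<omega> = (s, z)" by (cases "pop i \<omega>")
  from pop_states[OF assms(1) p] show ?thesis
    using assms(2,3) by (simp add: act_def p push_states Gr.m_assoc)
qed

lemma act_one:
  assumes "\<omega> \<in> states"
  shows "act i \<one>\<^bsub>Gr i\<^esub> \<omega> = \<omega>"
proof -
  obtain s z where p: "pop i \<omega> = (s, z)" by (cases "pop i \<omega>")
  from pop_states[OF assms(1) p] show ?thesis by (simp add: act_def p)
qed

text \<open>
  The relations that identify the two copies of \<open>A\<close> hold in the action: through either factor, an
  element of \<open>A\<close> only changes the last part of a normal form.
\<close>

lemma act_\<phi>:
  assumes "(s, a) \<in> states" "b \<in> carrier A"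
  shows "act i (\<phi> i b) (s, a) = (s, a \<otimes>\<^bsub>A\<^esub> b)"
proof (cases "free_top i s")
  case True
  have "\<phi> i a \<otimes>\<^bsub>Gr i\<^esub> \<phi> i b = \<phi> i (a \<otimes>\<^bsub>A\<^esub> b)" using assms by (simp add: states_def)
  then show ?thesis using True assms
    by (simp add: act_def pop_def push_def rep_\<phi> rest_\<phi> states_def del: \<phi>.hom_mult)
next
  case False
  then obtain r u where s: "s = (i, r) # u" by (cases s) (auto simp: free_top_def)
  have c: "r \<in> carrier (Gr i)" "rep i r = r" "r \<noteq> \<one>\<^bsub>Gr i\<^esub>" "a \<in> carrier A"
    using assms by (auto simp: states_def s stack_Cons)
  have e: "r \<otimes>\<^bsub>Gr i\<^esub> \<phi> i a \<otimes>\<^bsub>Gr i\<^esub> \<phi> i b = r \<otimes>\<^bsub>Gr i\<^esub> \<phi> i (a \<otimes>\<^bsub>A\<^esub> b)"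
    using assms c by (simp add: Gr.m_assoc)
  have "rest i (r \<otimes>\<^bsub>Gr i\<^esub> \<phi> i (a \<otimes>\<^bsub>A\<^esub> b)) = a \<otimes>\<^bsub>A\<^esub> b"
    using c assms by (intro rest_unique[of r]) (auto simp: rep_mult simp del: \<phi>.hom_mult)
  then show ?thesis using False assms c
    by (simp add: act_def pop_def push_def e s rep_mult del: \<phi>.hom_mult)
qed

text \<open>
  Below its top entry the stack is never read. This locality is what makes the action computable by a
  finite table.
\<close>

lemma act_local:
  "act i x (s, a) = (case act i x (take 1 s, a) of (t, b) \<Rightarrow> (t @ drop 1 s, b))"
  by (cases s) (auto simp: act_def pop_def push_def free_top_def)

lemma finite_A: "finite (carrier A)"
  using finite_imageD[OF finite_subset[OF _ finite_Gr] \<phi>_inj] by (metis \<phi>.hom_closed image_subsetI)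

end

text \<open>
  Normal forms can be evaluated in any group to which both factors are mapped compatibly.
\<close>

locale amalgam_target = amalgam Gr A \<phi> + G: group G
  for Gr :: "bool \<Rightarrow> 'g monoid" and A :: "('a, 'm) monoid_scheme" and \<phi> :: "bool \<Rightarrow> 'a \<Rightarrow> 'g"
    and G :: "('h, 'n) monoid_scheme" (structure) +
  fixes \<iota> :: "bool \<Rightarrow> 'g \<Rightarrow> 'h"
  assumes \<iota>_hom: "\<iota> i \<in> hom (Gr i) G"
    and \<iota>_\<phi>: "a \<in> carrier A \<Longrightarrow> \<iota> i (\<phi> i a) = \<iota> j (\<phi> j a)"
begin

lemma \<iota>_group_hom: "group_hom (Gr i) G (\<iota> i)"
  by (simp add: group_hom_def group_hom_axioms_def group_Gr \<iota>_hom)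

sublocale \<iota>: group_hom "Gr i" G "\<iota> i" for i by (rule \<iota>_group_hom)

definition base :: "'a \<Rightarrow> 'h" where
  "base a = \<iota> True (\<phi> True a)"

lemma base_eq: "a \<in> carrier A \<Longrightarrow> \<iota> i (\<phi> i a) = base a"
  unfolding base_def by (rule \<iota>_\<phi>)

lemma base_closed [simp]: "a \<in> carrier A \<Longrightarrow> base a \<in> carrier G"
  by (simp add: base_def)

lemma base_inv: "a \<in> carrier A \<Longrightarrow> base (inv\<^bsub>A\<^esub> a) = inv (base a)"
  by (simp add: base_def)

lemma base_one [simp]: "base \<one>\<^bsub>A\<^esub> = \<one>"
  by (simp add: base_def)

fun word_prod :: "(bool \<times> 'g) list \<Rightarrow> 'h" where
  "word_prod [] = \<one>"
| "word_prod ((i, x) # w) = \<iota> i x \<otimes> word_prod w"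

definition syllables :: "(bool \<times> 'g) list \<Rightarrow> bool" where
  "syllables w \<longleftrightarrow> (\<forall>(i, x)\<in>set w. x \<in> carrier (Gr i))"

lemma syllables_simps [simp]:
  "syllables []" "syllables ((i, x) # w) \<longleftrightarrow> x \<in> carrier (Gr i) \<and> syllables w"
  "syllables (u @ v) \<longleftrightarrow> syllables u \<and> syllables v" "syllables (rev w) \<longleftrightarrow> syllables w"
  by (auto simp: syllables_def)

lemma stack_syllables: "stack s \<Longrightarrow> syllables s"
  by (auto simp: stack_def syllables_def)

lemma word_prod_closed [simp]: "syllables w \<Longrightarrow> word_prod w \<in> carrier G"
  by (induction w rule: word_prod.induct) auto

lemma word_prod_append: "syllables u \<Longrightarrow> syllables v \<Longrightarrow> word_prod (u @ v) = word_prod u \<otimes> word_prod v"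
  by (induction u rule: word_prod.induct) (auto simp: G.m_assoc)

definition val :: "(bool \<times> 'g) list \<times> 'a \<Rightarrow> 'h" where
  "val = (\<lambda>(s, a). word_prod (rev s) \<otimes> base a)"

lemma val_closed: "\<omega> \<in> states \<Longrightarrow> val \<omega> \<in> carrier G"
  by (auto simp: val_def states_def stack_syllables)

lemma val_push:
  assumes "syllables s" "x \<in> carrier (Gr i)"
  shows "val (push i (s, x)) = word_prod (rev s) \<otimes> \<iota> i x"
proof -
  have "\<iota> i x = \<iota> i (rep i x) \<otimes> base (rest i x)"
    using \<iota>.hom_mult[of "rep i x" i "\<phi> i (rest i x)"] assms by (simp add: rep_rest base_eq)
  then show ?thesis
    using assms by (auto simp: push_def val_def word_prod_append G.m_assoc)
qed

lemma val_act:
  assumes "\<omega> \<in> states" "x \<in> carrier (Gr i)"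
  shows "val (act i x \<omega>) = val \<omega> \<otimes> \<iota> i x"
proof -
  obtain s z where p: "pop i \<omega> = (s, z)" by (cases "pop i \<omega>")
  note ps = pop_states[OF assms(1) p]
  have "val \<omega> = word_prod (rev s) \<otimes> \<iota> i z"
    using val_push[of s z i] ps by (simp add: stack_syllables)
  then show ?thesis
    using ps assms(2) by (simp add: act_def p val_push stack_syllables G.m_assoc)
qed

end


text \<open>
  The group is the amalgamated product if taking normal forms is a section of \<open>val\<close> that
  turns right multiplication by a factor into the action. Then an element is determined by its normal
  form, and its syllable length makes sense.
\<close>

locale amalgamated_product = amalgam_target Gr A \<phi> G \<iota>
  for Gr :: "bool \<Rightarrow> 'g monoid" and A :: "('a, 'm) monoid_scheme" and \<phi> :: "bool \<Rightarrow> 'a \<Rightarrow> 'g"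
    and G :: "('h, 'n) monoid_scheme" (structure) and \<iota> :: "bool \<Rightarrow> 'g \<Rightarrow> 'h" +
  fixes nf :: "'h \<Rightarrow> (bool \<times> 'g) list \<times> 'a"
  assumes nf_states: "g \<in> carrier G \<Longrightarrow> nf g \<in> states"
    and val_nf: "g \<in> carrier G \<Longrightarrow> val (nf g) = g"
    and nf_one: "nf \<one> = ([], \<one>\<^bsub>A\<^esub>)"
    and nf_mult: "g \<in> carrier G \<Longrightarrow> x \<in> carrier (Gr i) \<Longrightarrow> nf (g \<otimes> \<iota> i x) = act i x (nf g)"
begin

definition len :: "'h \<Rightarrow> nat" where
  "len g = length (fst (nf g))"

definition reduced :: "(bool \<times> 'g) list \<Rightarrow> bool" where
  "reduced w \<longleftrightarrow> successively (\<lambda>p q. fst p \<noteq> fst q) w \<and>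
     (\<forall>(i, x)\<in>set w. x \<in> carrier (Gr i) - edge i)"

lemma reduced_Nil [simp]: "reduced []"
  by (simp add: reduced_def)

lemma reduced_Cons:
  "reduced ((i, x) # w) \<longleftrightarrow> reduced w \<and> free_top i w \<and> x \<in> carrier (Gr i) - edge i"
  by (cases w) (auto simp: reduced_def free_top_def)

lemma reduced_syllables: "reduced w \<Longrightarrow> syllables w"
  by (auto simp: reduced_def syllables_def)

lemma stack_reduced: "stack s \<Longrightarrow> reduced s"
  by (auto simp: stack_def reduced_def rep_def)

lemma reduced_rev [simp]: "reduced (rev w) \<longleftrightarrow> reduced w"
proof -
  have "successively (\<lambda>p q. fst q \<noteq> fst p) w \<longleftrightarrow> successively (\<lambda>p q. fst p \<noteq> fst q) w"
    by (rule successively_cong) auto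
  then show ?thesis by (simp only: reduced_def successively_rev set_rev)
qed

lemma reduced_append:
  "reduced (u @ v) \<longleftrightarrow> reduced u \<and> reduced v \<and>
     (u \<noteq> [] \<longrightarrow> v \<noteq> [] \<longrightarrow> fst (last u) \<noteq> fst (hd v))"
  by (auto simp: reduced_def successively_append_iff)

text \<open>
  Multiplying by a reduced product pushes one entry for each syllable, as no syllable is absorbed:
  left multiplication by \<open>\<phi> i a\<close> does not bring it into the amalgamated subgroup. This is the normal form
  theorem in terms of lengths.
\<close>

lemma nf_reduced:
  assumes "g \<in> carrier G" "nf g = (s, a)" "reduced w"
    and "w = [] \<or> free_top (fst (hd w)) s"
  shows "length (fst (nf (g \<otimes> word_prod w))) = length s + length w"
  using assms
proof (induction w arbitrary: g s a)
  case Nil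
  then show ?case by simp
next
  case (Cons p w)
  obtain i x where p: "p = (i, x)" by (cases p)
  have x: "x \<in> carrier (Gr i)" "x \<notin> edge i" and w: "reduced w" "free_top i w"
    using Cons.prems by (auto simp: p reduced_Cons)
  have sa: "stack s" "a \<in> carrier A" using nf_states[OF Cons.prems(1)] Cons.prems(2) by (auto simp: states_def)
  have "\<phi> i a \<otimes>\<^bsub>Gr i\<^esub> x \<notin> edge i"
  proof
    assume "\<phi> i a \<otimes>\<^bsub>Gr i\<^esub> x \<in> edge i"
    moreover have "\<phi> i a \<in> edge i" using sa by (simp add: edge_def)
    ultimately have "inv\<^bsub>Gr i\<^esub> \<phi> i a \<otimes>\<^bsub>Gr i\<^esub> (\<phi> i a \<otimes>\<^bsub>Gr i\<^esub> x) \<in> edge i"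
      using subgroup.m_closed[OF subgroup_edge] subgroup.m_inv_closed[OF subgroup_edge] by blast
    then show False using x sa by (simp add: Gr.m_assoc[symmetric])
  qed
  then have "rep i (\<phi> i a \<otimes>\<^bsub>Gr i\<^esub> x) \<noteq> \<one>\<^bsub>Gr i\<^esub>"
    using x sa by (simp add: rep_eq_one_iff)
  moreover have "free_top i s" using Cons.prems by (simp add: p)
  ultimately obtain r b where nf: "nf (g \<otimes> \<iota> i x) = ((i, r) # s, b)"
    using x Cons.prems by (simp add: nf_mult act_def pop_def push_def)
  have "length (fst (nf (g \<otimes> \<iota> i x \<otimes> word_prod w))) = length ((i, r) # s) + length w"
    by (rule Cons.IH[OF _ nf w(1)]) (use Cons.prems x w in \<open>auto simp: free_top_def\<close>)
  then show ?case
    using Cons.prems x w by (simp add: p G.m_assoc reduced_syllables)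
qed

lemma nf_base: "a \<in> carrier A \<Longrightarrow> nf (base a) = ([], a)"
  using nf_mult[of \<one> "\<phi> True a" True] act_\<phi>[of "[]" "\<one>\<^bsub>A\<^esub>" a True]
  by (simp add: nf_one base_def states_def)

lemma nf_mult_base:
  assumes "g \<in> carrier G" "a \<in> carrier A"
  shows "fst (nf (g \<otimes> base a)) = fst (nf g)"
proof -
  obtain s b where s: "nf g = (s, b)" by (cases "nf g")
  then show ?thesis
    using nf_mult[of g "\<phi> True a" True] act_\<phi>[of s b a True] nf_states[of g] assms
    by (simp add: base_def)
qed

lemma len_reduced:
  assumes "reduced w" "a \<in> carrier A" "b \<in> carrier A"
  shows "len (base a \<otimes> word_prod w \<otimes> base b) = length w"
  using nf_reduced[OF _ nf_base[OF assms(2)] assms(1)] assms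
  by (simp add: len_def nf_mult_base reduced_syllables free_top_def)

definition inv_syllables :: "(bool \<times> 'g) list \<Rightarrow> (bool \<times> 'g) list" where
  "inv_syllables w = rev (map (\<lambda>(i, x). (i, inv\<^bsub>Gr i\<^esub> x)) w)"

lemma inv_syllables_Cons:
  "inv_syllables ((i, x) # w) = inv_syllables w @ [(i, inv\<^bsub>Gr i\<^esub> x)]"
  by (simp add: inv_syllables_def)

lemma last_inv_syllables:
  "inv_syllables u = [] \<longleftrightarrow> u = []" "u \<noteq> [] \<Longrightarrow> fst (last (inv_syllables u)) = fst (hd u)"
  by (auto simp: inv_syllables_def last_rev hd_map split_beta)

lemma syllables_inv: "syllables w \<Longrightarrow> syllables (inv_syllables w)"
  by (auto simp: syllables_def inv_syllables_def)

lemma word_prod_inv: "syllables w \<Longrightarrow> word_prod (inv_syllables w) = inv (word_prod w)"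
proof (induction w rule: word_prod.induct)
  case 1
  then show ?case by (simp add: inv_syllables_def)
next
  case (2 i x w)
  then show ?case
    by (simp add: inv_syllables_Cons word_prod_append syllables_inv G.inv_mult_group)
qed

lemma inv_edge: "x \<in> carrier (Gr i) \<Longrightarrow> inv\<^bsub>Gr i\<^esub> x \<in> edge i \<longleftrightarrow> x \<in> edge i"
  using subgroup.m_inv_closed[OF subgroup_edge] by (metis Gr.inv_inv)

lemma reduced_inv: "reduced w \<Longrightarrow> reduced (inv_syllables w)"
proof (induction w rule: word_prod.induct)
  case 1
  then show ?case by (simp add: inv_syllables_def)
next
  case (2 i x w)
  then show ?case
    by (cases w) (auto simp: inv_syllables_Cons reduced_append reduced_Cons free_top_def inv_edge, auto simp: inv_syllables_def)
qed

text \<open>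
  Twice the length of the common initial path in the Bass-Serre tree. Two different syllables from the same
  factor still share the vertex at which they diverge, which contributes half an edge.
\<close>

fun meet :: "(bool \<times> 'g) list \<Rightarrow> (bool \<times> 'g) list \<Rightarrow> nat" where
  "meet (p # u) (q # v) = (if p = q then 2 + meet u v else if fst p = fst q then 1 else 0)"
| "meet _ _ = 0"

lemma meet_ultrametric: "min (meet u v) (meet v w) \<le> meet u w"
proof (induction u v arbitrary: w rule: meet.induct)
  case (1 p u q v)
  show ?case
    using "1.IH"[of "tl w"] by (cases w) (auto simp: min_def split: if_splits)
next
  case ("2_2" u)
  then show ?case by simp
qed simp_all

lemma quotient_cancel:
  assumes "x \<in> carrier G" "y \<in> carrier G" "z \<in> carrier G"
  shows "inv (x \<otimes> y) \<otimes> (x \<otimes> z) = inv y \<otimes> z"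
proof -
  have "inv x \<otimes> (x \<otimes> z) = z" using assms by (simp add: G.m_assoc[symmetric])
  then show ?thesis using assms by (simp add: G.inv_mult_group G.m_assoc)
qed

text \<open>
  Cancel the common prefix of \<open>u\<close> and \<open>v\<close>. If the next syllables lie in the same factor they merge into one,
  which is not in the amalgamated subgroup because they represent different cosets. What remains is
  reduced, so its length is the number of syllables.
\<close>

lemma len_quotient:
  assumes "stack (rev u)" "stack (rev v)" "a \<in> carrier A" "b \<in> carrier A"
  shows "len (inv (word_prod u \<otimes> base a) \<otimes> (word_prod v \<otimes> base b)) + meet u v = length u + length v"
proof -
  have norm: "rep (fst p) (snd p) = snd p" if "p \<in> set u \<union> set v" for p
    using assms(1,2) that by (auto simp: stack_def)
  have red: "reduced u" "reduced v" using assms stack_reduced by fastforce+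
  have inv_base: "inv (word_prod u \<otimes> base a) \<otimes> (word_prod v \<otimes> base b) =
      base (inv\<^bsub>A\<^esub> a) \<otimes> (inv (word_prod u) \<otimes> word_prod v) \<otimes> base b" if "syllables u" "syllables v" for u v
    using that assms by (simp add: G.inv_mult_group base_inv G.m_assoc)
  have "len (base (inv\<^bsub>A\<^esub> a) \<otimes> (inv (word_prod u) \<otimes> word_prod v) \<otimes> base b) + meet u v = length u + length v"
    using red norm
  proof (induction u v rule: meet.induct)
    case (1 p u q v)
    obtain i x j y where pq: "p = (i, x)" "q = (j, y)" by (cases p, cases q)
    have xy: "x \<in> carrier (Gr i)" "x \<notin> edge i" "y \<in> carrier (Gr j)" "y \<notin> edge j"
      and uv: "reduced u" "reduced v" "free_top i u" "free_top j v" "rep i x = x" "rep j y = y"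
      using "1.prems"(1,2) "1.prems"(3)[of p] "1.prems"(3)[of q] by (simp_all add: pq reduced_Cons)
    have syl: "syllables u" "syllables v" using uv reduced_syllables by auto
    show ?case
    proof (cases "i = j")
      case False
      have "reduced (inv_syllables (p # u) @ q # v)"
        using reduced_inv[OF "1.prems"(1)] "1.prems"(2) False
        by (auto simp: pq reduced_append inv_syllables_Cons reduced_Cons free_top_def)
      moreover have "inv (word_prod (p # u)) \<otimes> word_prod (q # v) = word_prod (inv_syllables (p # u) @ q # v)"
        using word_prod_append[of "inv_syllables (p # u)" "q # v"] word_prod_inv[of "p # u"] syllables_inv[of "p # u"] xy syl
        by (simp add: pq del: word_prod.simps)
      ultimately show ?thesis
        using len_reduced[of "inv_syllables (p # u) @ q # v"] assms False
        by (simp add: pq inv_syllables_def)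
    next
      case [simp]: True
      show ?thesis
      proof (cases "x = y")
        case True
        then have "inv (word_prod (p # u)) \<otimes> word_prod (q # v) = inv (word_prod u) \<otimes> word_prod v"
          using quotient_cancel[of "\<iota> i x" "word_prod u" "word_prod v"] xy syl by (simp add: pq)
        moreover have "len (base (inv\<^bsub>A\<^esub> a) \<otimes> (inv (word_prod u) \<otimes> word_prod v) \<otimes> base b) + meet u v = length u + length v"
          by (rule "1.IH") (use "1.prems"(3) uv True pq in auto)
        ultimately show ?thesis using True by (simp add: pq)
      next
        case False
        let ?z = "inv\<^bsub>Gr i\<^esub> x \<otimes>\<^bsub>Gr i\<^esub> y"
        have z: "?z \<in> carrier (Gr i)" using xy by simp
        have "?z \<notin> edge i"
        proof
          assume "?z \<in> edge i"
          then obtain c where c: "c \<in> carrier A" "?z = \<phi> i c" by (auto simp: edge_def)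
          have "rep i (x \<otimes>\<^bsub>Gr i\<^esub> ?z) = rep i x" unfolding c(2) by (rule rep_mult[OF xy(1) c(1)])
          moreover have "x \<otimes>\<^bsub>Gr i\<^esub> ?z = y" using xy by (simp add: Gr.m_assoc[symmetric])
          ultimately show False using False uv by simp
        qed
        then have "reduced (inv_syllables u @ (i, ?z) # v)"
          using uv z by (auto simp: reduced_append reduced_inv reduced_Cons free_top_def last_inv_syllables)
        moreover have "inv (word_prod (p # u)) \<otimes> word_prod (q # v) = word_prod (inv_syllables u @ (i, ?z) # v)"
          using xy syl z syllables_inv[OF syl(1)]
          by (simp add: pq word_prod_append word_prod_inv G.inv_mult_group G.m_assoc)
        ultimately show ?thesis
          using len_reduced[of "inv_syllables u @ (i, ?z) # v"] assms False
          by (simp add: pq inv_syllables_def)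
      qed
    qed
  next
    case ("2_1" v)
    then show ?case using len_reduced[of v] assms by (simp add: reduced_syllables)
  next
    case ("2_2" u)
    then show ?case
      using len_reduced[OF reduced_inv[of u]] assms
      by (simp add: reduced_syllables word_prod_inv) (simp add: inv_syllables_def)
  qed
  then show ?thesis
    unfolding inv_base[OF reduced_syllables[OF red(1)] reduced_syllables[OF red(2)]] .
qed

lemma nf_decompose:
  assumes "g \<in> carrier G"
  obtains u a where "stack (rev u)" "a \<in> carrier A" "nf g = (rev u, a)" "g = word_prod u \<otimes> base a" "len g = length u"
proof -
  obtain s a where s: "nf g = (s, a)" by (cases "nf g")
  show ?thesis
  proof (rule that[of "rev s" a])
    show "g = word_prod (rev s) \<otimes> base a" using val_nf[OF assms] by (simp add: s val_def)
  qed (use nf_states[OF assms] s in \<open>auto simp: states_def len_def\<close>)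
qed

lemma nf_inj: "inj_on nf (carrier G)"
  using val_nf by (rule inj_on_inverseI)

lemma len_inv: 
  assumes "g \<in> carrier G"
  shows "len (inv g) = len g"
proof -
  obtain u a where u: "stack (rev u)" "a \<in> carrier A" "g = word_prod u \<otimes> base a" "len g = length u"
    by (rule nf_decompose[OF assms])
  then have "reduced u" using stack_reduced by fastforce
  then show ?thesis
    using len_quotient[of u "[]" a "\<one>\<^bsub>A\<^esub>"] u by (simp add: reduced_syllables)
qed

lemma finite_len_ball: "finite {g \<in> carrier G. len g \<le> n}"
proof (rule inj_on_finite)
  let ?S = "SIGMA i:UNIV. carrier (Gr i)"
  show "inj_on nf {g \<in> carrier G. len g \<le> n}" by (rule inj_on_subset[OF nf_inj]) auto
  show "nf ` {g \<in> carrier G. len g \<le> n} \<subseteq> {s. set s \<subseteq> ?S \<and> length s \<le> n} \<times> carrier A"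
    using nf_states by (fastforce simp: states_def stack_def len_def)
  show "finite ({s. set s \<subseteq> ?S \<and> length s \<le> n} \<times> carrier A)"
    by (intro finite_cartesian_product finite_lists_length_le finite_SigmaI finite_Gr finite_A) simp
qed

lemma len_hyperbolic:
  assumes "x \<in> carrier G" "y \<in> carrier G" "z \<in> carrier G"
  shows "min (int (len x) + int (len y) - int (len (inv x \<otimes> y)))
          (int (len y) + int (len z) - int (len (inv y \<otimes> z)))
        \<le> int (len x) + int (len z) - int (len (inv x \<otimes> z))"
proof -
  obtain u a where u: "stack (rev u)" "a \<in> carrier A" "x = word_prod u \<otimes> base a" "len x = length u"
    by (rule nf_decompose[OF assms(1)])
  obtain v b where v: "stack (rev v)" "b \<in> carrier A" "y = word_prod v \<otimes> base b" "len y = length v"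
    by (rule nf_decompose[OF assms(2)])
  obtain w c where w: "stack (rev w)" "c \<in> carrier A" "z = word_prod w \<otimes> base c" "len z = length w"
    by (rule nf_decompose[OF assms(3)])
  have "int (len x) + int (len y) - int (len (inv x \<otimes> y)) = int (meet u v)"
    using len_quotient[OF u(1) v(1) u(2) v(2)] unfolding u(3)[symmetric] v(3)[symmetric] u(4) v(4)
    by linarith
  moreover have "int (len y) + int (len z) - int (len (inv y \<otimes> z)) = int (meet v w)"
    using len_quotient[OF v(1) w(1) v(2) w(2)] unfolding v(3)[symmetric] w(3)[symmetric] v(4) w(4)
    by linarith
  moreover have "int (len x) + int (len z) - int (len (inv x \<otimes> z)) = int (meet u w)"
    using len_quotient[OF u(1) w(1) u(2) w(2)] unfolding u(3)[symmetric] w(3)[symmetric] u(4) w(4)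
    by linarith
  ultimately show ?thesis
    using meet_ultrametric[of u v w] by (simp only: of_nat_min[symmetric] of_nat_le_iff)
qed

lemma len_geodesic:
  assumes "x \<in> carrier G" "i \<le> len x"
  shows "\<exists>p\<in>carrier G. len p = i \<and> len (inv p \<otimes> x) = len x - i"
proof -
  obtain u a where u: "stack (rev u)" "a \<in> carrier A" "x = word_prod u \<otimes> base a" "len x = length u"
    by (rule nf_decompose[OF assms(1)])
  have "reduced (take i u @ drop i u)" using stack_reduced[OF u(1)] by simp
  then have red: "reduced (take i u)" "reduced (drop i u)" unfolding reduced_append by blast+
  then have syl: "syllables (take i u)" "syllables (drop i u)" by (simp_all add: reduced_syllables)
  then have "x = word_prod (take i u) \<otimes> (word_prod (drop i u) \<otimes> base a)"
    using word_prod_append[OF syl] u(2,3) by (simp add: G.m_assoc)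
  then have quot: "inv (word_prod (take i u)) \<otimes> x = word_prod (drop i u) \<otimes> base a"
    using quotient_cancel[of "word_prod (take i u)" \<one> "word_prod (drop i u) \<otimes> base a"] syl u(2) by simp
  have "len (word_prod (take i u)) = i"
    using len_reduced[OF red(1), of "\<one>\<^bsub>A\<^esub>" "\<one>\<^bsub>A\<^esub>"] syl u(4) assms(2) by simp
  moreover have "len (word_prod (drop i u) \<otimes> base a) = len x - i"
    using len_reduced[OF red(2), of "\<one>\<^bsub>A\<^esub>" a] syl u(2,4) by simp
  ultimately show ?thesis
    using quot syl by (intro bexI[of _ "word_prod (take i u)"]) simp_all
qed

lemma length_group_len: "length_group G len"
proof (intro length_group.intro length_group_axioms.intro)
  show "group G" by (rule G.group_axioms)
  show "len \<one> = 0" by (simp add: len_def nf_one)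
  show "len (inv x) = len x" if "x \<in> carrier G" for x
    using that by (rule len_inv)
  show "\<exists>p\<in>carrier G. len p = i \<and> len (inv p \<otimes> x) = len x - i"
    if "x \<in> carrier G" "i \<le> len x" for x i
    using that by (rule len_geodesic)
  show "finite {x \<in> carrier G. len x \<le> n}" for n
    by (rule finite_len_ball)
  show "min (int (len x) + int (len y) - int (len (inv x \<otimes> y)))
          (int (len y) + int (len z) - int (len (inv y \<otimes> z)))
        \<le> int (len x) + int (len z) - int (len (inv x \<otimes> z))"
    if "x \<in> carrier G" "y \<in> carrier G" "z \<in> carrier G" for x y z
    using that by (rule len_hyperbolic)
qed

end

section \<open>The amalgam as a presented group\<close>

text \<open>
  The two presentations are indexed by \<open>bool\<close> as well, which makes the factors instances of \<open>amalgam\<close>.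
\<close>

locale presented_amalgam =
  fixes Xs :: "bool \<Rightarrow> 'x set" and Rs :: "bool \<Rightarrow> 'x word set"
    and A :: "('a, 'm) monoid_scheme" and Y :: "'a set" and \<phi> :: "bool \<Rightarrow> 'a \<Rightarrow> 'x word set"
  assumes disjoint: "Xs True \<inter> Xs False = {}"
    and relators_words: "Rs i \<subseteq> words (Xs i)"
    and finite_factor: "finite (carrier (presented_group (Xs i) (Rs i)))"
    and group_A: "group A" and Y: "Y \<subseteq> carrier A" "generate A Y = carrier A"
    and \<phi>_mon: "\<phi> i \<in> mon A (presented_group (Xs i) (Rs i))"
begin

definition factor :: "bool \<Rightarrow> 'x word set monoid" where
  "factor i = presented_group (Xs i) (Rs i)"

sublocale amalgam factor A \<phi>
  by (rule amalgam.intro) (simp_all add: factor_def group_presented_group finite_factor group_A \<phi>_mon)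

definition X :: "'x set" where
  "X = Xs True \<union> Xs False"

definition R :: "'x word set" where
  "R = amalgam_relators (Rs True) (Rs False) Y (\<phi> True) (\<phi> False)"

definition G :: "'x word set monoid" where
  "G = presented_group X R"

abbreviation cl :: "'x word \<Rightarrow> 'x word set" where
  "cl \<equiv> word_class X R"

abbreviation fcl :: "bool \<Rightarrow> 'x word \<Rightarrow> 'x word set" where
  "fcl i \<equiv> word_class (Xs i) (Rs i)"

definition \<iota> :: "bool \<Rightarrow> 'x word set \<Rightarrow> 'x word set" where
  "\<iota> i U = cl (SOME u. u \<in> U)"

lemma Xs_subset: "Xs i \<subseteq> X"
  by (cases i) (auto simp: X_def)

lemma words_X: "w \<in> words (Xs i) \<Longrightarrow> w \<in> words X"
  using Xs_subset[of i] by (auto simp: words_def)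

lemma Rs_subset: "Rs i \<subseteq> R"
  by (cases i) (auto simp: R_def amalgam_relators_def)

lemma pres_rel_factor: "(u, v) \<in> pres_rel (Xs i) (Rs i) \<Longrightarrow> (u, v) \<in> pres_rel X R"
proof (induction rule: pres_rel.induct)
  case (relator r)
  then show ?case using Rs_subset[of i] words_X[of r i] by (auto intro: pres_rel.relator)
next
  case (cancel x b)
  then show ?case using Xs_subset[of i] by (auto intro: pres_rel.cancel)
qed (auto intro: pres_rel.intros words_X)

lemma some_class:
  assumes "u \<in> words Z"
  shows "(u, SOME v. v \<in> word_class Z S u) \<in> pres_rel Z S"
proof -
  have "u \<in> word_class Z S u" using assms by (simp add: word_class_def pres_rel.refl)
  from someI[of "\<lambda>v. v \<in> word_class Z S u", OF this] show ?thesis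
    by (simp add: word_class_def)
qed

lemma \<iota>_class:
  assumes "u \<in> words (Xs i)"
  shows "\<iota> i (fcl i u) = cl u"
proof -
  have *: "(u, SOME v. v \<in> fcl i u) \<in> pres_rel X R"
    by (rule pres_rel_factor[OF some_class[OF assms]])
  then have "cl u = cl (SOME v. v \<in> fcl i u)"
    using word_class_eq_iff pres_rel_words[OF *] by blast
  then show ?thesis by (simp add: \<iota>_def)
qed

lemma factor_elem:
  assumes "U \<in> carrier (factor i)"
  obtains u where "u \<in> words (Xs i)" "U = fcl i u"
  using assms presented_group_elem unfolding factor_def by metis

lemma factor_mult:
  "u \<in> words (Xs i) \<Longrightarrow> v \<in> words (Xs i) \<Longrightarrow> fcl i u \<otimes>\<^bsub>factor i\<^esub> fcl i v = fcl i (u @ v)"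
  unfolding factor_def by (rule word_class_mult)

lemma fcl_closed: "u \<in> words (Xs i) \<Longrightarrow> fcl i u \<in> carrier (factor i)"
  unfolding factor_def by (rule word_class_closed)

lemma fcl_Nil: "fcl i [] = \<one>\<^bsub>factor i\<^esub>"
  by (simp add: factor_def presented_group_def)

lemma cl_mult: "u \<in> words X \<Longrightarrow> v \<in> words X \<Longrightarrow> cl u \<otimes>\<^bsub>G\<^esub> cl v = cl (u @ v)"
  unfolding G_def by (rule word_class_mult)

lemma cl_closed: "u \<in> words X \<Longrightarrow> cl u \<in> carrier G"
  unfolding G_def by (rule word_class_closed)

lemma cl_Nil: "cl [] = \<one>\<^bsub>G\<^esub>"
  by (simp add: G_def presented_group_def)

lemma G_elem:
  assumes "U \<in> carrier G"
  obtains u where "u \<in> words X" "U = cl u"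
  using assms presented_group_elem unfolding G_def by metis

lemma group_G: "group G"
  unfolding G_def by (rule group_presented_group)

lemma \<iota>_hom: "\<iota> i \<in> hom (factor i) G"
proof (rule homI)
  fix U V assume "U \<in> carrier (factor i)"
  then obtain u where u: "u \<in> words (Xs i)" "U = fcl i u" by (rule factor_elem)
  show "\<iota> i U \<in> carrier G" using u by (simp add: \<iota>_class cl_closed words_X)
  assume "V \<in> carrier (factor i)"
  then obtain v where v: "v \<in> words (Xs i)" "V = fcl i v" by (rule factor_elem)
  show "\<iota> i (U \<otimes>\<^bsub>factor i\<^esub> V) = \<iota> i U \<otimes>\<^bsub>G\<^esub> \<iota> i V"
    using u v by (simp add: \<iota>_class factor_mult words_append cl_mult words_X)
qed

lemma \<iota>_group_hom: "group_hom (factor i) G (\<iota> i)"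
  by (simp add: group_hom_def group_hom_axioms_def group_Gr group_G \<iota>_hom)

text \<open>
  The relator \<open>u @ inv_word v\<close> is imposed for all words \<open>u\<close> and \<open>v\<close> representing the two images of a
  generator, in particular for those chosen here.
\<close>

lemma \<iota>_\<phi>_generator:
  assumes "a \<in> Y"
  shows "\<iota> True (\<phi> True a) = \<iota> False (\<phi> False a)"
proof -
  have a: "a \<in> carrier A" using assms Y by blast
  obtain u where u: "u \<in> words (Xs True)" "\<phi> True a = fcl True u"
    by (rule factor_elem[OF \<phi>.hom_closed[OF a]])
  obtain v where v: "v \<in> words (Xs False)" "\<phi> False a = fcl False v"
    by (rule factor_elem[OF \<phi>.hom_closed[OF a]])
  have ux: "u \<in> words X" "v \<in> words X" "inv_word v \<in> words X"
    using u v words_X inv_word_words by blast+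
  have "u \<in> \<phi> True a" "v \<in> \<phi> False a"
    using u v by (simp_all add: word_class_def pres_rel.refl)
  then have "u @ inv_word v \<in> R" using assms by (auto simp: R_def amalgam_relators_def)
  then have "(u @ inv_word v, []) \<in> pres_rel X R"
    by (rule pres_rel.relator) (use ux in \<open>simp add: words_append\<close>)
  then have "((u @ inv_word v) @ v, [] @ v) \<in> pres_rel X R"
    by (rule pres_rel.append) (use ux in \<open>simp add: pres_rel.refl\<close>)
  moreover have "(u @ (inv_word v @ v), u @ []) \<in> pres_rel X R"
    by (rule pres_rel.append) (use ux in \<open>simp_all add: pres_rel.refl inv_word_left\<close>)
  ultimately have "(u, v) \<in> pres_rel X R" by (auto intro: pres_rel.trans pres_rel.sym)
  then have "cl u = cl v" using word_class_eq_iff[OF ux(1,2)] by simp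
  then show ?thesis using u v by (simp add: \<iota>_class)
qed

lemma \<iota>_\<phi>_True_False:
  assumes "a \<in> carrier A"
  shows "\<iota> True (\<phi> True a) = \<iota> False (\<phi> False a)"
proof -
  interpret i: group_hom "factor i" G "\<iota> i" for i by (rule \<iota>_group_hom)
  have Yc: "a \<in> carrier A" if "a \<in> Y" for a using that Y by blast
  have "a \<in> generate A Y" using assms Y(2) by simp
  then have "a \<in> carrier A \<and> ?thesis"
    by (induction rule: generate.induct) (auto simp: Yc \<iota>_\<phi>_generator)
  then show ?thesis by blast
qed

sublocale amalgam_target factor A \<phi> G \<iota>
proof (intro amalgam_target.intro amalgam_target_axioms.intro)
  show "\<iota> i (\<phi> i a) = \<iota> j (\<phi> j a)" if "a \<in> carrier A" for i j a
    using \<iota>_\<phi>_True_False[OF that] by (cases i; cases j) simp_all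
qed (rule amalgam_axioms group_G \<iota>_hom)+

definition side :: "'x \<times> bool \<Rightarrow> bool" where
  "side l \<longleftrightarrow> fst l \<in> Xs True"

definition step :: "(bool \<times> 'x word set) list \<times> 'a \<Rightarrow> 'x \<times> bool \<Rightarrow> (bool \<times> 'x word set) list \<times> 'a" where
  "step \<omega> l = act (side l) (fcl (side l) [l]) \<omega>"

abbreviation run :: "(bool \<times> 'x word set) list \<times> 'a \<Rightarrow> 'x word \<Rightarrow> (bool \<times> 'x word set) list \<times> 'a" where
  "run \<equiv> foldl step"

lemma words_simps [simp]: "[] \<in> words Z" "l # w \<in> words Z \<longleftrightarrow> fst l \<in> Z \<and> w \<in> words Z"
  "u @ v \<in> words Z \<longleftrightarrow> u \<in> words Z \<and> v \<in> words Z"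
  by (auto simp: words_def mem_Times_iff)

lemma side_letter: "fst l \<in> Xs i \<Longrightarrow> side l = i"
  using disjoint by (cases i) (auto simp: side_def)

lemma letter_side: "fst l \<in> X \<Longrightarrow> [l] \<in> words (Xs (side l))"
  by (cases "fst l \<in> Xs True") (auto simp: X_def side_def)

lemma step_closed: "\<omega> \<in> states \<Longrightarrow> fst l \<in> X \<Longrightarrow> step \<omega> l \<in> states"
  unfolding step_def by (intro act_closed fcl_closed letter_side)

lemma run_closed: "\<omega> \<in> states \<Longrightarrow> w \<in> words X \<Longrightarrow> run \<omega> w \<in> states"
  by (induction w arbitrary: \<omega>) (auto simp: step_closed)

lemma run_factor:
  assumes "u \<in> words (Xs i)" "\<omega> \<in> states"
  shows "run \<omega> u = act i (fcl i u) \<omega>"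
  using assms
proof (induction u arbitrary: \<omega>)
  case Nil
  then show ?case by (simp add: fcl_Nil act_one)
next
  case (Cons l u)
  then have l: "[l] \<in> words (Xs i)" "fst l \<in> X" "side l = i" "u \<in> words (Xs i)"
    using Xs_subset[of i] side_letter by auto
  have "run \<omega> (l # u) = act i (fcl i u) (step \<omega> l)"
    using Cons l step_closed by simp
  also have "\<dots> = act i (fcl i [l] \<otimes>\<^bsub>factor i\<^esub> fcl i u) \<omega>"
    using Cons.prems l by (simp add: step_def act_act fcl_closed)
  also have "fcl i [l] \<otimes>\<^bsub>factor i\<^esub> fcl i u = fcl i (l # u)"
    using factor_mult[OF l(1,4)] by simp
  finally show ?case .
qed

lemma run_inv_word:
  assumes "w \<in> words (Xs i)" "\<omega> \<in> states"
  shows "run (run \<omega> w) (inv_word w) = \<omega>"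
proof -
  let ?G = "factor i"
  have iw: "inv_word w \<in> words (Xs i)" using assms(1) by (rule inv_word_words)
  have "fcl i (inv_word w @ w) = fcl i []"
    using inv_word_left[OF assms(1)] word_class_eq_iff[of "inv_word w @ w" "Xs i" "[]"] assms(1) iw by simp
  then have "fcl i (inv_word w) \<otimes>\<^bsub>?G\<^esub> fcl i w = \<one>\<^bsub>?G\<^esub>"
    using factor_mult[OF iw assms(1)] fcl_Nil by simp
  then have "fcl i w \<otimes>\<^bsub>?G\<^esub> fcl i (inv_word w) = \<one>\<^bsub>?G\<^esub>"
    using Gr.inv_comm fcl_closed iw assms(1) by blast
  moreover have "run (run \<omega> w) (inv_word w) = act i (fcl i (w @ inv_word w)) \<omega>"
    using run_factor[of "w @ inv_word w" i \<omega>] assms iw by simp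
  ultimately show ?thesis
    using factor_mult[OF assms(1) iw] assms(2) by (simp add: act_one)
qed

text \<open>
  Relators of a factor represent \<open>1\<close> there, and the words \<open>u\<close> and \<open>v\<close> in an amalgamation relator both act
  as the same element of \<open>A\<close>.
\<close>

lemma run_relator:
  assumes "r \<in> R" "\<omega> \<in> states"
  shows "run \<omega> r = \<omega>"
proof -
  consider (factor) i where "r \<in> Rs i"
    | (amalgam) a u v where "a \<in> Y" "u \<in> \<phi> True a" "v \<in> \<phi> False a" "r = u @ inv_word v"
    using assms(1) by (auto simp: R_def amalgam_relators_def)
  then show ?thesis
  proof cases
    case factor
    then have r: "r \<in> words (Xs i)" using relators_words by blast
    then have "(r, []) \<in> pres_rel (Xs i) (Rs i)" using factor by (auto intro: pres_rel.relator)
    then have "fcl i r = \<one>\<^bsub>factor i\<^esub>"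
      using word_class_eq_iff[OF r, of "[]" "Rs i"] by (simp add: fcl_Nil)
    then show ?thesis using run_factor[OF r assms(2)] assms(2) by (simp add: act_one)
  next
    case amalgam
    have a: "a \<in> carrier A" using amalgam Y by blast
    have uv: "w \<in> words (Xs i) \<and> \<phi> i a = fcl i w" if "w \<in> \<phi> i a" for i w
    proof -
      obtain w' where w': "w' \<in> words (Xs i)" "\<phi> i a = fcl i w'"
        using factor_elem \<phi>.hom_closed[OF a] by metis
      then have "(w', w) \<in> pres_rel (Xs i) (Rs i)" using that by (simp add: word_class_def)
      then show ?thesis using w' pres_rel_words word_class_eq_iff by metis
    qed
    obtain s c where \<omega>: "\<omega> = (s, c)" by (cases \<omega>)
    have sc: "stack s" "c \<in> carrier A" using assms(2) \<omega> by (auto simp: states_def)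
    note u = uv[OF amalgam(2)] and v = uv[OF amalgam(3)]
    have "run \<omega> u = run \<omega> v"
      using run_factor[of u True \<omega>] run_factor[of v False \<omega>] u v assms(2) a act_\<phi>[of s c a] \<omega> by metis
    then show ?thesis using amalgam(4) run_inv_word[of v False \<omega>] v assms(2) by simp
  qed
qed

text \<open>
  The action of words on normal forms factors through the presented group. This is the step that makes
  the normal form of a group element well defined.
\<close>

lemma run_pres_rel:
  "(u, v) \<in> pres_rel X R \<Longrightarrow> \<omega> \<in> states \<Longrightarrow> run \<omega> u = run \<omega> v"
proof (induction arbitrary: \<omega> rule: pres_rel.induct)
  case (append u u' v v')
  then have "run \<omega> u \<in> states" using run_closed pres_rel_words by blast
  then show ?case using append by simp
next
  case (cancel x b)
  then obtain i where i: "x \<in> Xs i" by (auto simp: X_def)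
  have "inv_word [(x, b)] = [(x, \<not> b)]" by (simp add: inv_word_def)
  then show ?case using run_inv_word[of "[(x, b)]" i \<omega>] i cancel by simp
next
  case (relator r)
  then show ?case by (simp add: run_relator)
qed auto

definition nf :: "'x word set \<Rightarrow> (bool \<times> 'x word set) list \<times> 'a" where
  "nf U = run ([], \<one>\<^bsub>A\<^esub>) (SOME w. w \<in> U)"

lemma start_state: "([], \<one>\<^bsub>A\<^esub>) \<in> states"
  by (simp add: states_def)

lemma nf_class:
  assumes "w \<in> words X"
  shows "nf (cl w) = run ([], \<one>\<^bsub>A\<^esub>) w"
  unfolding nf_def using run_pres_rel[OF some_class[OF assms] start_state] by simp

lemma val_run:
  assumes "w \<in> words X" "\<omega> \<in> states"
  shows "val (run \<omega> w) = val \<omega> \<otimes>\<^bsub>G\<^esub> cl w"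
  using assms
proof (induction w arbitrary: \<omega>)
  case Nil
  then show ?case by (simp add: cl_Nil val_closed)
next
  case (Cons l w)
  then have l: "fst l \<in> X" "[l] \<in> words X" "w \<in> words X" by auto
  have "val (run \<omega> (l # w)) = val (step \<omega> l) \<otimes>\<^bsub>G\<^esub> cl w"
    using Cons l step_closed by simp
  also have "val (step \<omega> l) = val \<omega> \<otimes>\<^bsub>G\<^esub> cl [l]"
    unfolding step_def using Cons.prems(2) l letter_side[OF l(1)]
    by (simp add: val_act fcl_closed \<iota>_class del: words_simps)
  also have "val \<omega> \<otimes>\<^bsub>G\<^esub> cl [l] \<otimes>\<^bsub>G\<^esub> cl w = val \<omega> \<otimes>\<^bsub>G\<^esub> cl (l # w)"
    using cl_mult[OF l(2,3)] val_closed[OF Cons.prems(2)] cl_closed[OF l(2)] cl_closed[OF l(3)]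
    by (simp add: G.m_assoc)
  finally show ?case .
qed

lemma amalgamated_product: "amalgamated_product factor A \<phi> G \<iota> nf"
proof (intro amalgamated_product.intro amalgamated_product_axioms.intro)
  show "amalgam_target factor A \<phi> G \<iota>" by (rule amalgam_target_axioms)
  fix g assume "g \<in> carrier G"
  then obtain w where w: "w \<in> words X" "g = cl w" by (rule G_elem)
  show "nf g \<in> states" using w by (simp add: nf_class run_closed start_state)
  show "val (nf g) = g"
    using w val_run[OF w(1) start_state] cl_closed[OF w(1)] by (simp add: nf_class val_def)
  fix x i assume "x \<in> carrier (factor i)"
  then obtain u where u: "u \<in> words (Xs i)" "x = fcl i u" by (rule factor_elem)
  then show "nf (g \<otimes>\<^bsub>G\<^esub> \<iota> i x) = act i x (nf g)"
    using w words_X[OF u(1)] run_factor[OF u(1) run_closed[OF start_state w(1)]]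
    by (simp add: \<iota>_class cl_mult nf_class)
next
  show "nf \<one>\<^bsub>G\<^esub> = ([], \<one>\<^bsub>A\<^esub>)" using nf_class[of "[]"] by (simp add: cl_Nil)
qed

end

section \<open>Numbering the normal forms\<close>

lemma digit_less_iff:
  fixes b d n m :: nat
  assumes "d < b"
  shows "d + b * n < b * m \<longleftrightarrow> n < m"
proof
  show "n < m" if "d + b * n < b * m"
  proof (rule ccontr)
    assume "\<not> n < m"
    then have "b * m \<le> b * n" by (intro mult_le_mono2) simp
    then show False using that by linarith
  qed
  assume "n < m"
  then have "b * Suc n \<le> b * m" by (intro mult_le_mono2) simp
  then show "d + b * n < b * m" using assms by simp
qed

lemma digit_eq_iff:
  fixes b d d' n n' :: nat
  assumes "d < b" "d' < b"
  shows "d + b * n = d' + b * n' \<longleftrightarrow> d = d' \<and> n = n'"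
proof
  assume e: "d + b * n = d' + b * n'"
  have "(d + b * n) mod b = d" "(d' + b * n') mod b = d'" "(d + b * n) div b = n" "(d' + b * n') div b = n'"
    using assms by auto
  then show "d = d' \<and> n = n'" using e by metis
qed simp

text \<open>
  The value of a digit sequence in base \<open>b\<close>, least significant digit first. If all digits
  are nonzero, the length can be recovered by comparing with powers of \<open>b\<close>.
\<close>

fun horner :: "nat \<Rightarrow> ('p \<Rightarrow> nat) \<Rightarrow> 'p list \<Rightarrow> nat" where
  "horner b f [] = 0"
| "horner b f (p # s) = f p + b * horner b f s"

lemma horner_append: "horner b f (s @ t) = horner b f s + b ^ length s * horner b f t"
  by (induction s) (auto simp: algebra_simps)

lemma horner_less_iff:
  assumes "b > 0" "\<And>p. p \<in> set s \<Longrightarrow> 0 < f p \<and> f p < b"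
  shows "horner b f s < b ^ n \<longleftrightarrow> length s \<le> n"
  using assms(2)
proof (induction s arbitrary: n)
  case Nil
  then show ?case using assms(1) by simp
next
  case (Cons p s)
  then show ?case
  proof (cases n)
    case 0
    then show ?thesis using Cons.prems[of p] by simp
  next
    case (Suc m)
    then show ?thesis using Cons.prems[of p] Cons.IH[of m] Cons.prems digit_less_iff[of "f p" b] by simp
  qed
qed

lemma horner_inj:
  assumes f: "inj_on f S" "\<And>p. p \<in> S \<Longrightarrow> 0 < f p \<and> f p < b"
  shows "set s \<subseteq> S \<Longrightarrow> set t \<subseteq> S \<Longrightarrow> horner b f s = horner b f t \<Longrightarrow> s = t"
proof (induction s arbitrary: t)
  case Nil
  then show ?case using f(2)[of "hd t"] by (cases t) auto
next
  case (Cons p s)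
  then obtain q u where t: "t = q # u" using f(2)[of p] by (cases t) auto
  have "f p = f q \<and> horner b f s = horner b f u"
    using Cons.prems f(2)[of p] f(2)[of q] digit_eq_iff[of "f p" b "f q"] by (simp add: t)
  then show ?case using Cons f(1) t by (auto dest: inj_onD)
qed

context amalgam
begin

text \<open>
  The digits of a normal form are the number of its part in \<open>A\<close>, followed by the numbers of the
  stack entries from the top. So \<open>code \<omega> mod b\<^sup>2\<close> determines the part in \<open>A\<close> and the top entry, on which the action
  depends. The action replaces these two digits by one, two or three others, so it
  multiplies the remaining number by a power of \<open>b\<close> and adds a new final part. The identity of
  \<open>A\<close> has digit \<open>0\<close>, all stack entries have nonzero digits; hence \<open>1\<close> is coded by \<open>0\<close> and the length is visible
  in the size of the code.
\<close>

lemma state_coding: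
  obtains b code where "b > (1::nat)" "inj_on code states" "code ([], \<one>\<^bsub>A\<^esub>) = 0"
    "\<And>s a n. (s, a) \<in> states \<Longrightarrow> code (s, a) < b ^ Suc n \<longleftrightarrow> length s \<le> n"
    "\<And>i x. \<exists>m v. \<forall>\<omega>\<in>states. code (act i x \<omega>) =
       code \<omega> div b\<^sup>2 * m (code \<omega> mod b\<^sup>2) + v (code \<omega> mod b\<^sup>2)"
proof -
  let ?S = "SIGMA i:UNIV. carrier (Gr i)"
  have "finite ?S" by (intro finite_SigmaI finite_Gr) simp
  then obtain f n where f: "f ` ?S = {i. i < (n::nat)}" "inj_on f ?S"
    using finite_imp_inj_to_nat_seg by blast
  obtain h k where h: "h ` carrier A = {i. i < (k::nat)}" "inj_on h (carrier A)"
    using finite_imp_inj_to_nat_seg[OF finite_A] by blast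
  \<comment> \<open>Stack entries get nonzero digits, and \<open>0\<close> is reserved for the identity of \<open>A\<close>.\<close>
  define sym where "sym p = Suc (f p)" for p
  define dig where "dig a = (if a = \<one>\<^bsub>A\<^esub> then 0 else Suc (h a))" for a
  define b where "b = n + k + 2"
  have b: "b > 1" by (simp add: b_def)
  have sym: "0 < sym p \<and> sym p < b" if "p \<in> ?S" for p
  proof -
    have "f p < n" using f(1) that by blast
    then show ?thesis by (simp add: sym_def b_def)
  qed
  have dig: "dig a < b" if "a \<in> carrier A" for a
  proof -
    have "h a < k" using h(1) that by blast
    then show ?thesis by (simp add: dig_def b_def)
  qed
  have sym_inj: "inj_on sym ?S" using f(2) by (auto simp: sym_def inj_on_def)
  have dig_inj: "a = a'" if "a \<in> carrier A" "a' \<in> carrier A" "dig a = dig a'" for a a'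
    using h(2) that by (auto simp: dig_def inj_on_def split: if_splits)
  define code where "code = (\<lambda>(s, a). dig a + b * horner b sym s)"
  have stackS: "set s \<subseteq> ?S" if "stack s" for s using that by (auto simp: stack_def)
  have inj: "inj_on code states"
  proof (rule inj_onI)
    fix \<omega> \<omega>' assume w: "\<omega> \<in> states" "\<omega>' \<in> states" "code \<omega> = code \<omega>'"
    obtain s a s' a' where e: "\<omega> = (s, a)" "\<omega>' = (s', a')" by (cases \<omega>, cases \<omega>')
    have st: "stack s" "a \<in> carrier A" "stack s'" "a' \<in> carrier A" using w e by (auto simp: states_def)
    have "dig a = dig a' \<and> horner b sym s = horner b sym s'"
      using w(3) digit_eq_iff[OF dig[OF st(2)] dig[OF st(4)]] by (simp add: e code_def)
    then show "\<omega> = \<omega>'"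
      using dig_inj st horner_inj[OF sym_inj sym stackS stackS] e by blast
  qed
  have bound: "code (s, a) < b ^ Suc n \<longleftrightarrow> length s \<le> n" if "(s, a) \<in> states" for s a n
  proof -
    have st: "stack s" "a \<in> carrier A" using that by (auto simp: states_def)
    have "horner b sym s < b ^ n \<longleftrightarrow> length s \<le> n"
      using b sym stackS[OF st(1)] by (intro horner_less_iff) auto
    then show ?thesis using digit_less_iff[OF dig[OF st(2)]] by (simp add: code_def)
  qed
  have local_action: "\<exists>m v. \<forall>\<omega>\<in>states. code (act i x \<omega>) =
       code \<omega> div b\<^sup>2 * m (code \<omega> mod b\<^sup>2) + v (code \<omega> mod b\<^sup>2)" for i x
  proof -
    define \<delta> where "\<delta> j = act i x (inv_into states code j)" for j
    have loc: "code (act i x \<omega>) =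
       code \<omega> div b\<^sup>2 * b ^ Suc (length (fst (\<delta> (code \<omega> mod b\<^sup>2)))) + code (\<delta> (code \<omega> mod b\<^sup>2))"
      if \<omega>: "\<omega> \<in> states" for \<omega>
    proof -
      obtain s a where e: "\<omega> = (s, a)" by (cases \<omega>)
      let ?t = "take 1 s" and ?d = "drop 1 s"
      have st: "stack s" "a \<in> carrier A" using \<omega> e by (auto simp: states_def)
      then have t: "(?t, a) \<in> states" by (cases s) (auto simp: states_def stack_Cons free_top_def)
      have "code (?t, a) < b\<^sup>2" using bound[OF t, of 1] by (simp add: power2_eq_square)
      moreover have "code \<omega> = code (?t, a) + b\<^sup>2 * horner b sym ?d"
        by (cases s) (auto simp: e code_def power2_eq_square algebra_simps)
      ultimately have dm: "code \<omega> div b\<^sup>2 = horner b sym ?d" "code \<omega> mod b\<^sup>2 = code (?t, a)"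
        using b by simp_all
      have \<delta>: "\<delta> (code (?t, a)) = act i x (?t, a)" unfolding \<delta>_def inv_into_f_f[OF inj t] ..
      obtain u c where u: "act i x (?t, a) = (u, c)" by (cases "act i x (?t, a)")
      have "act i x \<omega> = (u @ ?d, c)" unfolding e act_local[of i x s] u by simp
      then show ?thesis unfolding dm \<delta> u by (simp add: code_def horner_append algebra_simps)
    qed
    show ?thesis
      by (intro exI[of _ "\<lambda>j. b ^ Suc (length (fst (\<delta> j)))"] exI[of _ "\<lambda>j. code (\<delta> j)"] ballI)
        (rule loc)
  qed
  show ?thesis
  proof (rule that[of b code])
    show "code ([], \<one>\<^bsub>A\<^esub>) = 0" by (simp add: code_def dig_def)
    show "\<exists>m v. \<forall>\<omega>\<in>states. code (act i x \<omega>) =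
       code \<omega> div b\<^sup>2 * m (code \<omega> mod b\<^sup>2) + v (code \<omega> mod b\<^sup>2)" for i x
      by (rule local_action)
  qed (rule b, rule inj, rule bound)
qed

end

section \<open>Searching for a certificate\<close>

text \<open>
  The interface between group theory and computability: elements are given by words over a finite set of
  numbers, \<open>ev\<close> evaluates a word, and \<open>K\<close> numbers the elements injectively, so that equality is
  decided by running a word through \<open>step\<close>. Comparison of \<open>K g\<close> with powers of \<open>b\<close> decides membership in a
  ball.
\<close>

locale coded_length_group = length_group G len
  for G :: "('g, 'm) monoid_scheme" (structure) and len :: "'g \<Rightarrow> nat" +
  fixes Letters :: "nat set" and ev :: "nat list \<Rightarrow> 'g"
    and K :: "'g \<Rightarrow> nat" and b :: nat and step :: "nat \<Rightarrow> nat \<Rightarrow> nat"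
  assumes finite_Letters: "finite Letters"
    and ev_closed: "w \<in> lists Letters \<Longrightarrow> ev w \<in> carrier G"
    and ev_Nil: "ev [] = \<one>"
    and ev_append: "u \<in> lists Letters \<Longrightarrow> v \<in> lists Letters \<Longrightarrow> ev (u @ v) = ev u \<otimes> ev v"
    and ev_surj: "g \<in> carrier G \<Longrightarrow> \<exists>w\<in>lists Letters. ev w = g"
    and len_letter: "l \<in> Letters \<Longrightarrow> len (ev [l]) \<le> 1"
    and K_inj: "inj_on K (carrier G)"
    and K_one: "K \<one> = 0"
    and K_less: "g \<in> carrier G \<Longrightarrow> K g < b ^ Suc n \<longleftrightarrow> len g \<le> n"
    and K_step: "g \<in> carrier G \<Longrightarrow> l \<in> Letters \<Longrightarrow> K (g \<otimes> ev [l]) = step (K g) l"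
    and step_rfun: "rfun2 step"
begin

definition encode_lists :: "nat list list \<Rightarrow> nat" where
  "encode_lists ws = list_encode (map list_encode ws)"

definition run :: "nat \<Rightarrow> nat \<Rightarrow> nat" where
  "run n w = foldl step n (list_decode w)"

text \<open>
  \<open>T\<close> codes a list of words that represents the subgroup generated by \<open>x\<close> up to length \<open>M\<close>. The first
  conjunct makes every entry a word in the letters that is trivial, a generator, the inverse of a later entry or the product
  of later entries, so \<open>T\<close> stays inside the subgroup. The other conjuncts are the closure properties
  required by \<open>ball_closure\<close>, so \<open>T\<close> contains all elements of length at most \<open>M\<close>. All
  quantifiers in the formula are bounded, which keeps it recursive.
\<close>

definition lists_subgroup_ball :: "nat \<Rightarrow> nat \<Rightarrow> nat \<Rightarrow> bool" where
  "lists_subgroup_ball x M T \<longleftrightarrow>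
     (\<forall>j<T. drop_code j T \<noteq> 0 \<longrightarrow>
        (\<forall>l\<in>set (list_decode (hd_code (drop_code j T))). l \<in> Letters) \<and>
        (run 0 (hd_code (drop_code j T)) = 0 \<or>
         (\<exists>h\<in>set (list_decode x). h = hd_code (drop_code j T)) \<or>
         (\<exists>u\<in>set (list_decode (drop_code (Suc j) T)). run (run 0 (hd_code (drop_code j T))) u = 0) \<or>
         (\<exists>u\<in>set (list_decode (drop_code (Suc j) T)). \<exists>v\<in>set (list_decode (drop_code (Suc j) T)).
            run 0 (hd_code (drop_code j T)) = run (run 0 u) v))) \<and>
     (\<exists>t\<in>set (list_decode T). run 0 t = 0) \<and>
     (\<forall>h\<in>set (list_decode x). \<exists>t\<in>set (list_decode T). run 0 t = run 0 h) \<and>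
     (\<forall>u\<in>set (list_decode T). run 0 u < b ^ Suc M \<longrightarrow>
        (\<exists>t\<in>set (list_decode T). run (run 0 u) t = 0)) \<and>
     (\<forall>u\<in>set (list_decode T). \<forall>v\<in>set (list_decode T).
        run 0 u < b ^ Suc M \<longrightarrow> run 0 v < b ^ Suc M \<longrightarrow> run (run 0 u) v < b ^ Suc M \<longrightarrow>
        (\<exists>t\<in>set (list_decode T). run 0 t = run (run 0 u) v))"

text \<open>
  The equation \<open>k g = g k'\<close> replaces \<open>inv g k g = k'\<close>, so that no word for an inverse has to be computed.
\<close>

definition coded_witness :: "nat \<Rightarrow> nat \<Rightarrow> nat \<Rightarrow> bool" where
  "coded_witness T M g \<longleftrightarrow> run 0 g < b ^ Suc M \<and> (\<forall>t\<in>set (list_decode T). run 0 t \<noteq> run 0 g) \<and>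
     (\<exists>k\<in>set (list_decode T). \<exists>k'\<in>set (list_decode T).
        run 0 k \<noteq> 0 \<and> run (run 0 k) g = run (run 0 g) k')"

lemma rfun_run [intro]: "rfun k f \<Longrightarrow> rfun k g \<Longrightarrow> rfun k (\<lambda>v. run (f v) (g v))"
  unfolding run_def by (intro rfun_foldl step_rfun)

lemmas rfun_rules = rfun_nth rfun_tl_nth rfun_tl2_nth rfun_tl3_nth rfun_Suc rfun_const rfun_add
  rfun_mult rfun_power rfun_run rfun_hd_code rfun_drop_code rfun_fst rfun_snd rfun_prod_encode
  rdec_not rdec_conj rdec_disj rdec_imp rdec_le rdec_less rdec_eq rdec_ex rdec_all rdec_bex rdec_ball
  rdec_finite[OF finite_Letters]

lemma rdec_lists_subgroup_ball: "rfun3 (\<lambda>x M T. of_bool (lists_subgroup_ball x M T))"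
  unfolding lists_subgroup_ball_def by (intro rfun_rules; simp)

lemma rdec_coded_witness: "rfun3 (\<lambda>T M g. of_bool (coded_witness T M g))"
  unfolding coded_witness_def by (intro rfun_rules; simp)

lemma foldl_step:
  assumes "w \<in> lists Letters" "g \<in> carrier G"
  shows "foldl step (K g) w = K (g \<otimes> ev w)"
  using assms
proof (induction w arbitrary: g)
  case Nil
  then show ?case by (simp add: ev_Nil)
next
  case (Cons l w)
  then have l: "l \<in> Letters" "[l] \<in> lists Letters" "w \<in> lists Letters" by auto
  have "foldl step (K g) (l # w) = K (g \<otimes> ev [l] \<otimes> ev w)"
    using Cons l ev_closed by (simp add: K_step[symmetric])
  then show ?case
    using ev_append[OF l(2,3)] ev_closed[OF l(2)] ev_closed[OF l(3)] Cons.prems by (simp add: m_assoc)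
qed

lemma run_word:
  assumes "u \<in> lists Letters"
  shows "run 0 (list_encode u) = K (ev u)"
  using foldl_step[OF assms one_closed] assms by (simp add: run_def K_one ev_closed)

lemma run_word2:
  assumes "u \<in> lists Letters" "v \<in> lists Letters"
  shows "run (K (ev u)) (list_encode v) = K (ev u \<otimes> ev v)"
  using foldl_step[OF assms(2) ev_closed[OF assms(1)]] by (simp add: run_def)

lemma K_eq: "g \<in> carrier G \<Longrightarrow> h \<in> carrier G \<Longrightarrow> K g = K h \<longleftrightarrow> g = h"
  using K_inj by (rule inj_on_eq_iff)

lemma K_eq_0: "g \<in> carrier G \<Longrightarrow> K g = 0 \<longleftrightarrow> g = \<one>"
  using K_eq[of g \<one>] by (simp add: K_one)

lemma K_ball: "g \<in> carrier G \<Longrightarrow> K g < b ^ Suc n \<longleftrightarrow> g \<in> ball n"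
  by (simp only: K_less) (simp add: ball_def)

lemma card_ball: "card (ball n) \<le> b ^ Suc n"
proof -
  have "card (ball n) \<le> card {..<b ^ Suc n}"
    by (rule card_inj_on_le[of K])
       (use K_ball in \<open>auto simp: ball_def simp del: power_Suc intro: inj_on_subset[OF K_inj]\<close>)
  then show ?thesis by simp
qed

text \<open>
  Meaning of the conjuncts of \<open>lists_subgroup_ball\<close> in terms of words and group elements.
\<close>

definition justified :: "nat list list \<Rightarrow> nat list list \<Rightarrow> nat list \<Rightarrow> bool" where
  "justified hs s t \<longleftrightarrow> ev t = \<one> \<or> t \<in> set hs \<or> (\<exists>u\<in>set s. ev t \<otimes> ev u = \<one>) \<or>
     (\<exists>u\<in>set s. \<exists>v\<in>set s. ev t = ev u \<otimes> ev v)"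

definition straight :: "nat list list \<Rightarrow> nat list list \<Rightarrow> bool" where
  "straight hs ts \<longleftrightarrow> (\<forall>j<length ts. justified hs (drop (Suc j) ts) (ts ! j))"

definition closed_in_ball :: "nat list list \<Rightarrow> nat \<Rightarrow> nat list list \<Rightarrow> bool" where
  "closed_in_ball hs M ts \<longleftrightarrow>
     (\<exists>t\<in>set ts. ev t = \<one>) \<and> (\<forall>h\<in>set hs. \<exists>t\<in>set ts. ev t = ev h) \<and>
     (\<forall>u\<in>set ts. ev u \<in> ball M \<longrightarrow> (\<exists>t\<in>set ts. ev u \<otimes> ev t = \<one>)) \<and>
     (\<forall>u\<in>set ts. \<forall>v\<in>set ts. ev u \<in> ball M \<longrightarrow> ev v \<in> ball M \<longrightarrow> ev u \<otimes> ev v \<in> ball M \<longrightarrow>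
        (\<exists>t\<in>set ts. ev t = ev u \<otimes> ev v))"

lemma decode_encode_lists [simp]: "list_decode (encode_lists ts) = map list_encode ts"
  by (simp add: encode_lists_def)

lemma drop_encode_lists:
  "drop_code j (encode_lists ts) \<noteq> 0 \<longleftrightarrow> j < length ts"
  "j < length ts \<Longrightarrow> hd_code (drop_code j (encode_lists ts)) = list_encode (ts ! j)"
  "list_decode (drop_code j (encode_lists ts)) = map list_encode (drop j ts)"
proof -
  show "drop_code j (encode_lists ts) \<noteq> 0 \<longleftrightarrow> j < length ts"
    by (simp only: drop_code_eq_0 decode_encode_lists length_map not_le)
  show "hd_code (drop_code j (encode_lists ts)) = list_encode (ts ! j)" if "j < length ts"
    using that by (simp add: hd_drop_code)
  show "list_decode (drop_code j (encode_lists ts)) = map list_encode (drop j ts)"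
    by (simp add: drop_code_def drop_map)
qed

lemma length_le_encode_lists: "length ts \<le> encode_lists ts"
  using length_le_list_encode[of "map list_encode ts"] by (simp add: encode_lists_def)

lemma lists_subgroup_ball_iff:
  assumes hs: "set hs \<subseteq> lists Letters"
  shows "lists_subgroup_ball (encode_lists hs) M (encode_lists ts) \<longleftrightarrow>
    set ts \<subseteq> lists Letters \<and> straight hs ts \<and> closed_in_ball hs M ts"
proof -
  have bounded: "(\<forall>j<encode_lists ts. drop_code j (encode_lists ts) \<noteq> 0 \<longrightarrow> P j) \<longleftrightarrow> (\<forall>j<length ts. P j)" for P
    unfolding drop_encode_lists(1) using length_le_encode_lists[of ts] by (meson less_le_trans)
  have image: "list_encode t \<in> list_encode ` S \<longleftrightarrow> t \<in> S" for t S
    by (auto simp: list_encode_eq)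
  have letters: "(\<forall>j<length ts. \<forall>l\<in>set (ts ! j). l \<in> Letters) \<longleftrightarrow> set ts \<subseteq> lists Letters"
    by (auto simp: set_conv_nth subset_iff in_lists_conv_set) 
  let ?J = "\<lambda>j. run 0 (list_encode (ts ! j)) = 0 \<or> ts ! j \<in> set hs \<or>
     (\<exists>u\<in>set (drop (Suc j) ts). run (run 0 (list_encode (ts ! j))) (list_encode u) = 0) \<or>
     (\<exists>u\<in>set (drop (Suc j) ts). \<exists>v\<in>set (drop (Suc j) ts).
        run 0 (list_encode (ts ! j)) = run (run 0 (list_encode u)) (list_encode v))"
  let ?C = "(\<exists>t\<in>set ts. run 0 (list_encode t) = 0) \<and>
     (\<forall>h\<in>set hs. \<exists>t\<in>set ts. run 0 (list_encode t) = run 0 (list_encode h)) \<and>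
     (\<forall>u\<in>set ts. run 0 (list_encode u) < b ^ Suc M \<longrightarrow>
        (\<exists>t\<in>set ts. run (run 0 (list_encode u)) (list_encode t) = 0)) \<and>
     (\<forall>u\<in>set ts. \<forall>v\<in>set ts.
        run 0 (list_encode u) < b ^ Suc M \<longrightarrow> run 0 (list_encode v) < b ^ Suc M \<longrightarrow>
        run (run 0 (list_encode u)) (list_encode v) < b ^ Suc M \<longrightarrow>
        (\<exists>t\<in>set ts. run 0 (list_encode t) = run (run 0 (list_encode u)) (list_encode v)))"
  have "lists_subgroup_ball (encode_lists hs) M (encode_lists ts) \<longleftrightarrow>
     ((\<forall>j<length ts. \<forall>l\<in>set (ts ! j). l \<in> Letters) \<and> (\<forall>j<length ts. ?J j)) \<and> ?C"
    unfolding lists_subgroup_ball_def bounded all_conj_distrib imp_conjR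
    by (simp add: drop_encode_lists image del: power_Suc neq0_conv cong: conj_cong)
  also have "\<dots> \<longleftrightarrow> set ts \<subseteq> lists Letters \<and> ((\<forall>j<length ts. ?J j) \<and> ?C)"
    unfolding letters by blast
  also have "\<dots> \<longleftrightarrow> set ts \<subseteq> lists Letters \<and> (straight hs ts \<and> closed_in_ball hs M ts)"
  proof (rule conj_cong[OF HOL.refl])
    assume ts: "set ts \<subseteq> lists Letters"
    note tw = subsetD[OF ts] and hw = subsetD[OF hs]
    have r1: "run 0 (list_encode t) = K (ev t)" "ev t \<in> carrier G" if "t \<in> set ts \<union> set hs" for t
      using that tw hw run_word ev_closed by blast+
    have r2: "run (K (ev u)) (list_encode v) = K (ev u \<otimes> ev v)" if "u \<in> set ts" "v \<in> set ts" for u v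
      using that tw run_word2 by blast
    have "?J j \<longleftrightarrow> justified hs (drop (Suc j) ts) (ts ! j)" if "j < length ts" for j
    proof -
      have d: "u \<in> set ts" if "u \<in> set (drop (Suc j) ts)" for u using that by (rule in_set_dropD)
      have n: "ts ! j \<in> set ts" using that by simp
      show ?thesis
        unfolding justified_def using r1 r2 d n
        by (auto simp: K_eq_0 K_eq list_encode_eq cong: bex_cong)
    qed
    moreover have "?C \<longleftrightarrow> closed_in_ball hs M ts"
      unfolding closed_in_ball_def using r1 r2
      by (simp add: K_eq_0 K_eq K_ball del: power_Suc neq0_conv cong: bex_cong ball_cong)
    ultimately show "(\<forall>j<length ts. ?J j) \<and> ?C \<longleftrightarrow> straight hs ts \<and> closed_in_ball hs M ts"
      unfolding straight_def by blast
  qed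
  finally show ?thesis .
qed

lemma justified_mono: "justified hs s t \<Longrightarrow> set s \<subseteq> set s' \<Longrightarrow> justified hs s' t"
  unfolding justified_def by blast

lemma straight_Cons: "straight hs (t # s) \<longleftrightarrow> justified hs s t \<and> straight hs s"
  by (simp add: straight_def All_less_Suc2)

lemma straight_append: "straight hs s \<Longrightarrow> straight hs s' \<Longrightarrow> straight hs (s @ s')"
  by (induction s) (auto simp: straight_Cons intro: justified_mono)

lemma straight_sound:
  assumes "set hs \<subseteq> lists Letters" "straight hs ts" "set ts \<subseteq> lists Letters"
  shows "ev ` set ts \<subseteq> generate G (ev ` set hs)"
proof -
  have hc: "ev ` set hs \<subseteq> carrier G" using assms(1) ev_closed by blast
  note sub = generate_is_subgroup[OF hc]
  show ?thesis
    using assms(2,3)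
  proof (induction ts)
    case (Cons t s)
    then have IH: "ev u \<in> generate G (ev ` set hs)" if "u \<in> set s" for u
      using that by (auto simp: straight_Cons)
    have t: "ev t \<in> carrier G" using Cons.prems ev_closed by simp
    from Cons.prems have "justified hs s t" by (simp add: straight_Cons)
    then consider "ev t = \<one>" | "t \<in> set hs" | u where "u \<in> set s" "ev t \<otimes> ev u = \<one>"
      | u v where "u \<in> set s" "v \<in> set s" "ev t = ev u \<otimes> ev v"
      unfolding justified_def by blast
    then have "ev t \<in> generate G (ev ` set hs)"
    proof cases
      case 1
      then show ?thesis by (simp add: generate.one)
    next
      case 2
      then show ?thesis by (intro generate.incl) simp
    next
      case 3
      then have "inv (ev u) = ev t"
        using t subgroup.mem_carrier[OF sub IH[OF 3(1)]] by (intro inv_equality)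
      then show ?thesis using subgroup.m_inv_closed[OF sub IH[OF 3(1)]] by simp
    next
      case 4
      then show ?thesis using generate.eng[OF IH IH] by simp
    qed
    then show ?case using IH by auto
  qed simp
qed

lemma straight_complete:
  assumes "h \<in> generate G (ev ` set hs)" "set hs \<subseteq> lists Letters"
  shows "\<exists>ts. straight hs ts \<and> set ts \<subseteq> lists Letters \<and> h \<in> ev ` set ts"
  using assms(1)
proof (induction rule: generate.induct)
  case one
  show ?case
    by (intro exI[of _ "[[]]"]) (simp add: straight_Cons justified_def ev_Nil, simp add: straight_def)
next
  case (incl h)
  then obtain w where "w \<in> set hs" "h = ev w" by blast
  then show ?case using assms(2)
    by (intro exI[of _ "[w]"]) (auto simp: straight_Cons justified_def, simp add: straight_def)
next
  case (inv h)
  then obtain w where w: "w \<in> set hs" "h = ev w" by blast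
  then have wl: "w \<in> lists Letters" using assms(2) by blast
  obtain t where t: "t \<in> lists Letters" "ev t = inv h" using ev_surj[of "inv h"] w ev_closed[OF wl] by auto
  have "straight hs [t, w]"
    using w t ev_closed[OF wl] by (simp add: straight_Cons justified_def) (simp add: straight_def)
  then show ?case using t wl by (intro exI[of _ "[t, w]"]) auto
next
  case (eng h1 h2)
  obtain s1 where s1: "straight hs s1" "set s1 \<subseteq> lists Letters" "h1 \<in> ev ` set s1" using eng.IH(1) by blast
  obtain s2 where s2: "straight hs s2" "set s2 \<subseteq> lists Letters" "h2 \<in> ev ` set s2" using eng.IH(2) by blast
  obtain u v where uv: "u \<in> set s1" "h1 = ev u" "v \<in> set s2" "h2 = ev v" using s1 s2 by blast
  have c: "u \<in> lists Letters" "v \<in> lists Letters" using uv s1(2) s2(2) by blast+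
  have e: "ev (u @ v) = h1 \<otimes> h2" using ev_append[OF c] uv by simp
  have "justified hs (s1 @ s2) (u @ v)" using uv e unfolding justified_def by auto
  then have "straight hs ((u @ v) # s1 @ s2)"
    using straight_append[OF s1(1) s2(1)] by (simp add: straight_Cons)
  then show ?case using e c s1(2) s2(2) by (intro exI[of _ "(u @ v) # s1 @ s2"]) auto
qed

text \<open>
  Derivations can be concatenated, because an entry may use every later one.
\<close>

lemma straight_complete_finite:
  assumes "finite F" "F \<subseteq> generate G (ev ` set hs)" "set hs \<subseteq> lists Letters"
  shows "\<exists>ts. straight hs ts \<and> set ts \<subseteq> lists Letters \<and> F \<subseteq> ev ` set ts"
  using assms(1,2)
proof induction
  case empty
  show ?case by (intro exI[of _ "[]"]) (simp add: straight_def)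
next
  case (insert h F)
  then obtain s1 where s1: "straight hs s1" "set s1 \<subseteq> lists Letters" "F \<subseteq> ev ` set s1" by blast
  obtain s2 where s2: "straight hs s2" "set s2 \<subseteq> lists Letters" "h \<in> ev ` set s2"
    using straight_complete[of h hs] insert.prems assms(3) by blast
  show ?case
    using straight_append[OF s1(1) s2(1)] s1(2,3) s2(2,3) by (intro exI[of _ "s1 @ s2"]) auto
qed

lemma lists_subgroup_ball_sound:
  assumes hs: "set hs \<subseteq> lists Letters" and len: "\<forall>h\<in>set hs. len (ev h) \<le> M"
    and v: "lists_subgroup_ball (encode_lists hs) M (encode_lists ts)"
  shows "set ts \<subseteq> lists Letters" "ev ` set ts \<subseteq> generate G (ev ` set hs)"
    "generate G (ev ` set hs) \<inter> ball M \<subseteq> ev ` set ts"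
proof -
  have ts: "set ts \<subseteq> lists Letters" "straight hs ts" and cl: "closed_in_ball hs M ts"
    using v lists_subgroup_ball_iff[OF hs] by auto
  show "set ts \<subseteq> lists Letters" by (rule ts)
  show "ev ` set ts \<subseteq> generate G (ev ` set hs)" by (rule straight_sound[OF hs ts(2,1)])
  have c: "ev t \<in> carrier G" if "t \<in> set ts" for t using that ts ev_closed by blast
  have cl_one: "\<exists>t\<in>set ts. ev t = \<one>" and cl_gen: "\<forall>h\<in>set hs. \<exists>t\<in>set ts. ev t = ev h"
    and cl_inv: "\<forall>u\<in>set ts. ev u \<in> ball M \<longrightarrow> (\<exists>t\<in>set ts. ev u \<otimes> ev t = \<one>)"
    and cl_mult: "\<forall>u\<in>set ts. \<forall>v\<in>set ts. ev u \<in> ball M \<longrightarrow> ev v \<in> ball M \<longrightarrow>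
      ev u \<otimes> ev v \<in> ball M \<longrightarrow> (\<exists>t\<in>set ts. ev t = ev u \<otimes> ev v)"
    using cl unfolding closed_in_ball_def by blast+
  show "generate G (ev ` set hs) \<inter> ball M \<subseteq> ev ` set ts"
  proof (rule ball_closure)
    show "ev ` set hs \<subseteq> carrier G" using hs ev_closed by blast
    show "len x \<le> M" if "x \<in> ev ` set hs" for x using that len by blast
    show "\<one> \<in> ev ` set ts" using cl_one by force
    show "ev ` set hs \<subseteq> ev ` set ts"
    proof (rule image_subsetI)
      fix h assume "h \<in> set hs"
      then obtain t where "t \<in> set ts" "ev t = ev h" using cl_gen by blast
      then show "ev h \<in> ev ` set ts" by (metis imageI)
    qed
    show "inv x \<in> ev ` set ts" if x: "x \<in> ev ` set ts" "x \<in> ball M" for x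
    proof -
      obtain u where u: "u \<in> set ts" "x = ev u" using x(1) by blast
      obtain t where t: "t \<in> set ts" "ev u \<otimes> ev t = \<one>" using cl_inv u x(2) by blast
      have "inv (ev t) = ev u" using t(2) c[OF t(1)] c[OF u(1)] by (rule inv_equality)
      then have "inv x = ev t" using u(2) c[OF t(1)] by (metis inv_inv)
      then show ?thesis using t(1) by simp
    qed
    show "x \<otimes> y \<in> ev ` set ts"
      if xy: "x \<in> ev ` set ts" "y \<in> ev ` set ts" "x \<in> ball M" "y \<in> ball M" "x \<otimes> y \<in> ball M" for x y
    proof -
      obtain u v where uv: "u \<in> set ts" "x = ev u" "v \<in> set ts" "y = ev v" using xy(1,2) by blast
      then have "\<exists>t\<in>set ts. ev t = ev u \<otimes> ev v" using xy(3-5) cl_mult by simp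
      then show ?thesis using uv by force
    qed
  qed
qed

lemma lists_subgroup_ball_complete:
  assumes hs: "set hs \<subseteq> lists Letters" and len: "\<forall>h\<in>set hs. len (ev h) \<le> M"
  shows "\<exists>ts. lists_subgroup_ball (encode_lists hs) M (encode_lists ts)"
proof -
  let ?H = "generate G (ev ` set hs)"
  have hc: "ev ` set hs \<subseteq> carrier G" using hs ev_closed by blast
  note sub = generate_is_subgroup[OF hc]
  have "finite (?H \<inter> ball M)" using finite_ball[of M] by (simp add: ball_def)
  then obtain ts where ts: "straight hs ts" "set ts \<subseteq> lists Letters" "?H \<inter> ball M \<subseteq> ev ` set ts"
    using straight_complete_finite[of "?H \<inter> ball M" hs] hs by blast
  have H: "ev t \<in> ?H" if "t \<in> set ts" for t using that straight_sound[OF hs ts(1,2)] by blast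
  have in_ts: "\<exists>t\<in>set ts. ev t = x" if "x \<in> ?H" "x \<in> ball M" for x
    using that ts(3) by (metis IntI imageE subsetD)
  have "closed_in_ball hs M ts"
    unfolding closed_in_ball_def
  proof (intro conjI ballI impI)
    show "\<exists>t\<in>set ts. ev t = \<one>"
      by (rule in_ts) (simp_all add: generate.one ball_def len_one)
    show "\<exists>t\<in>set ts. ev t = ev h" if "h \<in> set hs" for h
      by (rule in_ts) (use that len hc in \<open>auto simp: ball_def intro: generate.incl\<close>)
    show "\<exists>t\<in>set ts. ev u \<otimes> ev t = \<one>" if u: "u \<in> set ts" "ev u \<in> ball M" for u
    proof -
      have "inv (ev u) \<in> ?H" "inv (ev u) \<in> ball M"
        using subgroup.m_inv_closed[OF sub H[OF u(1)]] u(2) by (auto simp: ball_def len_inv)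
      then obtain t where "t \<in> set ts" "ev t = inv (ev u)" using in_ts by blast
      then show ?thesis using u(2) by (intro bexI[of _ t]) (simp_all add: ball_def)
    qed
    show "\<exists>t\<in>set ts. ev t = ev u \<otimes> ev v"
      if "u \<in> set ts" "v \<in> set ts" "ev u \<otimes> ev v \<in> ball M" for u v
      using that H subgroup.m_closed[OF sub] by (intro in_ts) auto
  qed
  then show ?thesis using lists_subgroup_ball_iff[OF hs] ts by blast
qed

lemma len_word: "w \<in> lists Letters \<Longrightarrow> len (ev w) \<le> length w"
proof (induction w)
  case Nil
  then show ?case by (simp add: ev_Nil len_one)
next
  case (Cons l w)
  then have l: "[l] \<in> lists Letters" "w \<in> lists Letters" "l \<in> Letters" by auto
  have "len (ev (l # w)) \<le> len (ev [l]) + len (ev w)"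
    using len_mult[OF ev_closed[OF l(1)] ev_closed[OF l(2)]] ev_append[OF l(1,2)] by simp
  then show ?case using len_letter[OF l(3)] Cons l by simp
qed

lemma coded_witness_iff:
  assumes hs: "set hs \<subseteq> lists Letters" and len: "\<forall>h\<in>set hs. len (ev h) \<le> M"
    and v: "lists_subgroup_ball (encode_lists hs) M (encode_lists ts)" and g: "g \<in> lists Letters"
  shows "coded_witness (encode_lists ts) M (list_encode g) \<longleftrightarrow> ev g \<in> ball M \<and> ev g \<notin> generate G (ev ` set hs) \<and>
    (\<exists>k\<in>ev ` set ts. \<exists>k'\<in>ev ` set ts. k \<noteq> \<one> \<and> k \<otimes> ev g = ev g \<otimes> k')"
proof -
  note vs = lists_subgroup_ball_sound[OF hs len v]
  note tw = subsetD[OF vs(1)]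
  have r1: "run 0 (list_encode t) = K (ev t)" "ev t \<in> carrier G" if "t \<in> set ts" for t
    using that tw run_word ev_closed by blast+
  have gr: "run 0 (list_encode g) = K (ev g)" "ev g \<in> carrier G"
    using g run_word ev_closed by blast+
  have r2: "run (K (ev t)) (list_encode g) = K (ev t \<otimes> ev g)"
     "run (K (ev g)) (list_encode t) = K (ev g \<otimes> ev t)" if "t \<in> set ts" for t
    using that tw g run_word2 by blast+
  have W: "coded_witness (encode_lists ts) M (list_encode g) \<longleftrightarrow> ev g \<in> ball M \<and> (\<forall>t\<in>set ts. ev t \<noteq> ev g) \<and>
     (\<exists>k\<in>set ts. \<exists>k'\<in>set ts. ev k \<noteq> \<one> \<and> ev k \<otimes> ev g = ev g \<otimes> ev k')"
    unfolding coded_witness_def using r1 r2 gr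
    by (simp add: K_eq K_eq_0 K_ball del: power_Suc neq0_conv cong: bex_cong ball_cong)
  have B: "(\<forall>t\<in>set ts. ev t \<noteq> ev g) \<longleftrightarrow> ev g \<notin> generate G (ev ` set hs)" if "ev g \<in> ball M"
  proof -
    have "ev g \<in> ev ` set ts \<longleftrightarrow> ev g \<in> generate G (ev ` set hs)"
      using that vs(2,3) by blast
    moreover have "ev g \<in> ev ` set ts \<longleftrightarrow> \<not> (\<forall>t\<in>set ts. ev t \<noteq> ev g)"
      unfolding image_iff by metis
    ultimately show ?thesis by blast
  qed
  show ?thesis
    unfolding W bex_simps(7)
    by (rule conj_cong[OF HOL.refl], rule conj_cong[OF B HOL.refl])
qed

text \<open>
  The bounds of \<open>bounded_witness\<close> for generators of length at most \<open>Suc x\<close>, with the cardinality of the ball of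
  radius \<open>n\<close> estimated by \<open>b ^ Suc n\<close>. The radius covers \<open>g\<close>, \<open>k\<close> and the conjugate of \<open>k\<close> by \<open>g\<close>.
\<close>

definition bound :: "nat \<Rightarrow> nat" where
  "bound x = (let B = 2 * (Suc x + b ^ Suc (2 * Suc x) + 1) in
     2 * B + 2 * (b ^ Suc (Suc x) * b ^ Suc (2 * B)))"

lemma rfun_bound: "rfun1 bound"
  unfolding bound_def Let_def by (intro rfun_rules; simp)

text \<open>
  The code of the input is itself a crude bound for the lengths of the generators, so no maximum
  has to be computed.
\<close>

lemma len_generator:
  assumes "set hs \<subseteq> lists Letters" "h \<in> set hs"
  shows "len (ev h) \<le> encode_lists hs"
proof -
  have "list_encode h \<in> set (map list_encode hs)" using assms(2) by simp
  from elem_le_list_encode[OF this] have "list_encode h < encode_lists hs" by (simp add: encode_lists_def)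
  then show ?thesis
    using len_word[of h] length_le_list_encode[of h] assms by force
qed

lemma bound_ge: "Suc x \<le> bound x"
  by (simp add: bound_def Let_def)

lemma witness_in_bound:
  assumes hs: "set hs \<subseteq> lists Letters"
    and w: "intersection_witness (generate G (ev ` set hs)) g k"
  shows "\<exists>g k k'. g \<in> ball (bound (encode_lists hs)) \<and> g \<notin> generate G (ev ` set hs) \<and>
    k \<in> generate G (ev ` set hs) \<inter> ball (bound (encode_lists hs)) \<and>
    k' \<in> generate G (ev ` set hs) \<inter> ball (bound (encode_lists hs)) \<and> k \<noteq> \<one> \<and> k \<otimes> g = g \<otimes> k'"
proof -
  let ?H = "generate G (ev ` set hs)" and ?x = "encode_lists hs"
  define B where "B = 2 * (Suc ?x + b ^ Suc (2 * Suc ?x) + 1)"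
  define N where "N = b ^ Suc (Suc ?x) * b ^ Suc (2 * B)"
  have bd: "bound ?x = 2 * B + 2 * N" by (simp add: bound_def B_def N_def Let_def)
  have hc: "ev ` set hs \<subseteq> carrier G" using hs ev_closed by blast
  have "\<exists>g k. intersection_witness ?H g k \<and> len g \<le> B \<and>
    len k \<le> 2 * (card (ball (Suc ?x)) * card (ball (2 * B)))"
  proof (rule bounded_witness[OF hc _ w])
    show "len x \<le> Suc ?x" if "x \<in> ev ` set hs" for x using that len_generator[OF hs] le_SucI by blast
    show "2 * (Suc ?x + card (ball (2 * Suc ?x)) + 1) \<le> B"
      unfolding B_def by (intro mult_le_mono2 add_right_mono add_left_mono card_ball)
  qed simp
  then obtain g k where gk: "intersection_witness ?H g k" "len g \<le> B"
    "len k \<le> 2 * (card (ball (Suc ?x)) * card (ball (2 * B)))" by blast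
  have "card (ball (Suc ?x)) * card (ball (2 * B)) \<le> N"
    unfolding N_def by (intro mult_le_mono card_ball)
  then have k: "len k \<le> 2 * N" using gk(3) by linarith
  have c: "g \<in> carrier G" "k \<in> carrier G"
    using gk(1) generate_in_carrier[OF hc] by (auto simp: intersection_witness_def)
  let ?k = "inv g \<otimes> k \<otimes> g"
  have "len ?k \<le> len g + len k + len g"
    using len_mult[of "inv g \<otimes> k" g] len_mult[of "inv g" k] c by (simp add: len_inv)
  then have "len ?k \<le> bound ?x" using gk(2) k bd by linarith
  moreover have "k \<otimes> g = g \<otimes> ?k" using c by (simp add: m_assoc)
  ultimately show ?thesis
    using gk k c bd
    by (intro exI[of _ g] exI[of _ k] exI[of _ ?k]) (auto simp: intersection_witness_def ball_def)
qed

text \<open>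
  With all letters as generators the subgroup is the whole group, so \<open>lists_subgroup_ball\<close> also serves to
  enumerate the ball in which \<open>g\<close> is sought.
\<close>

definition letter_words :: "nat list list" where
  "letter_words = map (\<lambda>l. [l]) (sorted_list_of_set Letters)"

lemma letter_words:
  "set letter_words \<subseteq> lists Letters" "generate G (ev ` set letter_words) = carrier G"
proof -
  have s: "set letter_words = (\<lambda>l. [l]) ` Letters"
    by (simp add: letter_words_def finite_Letters)
  show l: "set letter_words \<subseteq> lists Letters" by (auto simp: s)
  have c: "ev ` set letter_words \<subseteq> carrier G" using l ev_closed by blast
  have "ev w \<in> generate G (ev ` set letter_words)" if "w \<in> lists Letters" for w
    using that
  proof (induction w)
    case Nil
    then show ?case by (simp add: ev_Nil generate.one)
  next
    case (Cons l w)
    then have "ev [l] \<in> generate G (ev ` set letter_words)" by (intro generate.incl) (auto simp: s)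
    then show ?case using generate.eng[of "ev [l]" G _ "ev w"] Cons ev_append[of "[l]" w] by simp
  qed
  then show "generate G (ev ` set letter_words) = carrier G"
    using ev_surj generate_incl[OF c] by blast
qed

lemma len_letter_word: "h \<in> set letter_words \<Longrightarrow> len (ev h) \<le> Suc 0"
  using len_letter finite_Letters by (auto simp: letter_words_def)

text \<open>
  \<open>y\<close> is the answer: \<open>0\<close> for malnormal, and \<open>Suc g\<close> for a witness \<open>g\<close>. The list \<open>T\<close> is for the
  subgroup and \<open>E\<close> for the whole group.
\<close>

definition certificate :: "nat \<Rightarrow> nat \<Rightarrow> nat \<Rightarrow> nat \<Rightarrow> bool" where
  "certificate x y T E \<longleftrightarrow> lists_subgroup_ball x (bound x) T \<and> lists_subgroup_ball (encode_lists letter_words) (bound x) E \<and>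
     (if y = 0 then \<forall>g\<in>set (list_decode E). \<not> coded_witness T (bound x) g
      else \<exists>g\<in>set (list_decode E). Suc g = y \<and> coded_witness T (bound x) g)"

lemma rdec_certificate:
  "rdec (Suc (Suc 0)) (\<lambda>v. certificate (v ! 1) (fst (prod_decode (v ! 0)))
     (fst (prod_decode (snd (prod_decode (v ! 0))))) (snd (prod_decode (snd (prod_decode (v ! 0))))))"
  unfolding certificate_def if_bool_eq_conj
  by (intro rfun_rules rfun_app3[OF rdec_lists_subgroup_ball] rfun_app3[OF rdec_coded_witness] rfun_app1[OF rfun_bound]; simp)

lemma certificate_sound:
  assumes hs: "set hs \<subseteq> lists Letters" and c: "certificate (encode_lists hs) y T E"
  shows "y = 0 \<and> (\<nexists>g k. intersection_witness (generate G (ev ` set hs)) g k) \<or>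
    (\<exists>g\<in>lists Letters. y = Suc (list_encode g) \<and>
       (\<exists>k. intersection_witness (generate G (ev ` set hs)) (ev g) k))"
proof -
  let ?H = "generate G (ev ` set hs)" and ?M = "bound (encode_lists hs)"
  define ts es where "ts = map list_decode (list_decode T)" and "es = map list_decode (list_decode E)"
  have TE: "T = encode_lists ts" "E = encode_lists es" by (simp_all add: encode_lists_def ts_def es_def comp_def)
  have len: "\<forall>h\<in>set hs. len (ev h) \<le> ?M"
    using len_generator[OF hs] bound_ge[of "encode_lists hs"] by (meson Suc_leD le_trans)
  have len': "\<forall>h\<in>set letter_words. len (ev h) \<le> ?M"
    using len_letter_word bound_ge[of "encode_lists hs"] by (meson Suc_le_mono le_trans le0)
  have vT: "lists_subgroup_ball (encode_lists hs) ?M (encode_lists ts)" and vE: "lists_subgroup_ball (encode_lists letter_words) ?M (encode_lists es)"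
    using c by (auto simp: certificate_def TE)
  note T = lists_subgroup_ball_sound[OF hs len vT] and E = lists_subgroup_ball_sound[OF letter_words(1) len' vE]
  note coded_witness = coded_witness_iff[OF hs len vT]
  have hc: "ev ` set hs \<subseteq> carrier G" using hs ev_closed by blast
  have tc: "t \<in> carrier G" if "t \<in> ev ` set ts" for t using that T(2) generate_in_carrier[OF hc] by blast
  show ?thesis
  proof (cases "y = 0")
    case True
    then have no: "\<not> coded_witness (encode_lists ts) ?M (list_encode g)" if "g \<in> set es" for g
      using c that by (simp add: certificate_def TE)
    have False if w: "intersection_witness ?H g k" for g k
    proof -
      obtain g k k' where g: "g \<in> ball ?M" "g \<notin> ?H"
        and k: "k \<in> ?H \<inter> ball ?M" "k' \<in> ?H \<inter> ball ?M" "k \<noteq> \<one>" "k \<otimes> g = g \<otimes> k'"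
        using witness_in_bound[OF hs w] by blast
      \<comment> \<open>The list \<open>E\<close> has a word for every element of the ball, so the witness would have been found.\<close>
      have "g \<in> carrier G \<inter> ball ?M" using g by (simp add: ball_def)
      then obtain w where w: "w \<in> set es" "g = ev w" using E(3) letter_words(2) by blast
      have "k \<in> ev ` set ts" "k' \<in> ev ` set ts" using k T(3) by blast+
      then have "coded_witness (encode_lists ts) ?M (list_encode w)"
        using coded_witness[of w] w E(1) g k by blast
      then show False using no w by blast
    qed
    then show ?thesis using True by blast
  next
    case False
    then obtain g where g: "g \<in> set es" "y = Suc (list_encode g)" "coded_witness (encode_lists ts) ?M (list_encode g)"
      using c by (auto simp: certificate_def TE)
    have gl: "g \<in> lists Letters" using g E(1) by blast
    have gc: "ev g \<in> carrier G" by (rule ev_closed[OF gl])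
    obtain k k' where k: "ev g \<notin> ?H" "k \<in> ev ` set ts" "k' \<in> ev ` set ts" "k \<noteq> \<one>" "k \<otimes> ev g = ev g \<otimes> k'"
      using coded_witness[OF gl] g(3) by blast
    have "inv (ev g) \<otimes> k \<otimes> ev g = k'" using k gc tc by (simp add: m_assoc)
    then have "intersection_witness ?H (ev g) k"
      using k gc T(2) unfolding intersection_witness_def by blast
    then show ?thesis using gl g(2) by blast
  qed
qed

lemma certificate_complete:
  assumes hs: "set hs \<subseteq> lists Letters"
  shows "\<exists>y T E. certificate (encode_lists hs) y T E"
proof -
  let ?M = "bound (encode_lists hs)"
  have len: "\<forall>h\<in>set hs. len (ev h) \<le> ?M"
    using len_generator[OF hs] bound_ge[of "encode_lists hs"] by (meson Suc_leD le_trans)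
  have len': "\<forall>h\<in>set letter_words. len (ev h) \<le> ?M"
    using len_letter_word bound_ge[of "encode_lists hs"] by (meson Suc_le_mono le_trans le0)
  obtain T where T: "lists_subgroup_ball (encode_lists hs) ?M T" using lists_subgroup_ball_complete[OF hs len] by blast
  obtain E where E: "lists_subgroup_ball (encode_lists letter_words) ?M E" using lists_subgroup_ball_complete[OF letter_words(1) len'] by blast
  show ?thesis
  proof (cases "\<exists>g\<in>set (list_decode E). coded_witness T ?M g")
    case True
    then obtain g where "g \<in> set (list_decode E)" "coded_witness T ?M g" by blast
    then have "certificate (encode_lists hs) (Suc g) T E" using T E by (auto simp: certificate_def)
    then show ?thesis by blast
  next
    case False
    then have "certificate (encode_lists hs) 0 T E" using T E by (auto simp: certificate_def)
    then show ?thesis by blast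
  qed
qed

text \<open>
  The program searches for a triple \<open>(y, T, E)\<close> and returns its first component. It halts since
  certificates exist, and every certificate has a correct answer.
\<close>

theorem witness_search:
  "\<exists>p. \<forall>hs. set hs \<subseteq> lists Letters \<longrightarrow> (\<exists>y. eval p [encode_lists hs] y \<and>
     (y = 0 \<and> (\<nexists>g k. intersection_witness (generate G (ev ` set hs)) g k) \<or>
      (\<exists>g\<in>lists Letters. y = Suc (list_encode g) \<and>
         (\<exists>k. intersection_witness (generate G (ev ` set hs)) (ev g) k))))"
proof -
  let ?C = "\<lambda>n x. certificate x (fst (prod_decode n)) (fst (prod_decode (snd (prod_decode n))))
    (snd (prod_decode (snd (prod_decode n))))"
  have "rdec (Suc (Suc 0)) (\<lambda>v. ?C (v ! 0) (tl v ! 0))"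
    by (rule rfun_cong[OF rdec_certificate]) (auto simp: nth_tl)
  from eval_search[of "Suc 0" "\<lambda>n v. ?C n (v ! 0)", OF this]
  obtain p where "\<forall>v. length v = Suc 0 \<longrightarrow> (\<exists>n. ?C n (v ! 0)) \<longrightarrow> eval p v (LEAST n. ?C n (v ! 0))"
    by (elim exE)
  from this[rule_format, of "[_]"]
  have p: "(\<exists>n. ?C n x) \<Longrightarrow> eval p [x] (LEAST n. ?C n x)" for x
    by simp
  have "rfun1 (\<lambda>n. fst (prod_decode n))" by (intro rfun_rules; simp)
  then obtain q where q: "length v = Suc 0 \<Longrightarrow> eval q v (fst (prod_decode (v ! 0)))" for v
    unfolding rfun_def by blast
  have "\<exists>y. eval (Comp q [p]) [encode_lists hs] y \<and>
     (y = 0 \<and> (\<nexists>g k. intersection_witness (generate G (ev ` set hs)) g k) \<or>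
      (\<exists>g\<in>lists Letters. y = Suc (list_encode g) \<and>
         (\<exists>k. intersection_witness (generate G (ev ` set hs)) (ev g) k)))"
    if hs: "set hs \<subseteq> lists Letters" for hs
  proof -
    obtain y T E where "certificate (encode_lists hs) y T E" using certificate_complete[OF hs] by blast
    then have "?C (prod_encode (y, prod_encode (T, E))) (encode_lists hs)" by simp
    then have ex: "\<exists>n. ?C n (encode_lists hs)" by blast
    define n where "n = (LEAST n. ?C n (encode_lists hs))"
    have "?C n (encode_lists hs)" unfolding n_def by (rule LeastI_ex[OF ex])
    note sound = certificate_sound[OF hs this]
    have "eval (Comp q [p]) [encode_lists hs] (fst (prod_decode n))"
      using q[of "[n]"] p[OF ex] by (intro eval.Comp[of _ _ "[n]"]) (simp_all add: n_def)
    then show ?thesis using sound by blast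
  qed
  then show ?thesis by blast
qed

end

section \<open>Deciding malnormality\<close>

context length_group
begin

lemma conjugate_iff:
  assumes "g \<in> carrier G" "H \<subseteq> carrier G"
  shows "x \<in> conjugate G g H \<longleftrightarrow> (\<exists>h\<in>H. x = g \<otimes> h \<otimes> inv g)"
  using assms by (auto simp: conjugate_def l_coset_def r_coset_def)

text \<open>
  The identity lies in both subgroups, so an intersection different from \<open>{\<one>}\<close> has a further element.
\<close>

lemma witness_iff_conjugate:
  assumes H: "subgroup H G"
  shows "(\<exists>k. intersection_witness H g k) \<longleftrightarrow>
    g \<in> carrier G - H \<and> conjugate G g H \<inter> H \<noteq> {\<one>}"
proof -
  note Hc = subgroup.subset[OF H]
  have one: "\<one> \<in> conjugate G g H \<inter> H" if "g \<in> carrier G"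
    using conjugate_iff[OF that Hc, of \<one>] subgroup.one_closed[OF H] that by force
  have conj: "k \<in> conjugate G g H \<longleftrightarrow> inv g \<otimes> k \<otimes> g \<in> H" if g: "g \<in> carrier G" and k: "k \<in> H" for k
  proof -
    have kc: "k \<in> carrier G" using k Hc by blast
    have inv1: "inv g \<otimes> (g \<otimes> h \<otimes> inv g) \<otimes> g = h" if "h \<in> carrier G" for h
      using that g by (simp add: m_assoc)
    have inv2: "g \<otimes> (inv g \<otimes> k \<otimes> g) \<otimes> inv g = k"
      using g kc by (simp add: m_assoc)
    show ?thesis
      unfolding conjugate_iff[OF g Hc] using inv1 inv2 Hc by (metis subsetD)
  qed
  show ?thesis
  proof (cases "g \<in> carrier G - H")
    case True
    then have "\<one> \<in> conjugate G g H \<inter> H" using one by simp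
    then have "conjugate G g H \<inter> H \<noteq> {\<one>} \<longleftrightarrow> (\<exists>k\<in>H. k \<noteq> \<one> \<and> k \<in> conjugate G g H)"
      by auto
    then show ?thesis using True conj unfolding intersection_witness_def by blast
  next
    case False
    then show ?thesis unfolding intersection_witness_def by blast
  qed
qed

lemma malnormal_iff:
  assumes "subgroup H G"
  shows "malnormal H G \<longleftrightarrow> (\<nexists>g k. intersection_witness H g k)"
  using witness_iff_conjugate[OF assms] assms unfolding malnormal_def by blast

end

context presented_amalgam
begin

sublocale amalgamated_product factor A \<phi> G \<iota> nf
  by (rule amalgamated_product)

definition letter_code :: "('x \<Rightarrow> nat) \<Rightarrow> 'x \<times> bool \<Rightarrow> nat" where
  "letter_code c = (\<lambda>(x, b). prod_encode (c x, of_bool b))"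

definition decode :: "('x \<Rightarrow> nat) \<Rightarrow> nat list \<Rightarrow> 'x word" where
  "decode c = map (inv_into (X \<times> UNIV) (letter_code c))"

lemma letter_code_inj: "inj_on c X \<Longrightarrow> inj_on (letter_code c) (X \<times> UNIV)"
  by (auto simp: inj_on_def letter_code_def)

lemma decode_map:
  assumes "inj_on c X" "w \<in> words X"
  shows "decode c (map (letter_code c) w) = w"
  using assms(2) inv_into_f_f[OF letter_code_inj[OF assms(1)]]
  by (auto simp: decode_def words_def comp_def intro!: map_idI)

lemma decode_words:
  assumes "w \<in> lists (letter_code c ` (X \<times> UNIV))"
  shows "decode c w \<in> words X" "map (letter_code c) (decode c w) = w"
proof -
  have l: "l \<in> letter_code c ` (X \<times> UNIV)" if "l \<in> set w" for l using assms that by auto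
  show "decode c w \<in> words X"
    unfolding decode_def words_def in_lists_conv_set using inv_into_into[OF l] by auto
  show "map (letter_code c) (decode c w) = w"
    unfolding decode_def using f_inv_into_f[OF l] by (simp add: map_idI)
qed

lemma code_words: "w \<in> words X \<Longrightarrow> map (letter_code c) w \<in> lists (letter_code c ` (X \<times> UNIV))"
  by (simp add: words_def in_lists_conv_set)

lemma nf_letter:
  assumes "g \<in> carrier G" "fst l \<in> X"
  shows "nf (g \<otimes>\<^bsub>G\<^esub> cl [l]) = act (side l) (fcl (side l) [l]) (nf g)"
  using nf_mult[OF assms(1) fcl_closed[OF letter_side[OF assms(2)]]] \<iota>_class[OF letter_side[OF assms(2)]]
  by simp

text \<open>
  The step function of the numbering is pieced together from tables for the finitely many pairs of a
  letter and a number below \<open>b\<^sup>2\<close>.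
\<close>

lemma coded_length_group_presented:
  assumes fin: "finite X" and c: "inj_on c X"
  shows "\<exists>K b step. coded_length_group G len (letter_code c ` (X \<times> UNIV)) (\<lambda>w. cl (decode c w)) K b step"
proof -
  obtain b code where b: "b > (1::nat)" and code_inj: "inj_on code states"
    and code_start: "code ([], \<one>\<^bsub>A\<^esub>) = 0"
    and code_less: "\<And>s a n. (s, a) \<in> states \<Longrightarrow> code (s, a) < b ^ Suc n \<longleftrightarrow> length s \<le> n"
    and code_act: "\<And>i x. \<exists>m v. \<forall>\<omega>\<in>states. code (act i x \<omega>) =
       code \<omega> div b\<^sup>2 * m (code \<omega> mod b\<^sup>2) + v (code \<omega> mod b\<^sup>2)"
    by (rule state_coding) blast
  obtain m v where mv: "\<And>i x \<omega>. \<omega> \<in> states \<Longrightarrow> code (act i x \<omega>) =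
       code \<omega> div b\<^sup>2 * m i x (code \<omega> mod b\<^sup>2) + v i x (code \<omega> mod b\<^sup>2)"
    using code_act by metis
  let ?L = "letter_code c ` (X \<times> UNIV)"
  define dl where "dl = inv_into (X \<times> UNIV) (letter_code c)"
  have dl: "fst (dl l) \<in> X" if "l \<in> ?L" for l
    using inv_into_into[OF that] unfolding dl_def by auto
  have decode1: "decode c [l] = [dl l]" for l by (simp add: decode_def dl_def)
  define S where "S = prod_encode ` (?L \<times> {..<b\<^sup>2})"
  have finS: "finite S" using fin unfolding S_def by auto
  define mf where "mf j = (let l = dl (fst (prod_decode j)) in
    m (side l) (fcl (side l) [l]) (snd (prod_decode j)))" for j
  define vf where "vf j = (let l = dl (fst (prod_decode j)) in
    v (side l) (fcl (side l) [l]) (snd (prod_decode j)))" for j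
  obtain mt where mt: "rfun1 mt" "\<forall>j\<in>S. mt j = mf j" using rfun_table[OF finS] by blast
  obtain vt where vt: "rfun1 vt" "\<forall>j\<in>S. vt j = vf j" using rfun_table[OF finS] by blast
  define st where "st n l = n div b\<^sup>2 * mt (prod_encode (l, n mod b\<^sup>2)) + vt (prod_encode (l, n mod b\<^sup>2))" for n l
  define K where "K g = code (nf g)" for g
  have "coded_length_group G len ?L (\<lambda>w. cl (decode c w)) K b st"
  proof (intro coded_length_group.intro coded_length_group_axioms.intro length_group_len)
    show "finite ?L" using fin by simp
    show "cl (decode c w) \<in> carrier G" if "w \<in> lists ?L" for w
      using decode_words(1)[OF that] by (rule cl_closed)
    show "cl (decode c []) = \<one>\<^bsub>G\<^esub>" by (simp add: decode_def cl_Nil)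
    show "cl (decode c (u @ w)) = cl (decode c u) \<otimes>\<^bsub>G\<^esub> cl (decode c w)"
      if "u \<in> lists ?L" "w \<in> lists ?L" for u w
      using cl_mult[OF decode_words(1)[OF that(1)] decode_words(1)[OF that(2)]] by (simp add: decode_def)
    show "\<exists>w\<in>lists ?L. cl (decode c w) = g" if g: "g \<in> carrier G" for g
    proof -
      obtain w where w: "w \<in> words X" "g = cl w" by (rule G_elem[OF g])
      then show ?thesis using decode_map[OF c w(1)] code_words[OF w(1)]
        by (intro bexI[of _ "map (letter_code c) w"]) simp_all
    qed
    show "len (cl (decode c [l])) \<le> 1" if "l \<in> ?L" for l
    proof -
      have "nf (cl [dl l]) = act (side (dl l)) (fcl (side (dl l)) [dl l]) ([], \<one>\<^bsub>A\<^esub>)"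
        using nf_class[of "[dl l]"] dl[OF that] by (simp add: step_def)
      then show ?thesis
        unfolding decode1 by (simp add: len_def act_def pop_def push_def free_top_def)
    qed
    show "inj_on K (carrier G)"
      unfolding K_def using nf_inj code_inj nf_states by (auto simp: inj_on_def)
    show "K \<one>\<^bsub>G\<^esub> = 0" by (simp add: K_def nf_one code_start)
    show "K g < b ^ Suc n \<longleftrightarrow> len g \<le> n" if "g \<in> carrier G" for g n
      using code_less[of "fst (nf g)" "snd (nf g)" n] nf_states[OF that] by (simp add: K_def len_def)
    show "K (g \<otimes>\<^bsub>G\<^esub> cl (decode c [l])) = st (K g) l" if g: "g \<in> carrier G" and l: "l \<in> ?L" for g l
    proof -
      have "prod_encode (l, code (nf g) mod b\<^sup>2) \<in> S" using l b by (auto simp: S_def)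
      then show ?thesis
        using mv[OF nf_states[OF g]] mt(2) vt(2)
        by (simp add: K_def decode1 nf_letter[OF g dl[OF l]] st_def mf_def vf_def Let_def)
    qed
    show "rfun2 st"
      unfolding st_def
      by (intro rfun_add rfun_mult rfun_div rfun_app1[OF mt(1)] rfun_app1[OF vt(1)] rfun_prod_encode
          rfun_mod rfun_const rfun_nth; simp)
  qed
  then show ?thesis by blast
qed

lemma generate_subgroup: "set hs \<subseteq> words X \<Longrightarrow> subgroup (generate G (cl ` set hs)) G"
  using cl_closed by (intro G.generate_is_subgroup) blast

theorem malnormality_decidable:
  assumes fin: "finite X" and c: "inj_on c X"
  shows "\<exists>p. \<forall>hs\<in>lists (words X). \<exists>ans. eval p [encode_words c hs] (encode_answer c ans) \<and>
     (case ans of None \<Rightarrow> malnormal (generate G (cl ` set hs)) G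
      | Some w \<Rightarrow> w \<in> words X \<and> cl w \<in> carrier G - generate G (cl ` set hs) \<and>
          conjugate G (cl w) (generate G (cl ` set hs)) \<inter> generate G (cl ` set hs) \<noteq> {\<one>\<^bsub>G\<^esub>})"
proof -
  let ?L = "letter_code c ` (X \<times> UNIV)" and ?ev = "\<lambda>w. cl (decode c w)"
  obtain K b st where "coded_length_group G len ?L ?ev K b st"
    using coded_length_group_presented[OF fin c] by blast
  then interpret C: coded_length_group G len ?L ?ev K b st .
  obtain p where p: "\<forall>hs. set hs \<subseteq> lists ?L \<longrightarrow> (\<exists>y. eval p [C.encode_lists hs] y \<and>
     (y = 0 \<and> (\<nexists>g k. C.intersection_witness (generate G (?ev ` set hs)) g k) \<or>
      (\<exists>g\<in>lists ?L. y = Suc (list_encode g) \<and>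
         (\<exists>k. C.intersection_witness (generate G (?ev ` set hs)) (?ev g) k))))"
    using C.witness_search by (rule exE)
  show ?thesis
  proof (intro exI[of _ p] ballI)
    fix hs assume hs: "hs \<in> lists (words X)"
    let ?H = "generate G (cl ` set hs)" and ?hs = "map (map (letter_code c)) hs"
    have sub: "subgroup ?H G" using hs by (intro generate_subgroup) auto
    have L: "set ?hs \<subseteq> lists ?L" using hs code_words by auto
    have "?ev (map (letter_code c) h) = cl h" if "h \<in> set hs" for h
      using decode_map[OF c, of h] hs that by auto
    then have ev: "?ev ` set ?hs = cl ` set hs" by (force simp: image_iff)
    have enc: "C.encode_lists ?hs = encode_words c hs"
      unfolding C.encode_lists_def encode_words_def list_encode_eq
      by (simp add: encode_word_def letter_code_def)
    obtain y where y: "eval p [encode_words c hs] y"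
      "y = 0 \<and> (\<nexists>g k. C.intersection_witness ?H g k) \<or>
      (\<exists>g\<in>lists ?L. y = Suc (list_encode g) \<and> (\<exists>k. C.intersection_witness ?H (?ev g) k))"
      using p[rule_format, OF L] unfolding ev enc by blast
    from y(2) show "\<exists>ans. eval p [encode_words c hs] (encode_answer c ans) \<and>
     (case ans of None \<Rightarrow> malnormal ?H G
      | Some w \<Rightarrow> w \<in> words X \<and> cl w \<in> carrier G - ?H \<and> conjugate G (cl w) ?H \<inter> ?H \<noteq> {\<one>\<^bsub>G\<^esub>})"
    proof (elim disjE conjE bexE)
      assume "y = 0" "\<nexists>g k. C.intersection_witness ?H g k"
      then show ?thesis
        using y(1) C.malnormal_iff[OF sub] by (intro exI[of _ None]) (simp add: encode_answer_def)
    next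
      fix g assume g: "g \<in> lists ?L" "y = Suc (list_encode g)" "\<exists>k. C.intersection_witness ?H (?ev g) k"
      note d = decode_words[OF g(1)]
      have "list_encode g = encode_word c (decode c g)"
        unfolding encode_word_def by (subst d(2)[symmetric]) (simp add: letter_code_def)
      then have "encode_answer c (Some (decode c g)) = y" by (simp add: encode_answer_def g(2))
      then show ?thesis
        using y(1) d(1) g(3) C.witness_iff_conjugate[OF sub, of "?ev g"]
        by (intro exI[of _ "Some (decode c g)"]) simp
    qed
  qed
qed

end

theorem corollary7p12:
  fixes X1 X2 :: "'x set" and R1 R2 :: "'x word set"
    and A :: "('a, 'm) monoid_scheme" and Y :: "'a set"
    and \<phi>1 \<phi>2 :: "'a \<Rightarrow> 'x word set"
    and c :: "'x \<Rightarrow> nat"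
  defines "X \<equiv> X1 \<union> X2"
    and "R \<equiv> amalgam_relators R1 R2 Y \<phi>1 \<phi>2"
  defines "G \<equiv> presented_group X R"
  assumes "amalgam_of_finite_groups X1 R1 X2 R2 A Y \<phi>1 \<phi>2"
    and "inj_on c X"
  shows "\<exists>alg :: 'x word list \<Rightarrow> 'x word option.
    computable_on (lists (words X)) (encode_words c) (encode_answer c) alg \<and>
    (\<forall>hs \<in> lists (words X).
       let H = generate G (word_class X R ` set hs) in
       case alg hs of
         None \<Rightarrow> malnormal H G
       | Some w \<Rightarrow> \<not> malnormal H G \<and> w \<in> words X \<and>
           (let g = word_class X R w in
              g \<in> carrier G - H \<and> g \<noteq> \<one>\<^bsub>G\<^esub> \<and> H \<inter> conjugate G g H \<noteq> {\<one>\<^bsub>G\<^esub>}))"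
proof -
  define Xs where "Xs i = (if i then X1 else X2)" for i
  define Rs where "Rs i = (if i then R1 else R2)" for i
  define \<phi> where "\<phi> i = (if i then \<phi>1 else \<phi>2)" for i
  note am = assms(4)[unfolded amalgam_of_finite_groups_def]
  interpret P: presented_amalgam Xs Rs A Y \<phi>
  proof (rule presented_amalgam.intro)
    show "Xs True \<inter> Xs False = {}" using am by (simp add: Xs_def)
    show "Rs i \<subseteq> words (Xs i)" for i using am by (simp add: Xs_def Rs_def)
    show "finite (carrier (presented_group (Xs i) (Rs i)))" for i using am by (simp add: Xs_def Rs_def)
    show "group A" "Y \<subseteq> carrier A" "generate A Y = carrier A" using am by blast+
    show "\<phi> i \<in> mon A (presented_group (Xs i) (Rs i))" for i using am by (simp add: Xs_def Rs_def \<phi>_def)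
  qed
  have X: "P.X = X" by (simp add: P.X_def X_def Xs_def)
  have R: "P.R = R" by (simp add: P.R_def R_def Rs_def \<phi>_def)
  have G: "P.G = G" by (simp add: P.G_def G_def X R)
  have fin: "finite X" using am by (simp add: X_def)
  let ?H = "\<lambda>hs. generate G (word_class X R ` set hs)"
  let ?Q = "\<lambda>hs ans. case ans of None \<Rightarrow> malnormal (?H hs) G
      | Some w \<Rightarrow> w \<in> words X \<and> word_class X R w \<in> carrier G - ?H hs \<and>
          conjugate G (word_class X R w) (?H hs) \<inter> ?H hs \<noteq> {\<one>\<^bsub>G\<^esub>}"
  obtain p where "\<forall>hs\<in>lists (words X). \<exists>ans. eval p [encode_words c hs] (encode_answer c ans) \<and> ?Q hs ans"
    using P.malnormality_decidable[unfolded X R G, OF fin assms(5)] by blast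
  from bchoice[OF this] obtain alg where alg:
    "\<forall>hs\<in>lists (words X). eval p [encode_words c hs] (encode_answer c (alg hs)) \<and> ?Q hs (alg hs)"
    by blast
  have sub: "subgroup (?H hs) G" if "hs \<in> lists (words X)" for hs
    using P.generate_subgroup[of hs, unfolded X R G] that by auto
  show ?thesis
  proof (intro exI[of _ alg] conjI ballI)
    show "computable_on (lists (words X)) (encode_words c) (encode_answer c) alg"
      unfolding computable_on_def using alg by blast
    fix hs assume hs: "hs \<in> lists (words X)"
    then have Q: "?Q hs (alg hs)" using alg by blast
    have one: "\<one>\<^bsub>G\<^esub> \<in> ?H hs" using sub[OF hs] by (rule subgroup.one_closed)
    show "let H = ?H hs in
       case alg hs of
         None \<Rightarrow> malnormal H G
       | Some w \<Rightarrow> \<not> malnormal H G \<and> w \<in> words X \<and>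
           (let g = word_class X R w in
              g \<in> carrier G - H \<and> g \<noteq> \<one>\<^bsub>G\<^esub> \<and> H \<inter> conjugate G g H \<noteq> {\<one>\<^bsub>G\<^esub>})"
    proof (cases "alg hs")
      case None
      then show ?thesis using Q by simp
    next
      case (Some w)
      with Q have w: "w \<in> words X" "word_class X R w \<in> carrier G - ?H hs"
        "conjugate G (word_class X R w) (?H hs) \<inter> ?H hs \<noteq> {\<one>\<^bsub>G\<^esub>}" by auto
      have "\<not> malnormal (?H hs) G" using w(2,3) unfolding malnormal_def by blast
      moreover have "word_class X R w \<noteq> \<one>\<^bsub>G\<^esub>" using w(2) one by auto
      ultimately show ?thesis using Some w by (simp add: Let_def Int_commute)
    qed
  qed
qed

end
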